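(* Let $N\geq 2$. For every $\beta>0$ there exists a constant $K>0$ depending only on $\beta$ (and the dimension $N$) such that for every $u\in\mathcal{A}_{\beta}$, $$\begin{aligned}\delta_{1,\mathbb{H}}(u)&\geq K\inf_{0<\lambda\leq\beta,\,c\in\mathbb{R}}\int_{\mathbb{H}^{N}}\left|u-ce^{-\frac{\rho^{2}(x)}{2\lambda^{2}}}\right|^{2}dV_{\mathbb{H}}\\&\geq K\inf_{0<\lambda\leq\beta,\,c\in\mathbb{R}}\left\|u-ce^{-\frac{\rho^{2}(x)}{2\lambda^{2}}}\right\|_{L^{2}(\mathbb{H}^{N})}^{2}.\end{aligned}$$ Consequently, $$\begin{aligned}\delta_{2,\mathbb{H}}(u)\geq{}&K\left(\int_{\mathbb{H}^{N}}\left[N+(N-1)\frac{\rho(x)\cosh\rho(x)-\sinh\rho(x)}{\sinh\rho(x)}\right]|u|^{2}dV_{\mathbb{H}}\right)\inf_{0<\lambda\leq\beta,\,c\in\mathbb{R}}\left\|u-ce^{-\frac{\rho^{2}(x)}{2\lambda^{2}}}\right\|_{L^{2}(\mathbb{H}^{N})}^{2}\\&+K^{2}\inf_{0<\lambda\leq\beta,\,c\in\mathbb{R}}\left\|u-ce^{-\frac{\rho^{2}(x)}{2\lambda^{2}}}\right\|_{L^{2}(\mathbb{H}^{N})}^{4}.\end{aligned}$$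
   Context: $\mathbb{H}^{N}$ is the hyperbolic space in the Poincaré ball model: the Euclidean unit ball with Riemannian metric $\left(\frac{2}{1-|x|^{2}}\right)^{2}dx^{2}$, volume element $dV_{\mathbb{H}}=\left(\frac{2}{1-|x|^{2}}\right)^{N}dx$, Riemannian gradient $\nabla_{\mathbb{H}}=\left(\frac{1-|x|^{2}}{2}\right)^{2}\nabla$; $|\nabla_{\mathbb H}u|$ is the Riemannian norm. $\rho(x)=\log\frac{1+|x|}{1-|x|}$ is the hyperbolic distance from $x$ to $0$. Functions are real-valued. For $\beta>0$, $$\mathcal{A}_{\beta}=\left\{u\in W^{1,2}(\mathbb{H}^{N}):\ \int_{\mathbb{H}^{N}}\rho^{2}|u|^{2}dV_{\mathbb{H}}<\infty\ \text{and}\ \frac{\int_{\mathbb{H}^{N}}\rho^{2}|u|^{2}dV_{\mathbb{H}}}{\int_{\mathbb{H}^{N}}|\nabla_{\mathbb{H}}u|^{2}dV_{\mathbb{H}}}\leq\beta^{4}\right\}$$ (with $u\neq0$ so that the quotient makes sense). The Heisenberg deficits are $$\delta_{1,\mathbb{H}}(u)=\left(\int_{\mathbb{H}^{N}}|\nabla_{\mathbb{H}}u|^{2}dV_{\mathbb{H}}\right)^{1/2}\left(\int_{\mathbb{H}^{N}}\rho^{2}|u|^{2}dV_{\mathbb{H}}\right)^{1/2}-\frac12\int_{\mathbb{H}^{N}}\left(N+(N-1)\frac{\rho\cosh\rho-\sinh\rho}{\sinh\rho}\right)|u|^{2}dV_{\mathbb{H}},$$ $$\delta_{2,\mathbb{H}}(u)=\left(\int_{\mathbb{H}^{N}}|\nabla_{\mathbb{H}}u|^{2}dV_{\mathbb{H}}\right)\left(\int_{\mathbb{H}^{N}}\rho^{2}|u|^{2}dV_{\mathbb{H}}\right)-\frac14\left(\int_{\mathbb{H}^{N}}\left[N+(N-1)\frac{\rho\cosh\rho-\sinh\rho}{\sinh\rho}\right]|u|^{2}dV_{\mathbb{H}}\right)^{2}.$$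 *)

theory Defs
  imports "HOL-Analysis.Analysis"
begin

text \<open>
  The hyperbolic space \<open>\<H>\<^sup>N\<close> in the Poincare ball model is the open unit ball of an
  \<open>N\<close>-dimensional Euclidean space \<open>'a\<close>, with \<open>N = DIM('a)\<close>.  Functions on \<open>\<H>\<^sup>N\<close> are total
  functions on \<open>'a\<close> of which only the values on the open unit ball are ever used.
\<close>

abbreviation hyp_ball :: "'a::euclidean_space set" where
  "hyp_ball \<equiv> ball 0 1"

definition hyp_volume :: "'a::euclidean_space measure" where
  "hyp_volume =
     density (lebesgue_on hyp_ball) (\<lambda>x. ennreal ((2 / (1 - (norm x)\<^sup>2)) ^ DIM('a)))"

definition hyp_dist0 :: "'a::euclidean_space \<Rightarrow> real" where
  "hyp_dist0 x = ln ((1 + norm x) / (1 - norm x))"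

fun C_k :: "nat \<Rightarrow> ('a::euclidean_space \<Rightarrow> real) \<Rightarrow> bool" where
  "C_k 0 f \<longleftrightarrow> continuous_on UNIV f"
| "C_k (Suc k) f \<longleftrightarrow>
     (\<forall>x. f differentiable (at x)) \<and>
     (\<forall>i\<in>Basis. C_k k (\<lambda>x. frechet_derivative f (at x) i))"

definition test_function :: "('a::euclidean_space \<Rightarrow> real) \<Rightarrow> bool" where
  "test_function \<phi> \<longleftrightarrow>
     (\<forall>k. C_k k \<phi>) \<and> compact (closure {x. \<phi> x \<noteq> 0}) \<and> closure {x. \<phi> x \<noteq> 0} \<subseteq> hyp_ball"

definition locally_integrable ::
    "('a::euclidean_space \<Rightarrow> 'b::euclidean_space) \<Rightarrow> bool" where
  "locally_integrable f \<longleftrightarrow>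
     (\<forall>S. compact S \<and> S \<subseteq> hyp_ball \<longrightarrow> f absolutely_integrable_on S)"

definition has_weak_gradient ::
    "('a::euclidean_space \<Rightarrow> real) \<Rightarrow> ('a \<Rightarrow> 'a) \<Rightarrow> bool" where
  "has_weak_gradient u g \<longleftrightarrow>
     locally_integrable u \<and> locally_integrable g \<and>
     (\<forall>\<phi>. test_function \<phi> \<longrightarrow>
        (\<forall>i\<in>Basis.
           (LINT x:hyp_ball|lebesgue. u x * frechet_derivative \<phi> (at x) i) =
           - (LINT x:hyp_ball|lebesgue. (g x \<bullet> i) * \<phi> x)))"

text \<open>A weak gradient is unique up to null sets, so the choice below affects no integral.\<close>

definition weak_gradient :: "('a::euclidean_space \<Rightarrow> real) \<Rightarrow> 'a \<Rightarrow> 'a" where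
  "weak_gradient u = (SOME g. has_weak_gradient u g)"

definition hyp_gradient :: "('a::euclidean_space \<Rightarrow> real) \<Rightarrow> 'a \<Rightarrow> 'a" where
  "hyp_gradient u x = ((1 - (norm x)\<^sup>2) / 2)\<^sup>2 *\<^sub>R weak_gradient u x"

text \<open>The length of a tangent vector \<open>v\<close> at the point \<open>x\<close> in the metric \<open>(2 / (1 - |x|\<^sup>2))\<^sup>2 dx\<^sup>2\<close>.\<close>

definition riem_norm :: "'a::euclidean_space \<Rightarrow> 'a \<Rightarrow> real" where
  "riem_norm x v = 2 / (1 - (norm x)\<^sup>2) * norm v"

definition hyp_L2 :: "('a::euclidean_space \<Rightarrow> real) set" where
  "hyp_L2 = {u. u \<in> borel_measurable hyp_volume \<and> integrable hyp_volume (\<lambda>x. \<bar>u x\<bar>\<^sup>2)}"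

definition hyp_L2_norm :: "('a::euclidean_space \<Rightarrow> real) \<Rightarrow> real" where
  "hyp_L2_norm u = sqrt (LINT x|hyp_volume. \<bar>u x\<bar>\<^sup>2)"

definition hyp_W12 :: "('a::euclidean_space \<Rightarrow> real) set" where
  "hyp_W12 = {u \<in> hyp_L2. (\<exists>g. has_weak_gradient u g) \<and>
      integrable hyp_volume (\<lambda>x. (riem_norm x (hyp_gradient u x))\<^sup>2)}"

definition hyp_dirichlet :: "('a::euclidean_space \<Rightarrow> real) \<Rightarrow> real" where
  "hyp_dirichlet u = (LINT x|hyp_volume. (riem_norm x (hyp_gradient u x))\<^sup>2)"

definition hyp_moment :: "('a::euclidean_space \<Rightarrow> real) \<Rightarrow> real" where
  "hyp_moment u = (LINT x|hyp_volume. (hyp_dist0 x)\<^sup>2 * \<bar>u x\<bar>\<^sup>2)"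

text \<open>
  Elements of \<open>W\<^sup>1\<^sup>,\<^sup>2\<close> are functions rather than classes modulo null sets, so \<open>u \<noteq> 0\<close> reads
  ``not almost everywhere zero''.
\<close>

definition class_A :: "real \<Rightarrow> ('a::euclidean_space \<Rightarrow> real) set" where
  "class_A \<beta> = {u \<in> hyp_W12.
      \<not> (AE x in hyp_volume. u x = 0) \<and>
      integrable hyp_volume (\<lambda>x. (hyp_dist0 x)\<^sup>2 * \<bar>u x\<bar>\<^sup>2) \<and>
      hyp_moment u / hyp_dirichlet u \<le> \<beta> ^ 4}"

text \<open>At \<open>x = 0\<close> the quotient is \<open>0 / 0 = 0\<close>, which is also its continuous extension.\<close>

definition hyp_weight :: "'a::euclidean_space \<Rightarrow> real" where
  "hyp_weight x =
     real DIM('a) + (real DIM('a) - 1) *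
       ((hyp_dist0 x * cosh (hyp_dist0 x) - sinh (hyp_dist0 x)) / sinh (hyp_dist0 x))"

definition deficit1 :: "('a::euclidean_space \<Rightarrow> real) \<Rightarrow> real" where
  "deficit1 u =
     sqrt (hyp_dirichlet u) * sqrt (hyp_moment u)
       - 1 / 2 * (LINT x|hyp_volume. hyp_weight x * \<bar>u x\<bar>\<^sup>2)"

definition deficit2 :: "('a::euclidean_space \<Rightarrow> real) \<Rightarrow> real" where
  "deficit2 u =
     hyp_dirichlet u * hyp_moment u
       - 1 / 4 * (LINT x|hyp_volume. hyp_weight x * \<bar>u x\<bar>\<^sup>2)\<^sup>2"

definition hyp_gaussian :: "real \<Rightarrow> 'a::euclidean_space \<Rightarrow> real" where
  "hyp_gaussian l x = exp (- ((hyp_dist0 x)\<^sup>2 / (2 * l\<^sup>2)))"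

end

theory Submission
  imports Defs
begin

text \<open>
  For \<open>l > 0\<close> expand \<open>D = \<integral> |l \<nabla>u + \<rho> u \<nabla>\<rho> / l|\<^sup>2 dV\<close>.  Since \<open>div (\<rho> \<nabla>\<rho>)\<close> is the weight \<open>w\<close>, an
  integration by parts gives \<open>D = l\<^sup>2 A + B / l\<^sup>2 - W\<close> with \<open>A = \<integral> |\<nabla>u|\<^sup>2\<close>, \<open>B = \<integral> \<rho>\<^sup>2 u\<^sup>2\<close>,
  \<open>W = \<integral> w u\<^sup>2\<close>, and at \<open>l\<^sup>4 = B / A \<le> \<beta>\<^sup>4\<close> this is twice the first deficit.  The Gaussian
  \<open>g = exp (- \<rho>\<^sup>2 / (2 l\<^sup>2))\<close> satisfies \<open>l \<nabla>g + \<rho> g \<nabla>\<rho> / l = 0\<close>, so \<open>D\<close> does not change when \<open>u\<close> is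
  replaced by \<open>v = u - c g\<close>.  For \<open>v\<close> the identity yields \<open>\<integral> v\<^sup>2 (\<rho>\<^sup>2 / l\<^sup>2 - w) \<le> D\<close>; as \<open>w\<close> grows only
  linearly in \<open>\<rho>\<close>, this bounds \<open>\<integral> v\<^sup>2\<close> by \<open>D\<close> and the integral of \<open>v\<^sup>2\<close> over the ball \<open>\<rho> < l R\<close>,
  where \<open>R\<close> depends only on \<open>N\<close> and \<open>\<beta>\<close>.  On that ball the metric, rescaled by \<open>l\<close>, is uniformly
  comparable to the Euclidean one, and the Euclidean Poincare inequality for \<open>u / g\<close> chooses \<open>c\<close>.
  The estimate for the second deficit follows from \<open>\<delta>\<^sub>2 = \<delta>\<^sub>1 (\<delta>\<^sub>1 + W)\<close>.
\<close>

section \<open>Smooth bump functions\<close>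

text \<open>The bound \<open>l\<close> \<le> \<beta> enters twice. In the variable y = \<rho> / l
  the weight is at most N + (N - 1) l y, so the radius beyond which y^2 exceeds it by 1 stays
  bounded only for bounded \<open>l\<close>; and on \<rho> < l R the density
  \<open>conf x ^ N\<close> is at most (1 + cosh (\<beta> R))^N. The constant survives l tending to
  0 because the Euclidean radius of that ball is at most l R: the Poincare inequality contributes
  l^2, exactly the factor between \<open>hyp_D\<close> and D.

  Two obstacles shape the analysis. Only a weak gradient of u is given, so product rule, integration
  by parts and Poincare inequality are proved for C^1 functions and carried over by mollification on
  balls of radius r < 1. And the field \<rho> \<nabla>\<rho> has no compact support; its truncations
  give identities whose integrands are dominated by the densities of u^2, \<rho>^2 u^2 and
  |\<nabla>u|^2.

  Averaging and approximation determine c only up to a small error, hence the \<delta> > 0 in the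
  Poincare estimates and in \<open>hyp_stability\<close>; it disappears when the infimum over c is
  taken.\<close>

definition bump :: "nat \<Rightarrow> real \<Rightarrow> real" where
  "bump m t = (if t > 0 then inverse t ^ m * exp (- inverse t) else 0)"

lemma bump_nonneg: "bump m t \<ge> 0"
  by (simp add: bump_def)

lemma bump_zero: "t \<le> 0 \<Longrightarrow> bump m t = 0"
  by (simp add: bump_def)

text \<open>The term of order m + 2 in the series of exp (1 / t) beats t^(-m) with two orders to
  spare. This forces the difference quotient at 0 to tend to 0.\<close>

lemma bump_le_square: "bump m t \<le> fact (m + 2) * t\<^sup>2"
proof (cases "t > 0")
  case True
  define s where "s = inverse t"
  have s: "s > 0" using True by (simp add: s_def)
  have "s ^ (m + 2) / fact (m + 2) \<le> exp s"
  proof -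
    have "(\<Sum>n<m+3. s ^ n /\<^sub>R fact n) \<le> exp s"
      unfolding exp_def using s by (intro sum_le_suminf summable_exp_generic) auto
    moreover have "s ^ (m + 2) /\<^sub>R fact (m + 2) \<le> (\<Sum>n<m+3. s ^ n /\<^sub>R fact n)"
      using s by (intro member_le_sum) auto
    ultimately show ?thesis by (simp add: divide_inverse mult.commute)
  qed
  then have "s ^ m * s\<^sup>2 \<le> fact (m + 2) * exp s"
    by (subst (asm) pos_divide_le_eq) (simp_all only: power_add fact_gt_zero mult.commute)
  then have "s ^ m * exp (- s) \<le> fact (m + 2) * (inverse s)\<^sup>2"
    using s by (simp add: exp_minus field_simps del: fact_Suc)
  then show ?thesis using True by (simp add: bump_def s_def)
qed (simp add: bump_def)

text \<open>Differentiating t^(-m) exp (-1 / t) only changes the power of 1 / t, which is why the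
  family is indexed by \<open>m\<close>; the plain profile is \<open>bump 0\<close>.\<close>

lemma bump_deriv:
  "(bump m has_real_derivative (bump (m + 2) t - real m * bump (m + 1) t)) (at t)"
proof -
  consider "t > 0" | "t < 0" | "t = 0" by linarith
  then show ?thesis
  proof cases
    case 1
    have "((\<lambda>t. inverse t ^ m * exp (- inverse t)) has_real_derivative
            (bump (m + 2) t - real m * bump (m + 1) t)) (at t)"
      using 1
      by (auto intro!: derivative_eq_intros simp: bump_def)
         (cases m; simp add: field_simps power2_eq_square)
    then show ?thesis
      by (rule has_field_derivative_transform_within_open[of _ _ _ "{0<..}"])
         (use 1 in \<open>auto simp: bump_def\<close>)
  next
    case 2
    have "((\<lambda>t. 0) has_real_derivative (bump (m + 2) t - real m * bump (m + 1) t)) (at t)"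
      using 2 by (simp add: bump_def)
    then show ?thesis
      by (rule has_field_derivative_transform_within_open[of _ _ _ "{..<0}"])
         (use 2 in \<open>auto simp: bump_def\<close>)
  next
    case 3
    have "((\<lambda>h. bump m h / h) \<longlongrightarrow> 0) (at 0)"
    proof (rule Lim_null_comparison)
      show "\<forall>\<^sub>F h in at 0. norm (bump m h / h) \<le> fact (m + 2) * \<bar>h\<bar>"
      proof (rule eventuallyI)
        fix h :: real
        show "norm (bump m h / h) \<le> fact (m + 2) * \<bar>h\<bar>"
        proof (cases "h = 0")
          case False
          have "bump m h \<le> fact (m + 2) * \<bar>h\<bar> * \<bar>h\<bar>"
            using bump_le_square[of m h] by (simp only: mult.assoc abs_mult_self_eq power2_eq_square)
          then have "bump m h / \<bar>h\<bar> \<le> fact (m + 2) * \<bar>h\<bar>"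
            using False by (subst pos_divide_le_eq) auto
          then show ?thesis using bump_nonneg[of m h] by (simp add: abs_divide)
        qed simp
      qed
      show "((\<lambda>h. fact (m + 2) * \<bar>h\<bar>) \<longlongrightarrow> (0::real)) (at 0)"
        by (auto intro!: tendsto_eq_intros)
    qed
    then show ?thesis using 3 by (simp add: DERIV_def bump_def)
  qed
qed

lemma continuous_on_bump: "continuous_on S (bump m)"
  by (meson DERIV_isCont bump_deriv continuous_at_imp_continuous_on)

text \<open>
  This set is closed under partial derivatives, so all of its elements satisfy every \<^const>\<open>C_k\<close>.
\<close>

inductive_set bump_algebra :: "'a::euclidean_space \<Rightarrow> real \<Rightarrow> ('a \<Rightarrow> real) set"
  for x :: 'a and R :: real where
  const: "(\<lambda>y. c) \<in> bump_algebra x R"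
| coord: "(\<lambda>y. y \<bullet> i) \<in> bump_algebra x R"
| bump: "(\<lambda>y. bump m (R - (y - x) \<bullet> (y - x))) \<in> bump_algebra x R"
| add: "f \<in> bump_algebra x R \<Longrightarrow> g \<in> bump_algebra x R \<Longrightarrow> (\<lambda>y. f y + g y) \<in> bump_algebra x R"
| mult: "f \<in> bump_algebra x R \<Longrightarrow> g \<in> bump_algebra x R \<Longrightarrow> (\<lambda>y. f y * g y) \<in> bump_algebra x R"

lemma bump_quadratic_has_derivative:
  fixes x :: "'a::euclidean_space"
  shows "((\<lambda>y. bump m (R - (y - x) \<bullet> (y - x))) has_derivative
           (\<lambda>k. (bump (m + 2) (R - (y - x) \<bullet> (y - x)) - real m * bump (m + 1) (R - (y - x) \<bullet> (y - x)))
              * (- 2 * ((y - x) \<bullet> k)))) (at y)"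
proof -
  have "((\<lambda>y. R - (y - x) \<bullet> (y - x)) has_derivative (\<lambda>k. - 2 * ((y - x) \<bullet> k))) (at y)"
    by (auto intro!: derivative_eq_intros simp: inner_commute algebra_simps)
  from DERIV_compose_FDERIV[OF bump_deriv this] show ?thesis
    by (simp add: mult_ac)
qed

lemma bump_algebra_derivative:
  assumes "f \<in> bump_algebra x R"
  shows "\<exists>f'. (\<forall>y. (f has_derivative f' y) (at y)) \<and> (\<forall>i. (\<lambda>y. f' y i) \<in> bump_algebra x R)"
  using assms
proof induction
  case (const c)
  then show ?case
    by (intro exI[of _ "\<lambda>y k. 0"]) (auto intro: bump_algebra.intros)
next
  case (coord i)
  then show ?case
    by (intro exI[of _ "\<lambda>y k. k \<bullet> i"]) (auto intro!: bump_algebra.intros derivative_eq_intros)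
next
  case (bump m)
  \<comment> \<open>Differences are written as sums with negated constants, so that the closure
    rules apply literally.\<close>
  have "(\<lambda>y. (bump (m + 2) (R - (y - x) \<bullet> (y - x)) + (- real m) * bump (m + 1) (R - (y - x) \<bullet> (y - x)))
              * (- 2 * ((y \<bullet> i) + (- (x \<bullet> i))))) \<in> bump_algebra x R" for i
    by (intro bump_algebra.intros)
  then have "(\<lambda>y. (bump (m + 2) (R - (y - x) \<bullet> (y - x)) - real m * bump (m + 1) (R - (y - x) \<bullet> (y - x)))
              * (- 2 * ((y - x) \<bullet> i))) \<in> bump_algebra x R" for i
    by (simp add: inner_diff_left)
  with bump_quadratic_has_derivative show ?case
    by (intro exI[of _ "\<lambda>y k. (bump (m + 2) (R - (y - x) \<bullet> (y - x)) - real m * bump (m + 1) (R - (y - x) \<bullet> (y - x)))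
              * (- 2 * ((y - x) \<bullet> k))"]) blast
next
  case (add f g)
  then obtain f' g' where
    "\<forall>y. (f has_derivative f' y) (at y)" "\<forall>i. (\<lambda>y. f' y i) \<in> bump_algebra x R"
    "\<forall>y. (g has_derivative g' y) (at y)" "\<forall>i. (\<lambda>y. g' y i) \<in> bump_algebra x R"
    by blast
  then show ?case
    by (intro exI[of _ "\<lambda>y k. f' y k + g' y k"])
       (auto intro!: has_derivative_add bump_algebra.add)
next
  case (mult f g)
  then obtain f' g' where
    "\<forall>y. (f has_derivative f' y) (at y)" "\<forall>i. (\<lambda>y. f' y i) \<in> bump_algebra x R"
    "\<forall>y. (g has_derivative g' y) (at y)" "\<forall>i. (\<lambda>y. g' y i) \<in> bump_algebra x R"
    by blast
  with mult.hyps show ?case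
    by (intro exI[of _ "\<lambda>y k. f y * g' y k + f' y k * g y"])
       (auto intro!: has_derivative_mult bump_algebra.intros)
qed

lemma bump_algebra_C_k: "f \<in> bump_algebra x R \<Longrightarrow> C_k k f"
proof (induction k arbitrary: f)
  case 0
  then obtain f' where "\<forall>y. (f has_derivative f' y) (at y)"
    using bump_algebra_derivative by blast
  then have "\<forall>y. isCont f y" using has_derivative_continuous by blast
  then show ?case by (simp add: continuous_at_imp_continuous_on)
next
  case (Suc k)
  then obtain f' where f': "\<forall>y. (f has_derivative f' y) (at y)" "\<forall>i. (\<lambda>y. f' y i) \<in> bump_algebra x R"
    using bump_algebra_derivative by blast
  then have "frechet_derivative f (at y) = f' y" for y
    by (metis frechet_derivative_at)
  with f' Suc.IH show ?case by (auto simp: differentiable_def)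
qed

text \<open>The argument is quadratic in \<open>z\<close>, hence smooth at the centre, where
  \<open>norm z\<close> is not. The normalisation by the integral is left to the place of
  use.\<close>

definition standard_bump :: "real \<Rightarrow> 'a::euclidean_space \<Rightarrow> real" where
  "standard_bump \<epsilon> z = bump 0 (\<epsilon>\<^sup>2 - z \<bullet> z)"

lemma standard_bump_pos_iff: "\<epsilon> > 0 \<Longrightarrow> standard_bump \<epsilon> z > 0 \<longleftrightarrow> norm z < \<epsilon>"
  by (auto simp: standard_bump_def bump_def dot_square_norm power_mono_iff
      dest: power_less_imp_less_base intro: power_strict_mono)

lemma test_function_standard_bump:
  fixes x :: "'a::euclidean_space"
  assumes "\<epsilon> > 0" "cball x \<epsilon> \<subseteq> hyp_ball"
  shows "test_function (\<lambda>y. standard_bump \<epsilon> (y - x))"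
proof -
  have "(\<lambda>y. standard_bump \<epsilon> (y - x)) \<in> bump_algebra x (\<epsilon>\<^sup>2)"
    unfolding standard_bump_def by (rule bump_algebra.bump)
  moreover have "{y. standard_bump \<epsilon> (y - x) \<noteq> 0} \<subseteq> cball x \<epsilon>"
    using standard_bump_pos_iff[OF assms(1)] bump_nonneg
    by (fastforce simp: standard_bump_def dist_norm norm_minus_commute less_le)
  then have sub: "closure {y. standard_bump \<epsilon> (y - x) \<noteq> 0} \<subseteq> cball x \<epsilon>"
    by (simp add: closure_minimal)
  then have "compact (closure {y. standard_bump \<epsilon> (y - x) \<noteq> 0})"
    by (meson bounded_cball bounded_subset closed_closure compact_eq_bounded_closed)
  ultimately show ?thesis
    using sub assms(2) by (auto simp: test_function_def intro: bump_algebra_C_k)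
qed

lemma standard_bump_has_derivative:
  fixes z :: "'a::euclidean_space"
  shows "(standard_bump \<epsilon> has_derivative (\<lambda>k. (- 2 * bump 2 (\<epsilon>\<^sup>2 - z \<bullet> z)) *\<^sub>R z \<bullet> k)) (at z)"
  using bump_quadratic_has_derivative[of 0 "\<epsilon>\<^sup>2" 0 z]
  by (simp add: standard_bump_def[abs_def] mult_ac numeral_2_eq_2)

section \<open>Mollification in the square mean\<close>

lemma integrable_lborel_translate:
  fixes f :: "'a::euclidean_space \<Rightarrow> 'b::{banach, second_countable_topology}"
  assumes "integrable lborel f"
  shows "integrable lborel (\<lambda>x. f (x + z))"
proof -
  have "integrable (distr lborel borel ((+) z)) f"
    using assms by (simp add: lborel_distr_plus)
  then have "integrable lborel (\<lambda>x. f (z + x))"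
    using assms by (subst (asm) integrable_distr_eq) auto
  then show ?thesis by (simp add: add.commute)
qed

lemma integral_lborel_translate:
  fixes f :: "'a::euclidean_space \<Rightarrow> 'b::{banach, second_countable_topology}"
  assumes "f \<in> borel_measurable borel"
  shows "(LINT x|lborel. f (x + z)) = (LINT x|lborel. f x)"
proof -
  have "(LINT x|lborel. f x) = integral\<^sup>L (distr lborel borel ((+) z)) f"
    by (simp add: lborel_distr_plus)
  also have "\<dots> = (LINT x|lborel. f (z + x))"
    using assms by (subst integral_distr) auto
  finally show ?thesis by (simp add: add.commute)
qed

definition L1_modulus :: "('a::euclidean_space \<Rightarrow> real) \<Rightarrow> 'a \<Rightarrow> real" where
  "L1_modulus f z = (LINT x|lborel. \<bar>f (x + z) - f x\<bar>)"

lemma L1_modulus_nonneg: "0 \<le> L1_modulus f z"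
  by (simp add: L1_modulus_def)

lemma L1_modulus_triangle:
  assumes f: "integrable lborel f" and g: "integrable lborel g"
  shows "L1_modulus f z \<le> L1_modulus g z + L1_modulus (\<lambda>x. f x - g x) z"
proof -
  note [simp] = integrable_lborel_translate[OF f] integrable_lborel_translate[OF g] f g
  have "L1_modulus f z \<le> (LINT x|lborel. \<bar>g (x + z) - g x\<bar> + \<bar>(f (x + z) - g (x + z)) - (f x - g x)\<bar>)"
    unfolding L1_modulus_def by (rule integral_mono) auto
  then show ?thesis by (simp add: L1_modulus_def)
qed

lemma L1_modulus_le:
  assumes f: "integrable lborel f"
  shows "L1_modulus f z \<le> 2 * (LINT x|lborel. \<bar>f x\<bar>)"
proof -
  note [simp] = integrable_lborel_translate[OF f] f
  have "L1_modulus f z \<le> (LINT x|lborel. \<bar>f (x + z)\<bar> + \<bar>f x\<bar>)"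
    unfolding L1_modulus_def by (rule integral_mono) auto
  then show ?thesis
    using integral_lborel_translate[of "\<lambda>x. \<bar>f x\<bar>" z] f by simp
qed

text \<open>The functions with vanishing modulus form a closed set in the mean: replacing
  \<open>f\<close> by \<open>g\<close> costs at most twice the norm of the difference, uniformly in
  the translation.\<close>

lemma L1_modulus_tendsto_approx:
  assumes f: "integrable lborel f"
    and approx: "\<And>e. e > 0 \<Longrightarrow> \<exists>g. integrable lborel g \<and> (L1_modulus g \<longlongrightarrow> 0) (at 0)
          \<and> (LINT x|lborel. \<bar>f x - g x\<bar>) < e"
  shows "(L1_modulus f \<longlongrightarrow> 0) (at 0)"
proof (rule tendstoI)
  fix e :: real assume e: "e > 0"
  then obtain g where g: "integrable lborel g" "(L1_modulus g \<longlongrightarrow> 0) (at 0)"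
      "(LINT x|lborel. \<bar>f x - g x\<bar>) < e / 4"
    using approx[of "e / 4"] by auto
  have "\<forall>\<^sub>F z in at 0. L1_modulus g z < e / 2"
    using g(2) e by (auto simp: tendsto_iff dist_real_def L1_modulus_nonneg dest!: spec[of _ "e/2"])
  then show "\<forall>\<^sub>F z in at 0. dist (L1_modulus f z) 0 < e"
  proof eventually_elim
    case (elim z)
    then show ?case
      using L1_modulus_triangle[OF f g(1), of z] L1_modulus_le[of "\<lambda>x. f x - g x" z] f g
      by (simp add: dist_real_def L1_modulus_nonneg)
  qed
qed

text \<open>Points of an open set stay in it under small translations, so the loss max (0, 1_U(x) -
  1_U(x + z)) tends to 0 pointwise, dominated by 1_U. Gain and loss have equal integrals by
  translation invariance, hence the factor 2 below. The boundary of \<open>U\<close>, possibly of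
  positive measure, thus causes no trouble.\<close>

lemma L1_modulus_tendsto_open:
  fixes U :: "'a::euclidean_space set"
  assumes U: "open U" "emeasure lborel U < \<infinity>"
  shows "(L1_modulus (indicat_real U) \<longlongrightarrow> 0) (at 0)"
  unfolding tendsto_at_iff_sequentially
proof (intro allI impI, unfold comp_def)
  fix z :: "nat \<Rightarrow> 'a" assume "z \<longlonglongrightarrow> 0"
  have iU[simp]: "integrable lborel (indicat_real U)"
    using U by (simp add: integrable_indicator_iff)
  note [simp] = integrable_lborel_translate[OF iU]
  have "(\<lambda>n. LINT x|lborel. max 0 (indicat_real U x - indicat_real U (x + z n))) \<longlonglongrightarrow> (LINT x|(lborel :: 'a measure). 0)"
  proof (rule integral_dominated_convergence)
    show "AE x in lborel. (\<lambda>n. max 0 (indicat_real U x - indicat_real U (x + z n))) \<longlonglongrightarrow> 0"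
    proof (rule AE_I2, rule tendsto_eventually)
      fix x :: 'a
      have "(\<lambda>n. x + z n) \<longlonglongrightarrow> x"
        using \<open>z \<longlonglongrightarrow> 0\<close> by (auto intro!: tendsto_eq_intros)
      then have "x \<in> U \<Longrightarrow> \<forall>\<^sub>F n in sequentially. x + z n \<in> U"
        using U topological_tendstoD by blast
      then show "\<forall>\<^sub>F n in sequentially. max 0 (indicat_real U x - indicat_real U (x + z n)) = 0"
        by (cases "x \<in> U") (auto elim!: eventually_mono)
    qed
    show "AE x in lborel. norm (max 0 (indicat_real U x - indicat_real U (x + z n))) \<le> indicat_real U x" for n
      by (auto simp: indicator_def)
    have [measurable]: "U \<in> sets borel" using U by simp
    show "(\<lambda>x. max 0 (indicat_real U x - indicat_real U (x + z n))) \<in> borel_measurable lborel" for n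
      by measurable
  qed (use iU in simp_all)
  moreover have "L1_modulus (indicat_real U) y = 2 * (LINT x|lborel. max 0 (indicat_real U x - indicat_real U (x + y)))"
    for y :: 'a
  proof -
    note [simp] = integrable_lborel_translate[OF iU, of y]
    have "L1_modulus (indicat_real U) y =
        (LINT x|lborel. 2 * max 0 (indicat_real U x - indicat_real U (x + y)) + (indicat_real U (x + y) - indicat_real U x))"
      unfolding L1_modulus_def by (rule Bochner_Integration.integral_cong) (auto simp: max_def abs_if)
    also have "\<dots> = 2 * (LINT x|lborel. max 0 (indicat_real U x - indicat_real U (x + y)))
         + ((LINT x|lborel. indicat_real U (x + y)) - (LINT x|lborel. indicat_real U x))"
      by (subst Bochner_Integration.integral_add) auto
    finally show ?thesis
      using integral_lborel_translate[of "indicat_real U" y] U by simp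
  qed
  ultimately show "(\<lambda>n. L1_modulus (indicat_real U) (z n)) \<longlonglongrightarrow> 0"
    by (simp add: tendsto_mult_right_zero)
qed

lemma L1_modulus_cmult: "L1_modulus (\<lambda>x. f x * c) z = L1_modulus f z * \<bar>c\<bar>"
  by (simp add: L1_modulus_def flip: left_diff_distrib abs_mult)
     (simp add: abs_mult)

text \<open>Outer regularity reduces measurable sets of finite measure to open ones; linearity and
  the closedness in \<open>L1_modulus_tendsto_approx\<close> do the rest.\<close>

lemma L1_modulus_tendsto:
  fixes f :: "'a::euclidean_space \<Rightarrow> real"
  assumes "integrable lborel f"
  shows "(L1_modulus f \<longlongrightarrow> 0) (at 0)"
  using assms
proof (induction rule: integrable_induct)
  case (base A c)
  have iA: "integrable lborel (indicat_real A)"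
    using base by (simp add: integrable_indicator_iff)
  have "(L1_modulus (indicat_real A) \<longlongrightarrow> 0) (at 0)"
  proof (rule L1_modulus_tendsto_approx[OF iA])
    fix e :: real assume e: "e > 0"
    obtain U where U: "open U" "A \<subseteq> U" "emeasure lborel (U - A) < e"
      using outer_regular_lborel[OF _ e, of A] base by auto
    have "emeasure lborel U = emeasure lborel A + emeasure lborel (U - A)"
      using U base by (subst plus_emeasure) (auto intro!: arg_cong[where f="emeasure lborel"])
    also have "\<dots> < \<infinity>"
      using less_trans[OF U(3) ennreal_less_top] base(2) by (simp add: less_top)
    finally have fin: "emeasure lborel U < \<infinity>" .
    have "(LINT x|lborel. \<bar>indicat_real A x - indicat_real U x\<bar>) = (LINT x|lborel. indicat_real (U - A) x)"
      using U by (intro Bochner_Integration.integral_cong) (auto simp: indicator_def)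
    also have "\<dots> = measure lborel (U - A)"
      by simp
    also have "\<dots> < e"
    proof -
      have "ennreal (measure lborel (U - A)) = emeasure lborel (U - A)"
        using less_trans[OF U(3) ennreal_less_top] by (intro emeasure_eq_ennreal_measure[symmetric]) auto
      then show ?thesis using U(3) by (simp add: ennreal_less_iff[symmetric])
    qed
    finally show "\<exists>g. integrable lborel g \<and> (L1_modulus g \<longlongrightarrow> 0) (at 0)
          \<and> (LINT x|lborel. \<bar>indicat_real A x - g x\<bar>) < e"
      using U fin by (intro exI[of _ "indicat_real U"])
        (auto simp: integrable_indicator_iff intro: L1_modulus_tendsto_open)
  qed
  then show ?case by (simp add: L1_modulus_cmult[abs_def] tendsto_mult_left_zero)
next
  case (add f g)
  have "(\<lambda>z. L1_modulus f z + L1_modulus g z) \<midarrow>0\<rightarrow> 0"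
    using tendsto_add[OF add.IH] by simp
  then show ?case
  proof (rule Lim_null_comparison[rotated])
    show "\<forall>\<^sub>F z in at 0. norm (L1_modulus (\<lambda>x. f x + g x) z) \<le> L1_modulus f z + L1_modulus g z"
    proof (rule eventuallyI)
      fix z :: 'a
      show "norm (L1_modulus (\<lambda>x. f x + g x) z) \<le> L1_modulus f z + L1_modulus g z"
        using L1_modulus_triangle[of "\<lambda>x. f x + g x" f z] add.hyps by (simp add: L1_modulus_nonneg)
    qed
  qed
next
  case (lim f s)
  show ?case
  proof (rule L1_modulus_tendsto_approx)
    fix e :: real assume e: "e > 0"
    have "(\<lambda>i. LINT x|lborel. \<bar>f x - s i x\<bar>) \<longlonglongrightarrow> (LINT x|(lborel :: 'a measure). 0)"
    proof (rule integral_dominated_convergence[where w="\<lambda>x. 3 * \<bar>f x\<bar>"])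
      show "AE x in lborel. (\<lambda>i. \<bar>f x - s i x\<bar>) \<longlonglongrightarrow> 0"
      proof (rule AE_I2)
        fix x :: 'a
        have "(\<lambda>i. \<bar>f x - s i x\<bar>) \<longlonglongrightarrow> \<bar>f x - f x\<bar>"
          using lim.hyps(2)[of x] by (intro tendsto_intros) auto
        then show "(\<lambda>i. \<bar>f x - s i x\<bar>) \<longlonglongrightarrow> 0" by simp
      qed
      show "AE x in lborel. norm \<bar>f x - s i x\<bar> \<le> 3 * \<bar>f x\<bar>" for i
      proof (rule AE_I2)
        fix x :: 'a
        show "norm \<bar>f x - s i x\<bar> \<le> 3 * \<bar>f x\<bar>"
          using lim.hyps(3)[of x i] by (simp add: abs_if split: if_splits)
      qed
    qed (use lim in \<open>auto intro!: borel_measurable_integrable\<close>)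
    then have "\<forall>\<^sub>F i in sequentially. (LINT x|lborel. \<bar>f x - s i x\<bar>) < e"
      using e by (auto dest: order_tendstoD(2))
    then obtain i where "(LINT x|lborel. \<bar>f x - s i x\<bar>) < e"
      by (auto simp: eventually_sequentially)
    then show "\<exists>g. integrable lborel g \<and> (L1_modulus g \<longlongrightarrow> 0) (at 0) \<and> (LINT x|lborel. \<bar>f x - g x\<bar>) < e"
      using lim by blast
  qed (use lim in auto)
qed

text \<open>
  Reduces continuity of translations in the square mean to continuity in the mean, applied to \<open>f |f|\<close>.
\<close>

lemma square_diff_le_signed_squares: "(a - b)\<^sup>2 \<le> 2 * \<bar>a * \<bar>a\<bar> - b * \<bar>b\<bar>\<bar>" for a b :: real
proof -
  have same: "(a - b)\<^sup>2 \<le> \<bar>a * a - b * b\<bar>" if "a \<ge> 0" "b \<ge> 0" for a b :: real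
  proof -
    have "\<bar>a * a - b * b\<bar> = \<bar>a - b\<bar> * (a + b)"
    proof -
      have "a * a - b * b = (a - b) * (a + b)" by (simp add: algebra_simps)
      then show ?thesis using that by (simp add: abs_mult)
    qed
    moreover have "\<bar>a - b\<bar> \<le> a + b" using that by auto
    ultimately show ?thesis
      by (metis abs_ge_zero mult_left_mono power2_abs power2_eq_square)
  qed
  have opp: "(a - b)\<^sup>2 \<le> 2 * (a * a + b * b)"
    by (smt (verit) sum_squares_ge_zero zero_le_square power2_eq_square power2_diff power2_sum)
  consider "a \<ge> 0" "b \<ge> 0" | "a \<le> 0" "b \<le> 0" | "a \<ge> 0" "b \<le> 0" | "a \<le> 0" "b \<ge> 0" by linarith
  then show ?thesis
  proof cases
    case 1
    then have "(a - b)\<^sup>2 \<le> \<bar>a * \<bar>a\<bar> - b * \<bar>b\<bar>\<bar>" using same[of a b] by simp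
    then show ?thesis by (rule order_trans) simp
  next
    case 2
    then have "(a - b)\<^sup>2 \<le> \<bar>a * \<bar>a\<bar> - b * \<bar>b\<bar>\<bar>"
      using same[of "-a" "-b"] by (simp add: power2_commute abs_minus_commute)
    then show ?thesis by (rule order_trans) simp
  next
    case 3 then show ?thesis using opp by simp
  next
    case 4
    then have "a * \<bar>a\<bar> - b * \<bar>b\<bar> = - (a * a + b * b)" by simp
    then show ?thesis using opp by (simp only: abs_minus_cancel) simp
  qed
qed

section \<open>Convolution with a concentrated kernel\<close>

lemma Jensen_square:
  assumes "integrable M \<kappa>" "integrable M (\<lambda>z. \<kappa> z * g z)" "integrable M (\<lambda>z. \<kappa> z * (g z)\<^sup>2)"
    and "(LINT z|M. \<kappa> z) = 1" "\<And>z. \<kappa> z \<ge> (0::real)"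
  shows "(LINT z|M. \<kappa> z * g z)\<^sup>2 \<le> (LINT z|M. \<kappa> z * (g z)\<^sup>2)"
proof -
  define m where "m = (LINT z|M. \<kappa> z * g z)"
  \<comment> \<open>The variance about the mean \<open>m\<close>; expanding it gives the
    claim.\<close>
  have "0 \<le> (LINT z|M. \<kappa> z * (g z - m)\<^sup>2)"
    using assms by (intro integral_nonneg_AE) auto
  also have "\<dots> = (LINT z|M. \<kappa> z * (g z)\<^sup>2 - 2 * m * (\<kappa> z * g z) + m\<^sup>2 * \<kappa> z)"
    by (intro Bochner_Integration.integral_cong) (auto simp: power2_eq_square algebra_simps)
  also have "\<dots> = (LINT z|M. \<kappa> z * (g z)\<^sup>2) - 2 * m * m + m\<^sup>2"
    using assms by (simp add: m_def)
  finally show ?thesis by (simp add: m_def power2_eq_square)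
qed

lemma integrable_bounded_mult:
  fixes f g :: "'a \<Rightarrow> real"
  assumes "integrable M f" "g \<in> borel_measurable M" "\<And>x. \<bar>g x\<bar> \<le> C"
  shows "integrable M (\<lambda>x. g x * f x)"
proof (rule Bochner_Integration.integrable_bound[of _ "\<lambda>x. C * f x"])
  show "AE x in M. norm (g x * f x) \<le> norm (C * f x)"
  proof (rule AE_I2)
    fix x
    have "\<bar>g x\<bar> \<le> \<bar>C\<bar>" using assms(3)[of x] by linarith
    then show "norm (g x * f x) \<le> norm (C * f x)" by (simp add: abs_mult mult_right_mono)
  qed
qed (use assms in auto)

text \<open>With \<open>x + z\<close> in place of \<open>x - z\<close>, the substitution y = x + z
  turns the kernel into \<open>\<kappa> (y - x)\<close>, which for a small bump is a test function
  of y centred at x.\<close>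

definition mollify :: "('a::euclidean_space \<Rightarrow> real) \<Rightarrow> ('a \<Rightarrow> real) \<Rightarrow> 'a \<Rightarrow> real" where
  "mollify \<kappa> f x = (LINT z|lborel. \<kappa> z * f (x + z))"

text \<open>The distance \<open>d\<close> is fixed before the kernel, so that one kernel can later
  serve a function and all components of its gradient. Jensen moves the square under the kernel;
  \<open>square_diff_le_signed_squares\<close> then replaces it by the modulus of
  \<open>f |f|\<close>, which is at most e / 2 for translations shorter than
  \<open>d\<close>.\<close>

lemma mollify_L2_approx:
  fixes f :: "'a::euclidean_space \<Rightarrow> real"
  assumes f: "integrable lborel f" and f2: "integrable lborel (\<lambda>x. (f x)\<^sup>2)" and "e > 0"
  shows "\<exists>d>0. \<forall>\<kappa> C. continuous_on UNIV \<kappa> \<and> integrable lborel \<kappa> \<and> (LINT z|lborel. \<kappa> z) = 1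
      \<and> (\<forall>z. 0 \<le> \<kappa> z \<and> \<kappa> z \<le> C) \<and> (\<forall>z. norm z \<ge> d \<longrightarrow> \<kappa> z = 0) \<longrightarrow>
      integrable lborel (\<lambda>x. (mollify \<kappa> f x - f x)\<^sup>2) \<and>
      (LINT x|lborel. (mollify \<kappa> f x - f x)\<^sup>2) \<le> e"
proof -
  have fm[measurable]: "f \<in> borel_measurable borel"
    using borel_measurable_integrable[OF f] by simp
  define g where "g x = f x * \<bar>f x\<bar>" for x
  have gm[measurable]: "g \<in> borel_measurable borel"
    unfolding g_def by measurable
  have g: "integrable lborel g"
    by (rule Bochner_Integration.integrable_bound[OF f2]) (auto simp: g_def abs_mult power2_eq_square)
  from L1_modulus_tendsto[OF g] \<open>e > 0\<close>
  obtain d where d: "d > 0" "\<And>z. z \<noteq> 0 \<Longrightarrow> norm z < d \<Longrightarrow> L1_modulus g z < e / 2"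
    by (auto simp: tendsto_iff eventually_at dist_norm L1_modulus_nonneg dest!: spec[of _ "e/2"])
  have d': "L1_modulus g z \<le> e / 2" if "norm z < d" for z
    using d(2)[of z] that \<open>e > 0\<close> by (cases "z = 0") (auto simp: L1_modulus_def)
  show ?thesis
  proof (intro exI[of _ d] conjI[OF d(1)] allI impI)
    fix \<kappa> :: "'a \<Rightarrow> real" and C :: real
    assume "continuous_on UNIV \<kappa> \<and> integrable lborel \<kappa> \<and> (LINT z|lborel. \<kappa> z) = 1
      \<and> (\<forall>z. 0 \<le> \<kappa> z \<and> \<kappa> z \<le> C) \<and> (\<forall>z. norm z \<ge> d \<longrightarrow> \<kappa> z = 0)"
    then have "continuous_on UNIV \<kappa>" and ki: "integrable lborel \<kappa>" and k1: "(LINT z|lborel. \<kappa> z) = 1"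
      and kC: "\<forall>z. 0 \<le> \<kappa> z \<and> \<kappa> z \<le> C" and kd: "\<forall>z. norm z \<ge> d \<longrightarrow> \<kappa> z = 0"
      by auto
    from this(1) have km[measurable]: "\<kappa> \<in> borel_measurable borel"
      by (simp add: borel_measurable_continuous_onI)
    have mm[measurable]: "mollify \<kappa> f \<in> borel_measurable borel"
      unfolding mollify_def[abs_def] by measurable
    have tr: "integrable lborel (\<lambda>z. h (x + z))" if "integrable lborel h" for h :: "'a \<Rightarrow> real" and x
      using integrable_lborel_translate[OF that, of x] by (simp add: add.commute)
    have kint: "integrable lborel (\<lambda>z. \<kappa> z * h z)" if "integrable lborel h" for h :: "'a \<Rightarrow> real"
      using kC by (intro integrable_bounded_mult[OF that]) auto
    have kfi: "integrable lborel (\<lambda>z. \<kappa> z * (f (x + z) - f x))" for x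
      using kint[OF tr[OF f, of x]] ki by (simp add: right_diff_distrib)
    have kf2i: "integrable lborel (\<lambda>z. \<kappa> z * (f (x + z) - f x)\<^sup>2)" for x
    proof -
      have "(\<lambda>z. \<kappa> z * (f (x + z) - f x)\<^sup>2) =
         (\<lambda>z. \<kappa> z * (f (x + z))\<^sup>2 - 2 * f x * (\<kappa> z * f (x + z)) + (f x)\<^sup>2 * \<kappa> z)"
        by (auto simp: power2_eq_square algebra_simps)
      then show ?thesis
        using kint[OF tr[OF f2, of x]] kint[OF tr[OF f, of x]] ki by simp
    qed
    have kgi: "integrable lborel (\<lambda>z. \<kappa> z * \<bar>g (x + z) - g x\<bar>)" for x
    proof -
      have "integrable lborel (\<lambda>z. \<kappa> z * (g (x + z) - g x))"
        using kint[OF tr[OF g, of x]] ki by (simp add: right_diff_distrib)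
      from integrable_abs[OF this] show ?thesis using kC by (simp add: abs_mult)
    qed
    have pt: "(mollify \<kappa> f x - f x)\<^sup>2 \<le> (LINT z|lborel. 2 * (\<kappa> z * \<bar>g (x + z) - g x\<bar>))" for x
    proof -
      have "mollify \<kappa> f x - f x = (LINT z|lborel. \<kappa> z * (f (x + z) - f x))"
        using kint[OF tr[OF f, of x]] ki k1 by (simp add: mollify_def right_diff_distrib)
      then have "(mollify \<kappa> f x - f x)\<^sup>2 \<le> (LINT z|lborel. \<kappa> z * (f (x + z) - f x)\<^sup>2)"
        using Jensen_square[OF ki kfi[of x] kf2i[of x] k1] kC by simp
      also have "\<dots> \<le> (LINT z|lborel. 2 * (\<kappa> z * \<bar>g (x + z) - g x\<bar>))"
      proof (rule integral_mono[OF kf2i])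
        fix z
        have "(f (x + z) - f x)\<^sup>2 \<le> 2 * \<bar>g (x + z) - g x\<bar>"
          unfolding g_def by (rule square_diff_le_signed_squares)
        then show "\<kappa> z * (f (x + z) - f x)\<^sup>2 \<le> 2 * (\<kappa> z * \<bar>g (x + z) - g x\<bar>)"
          using mult_left_mono[of _ _ "\<kappa> z"] kC by (simp add: mult.left_commute)
      qed (use kgi in simp)
      finally show ?thesis .
    qed
    \<comment> \<open>Nonnegative integrals permit the exchange of integrations and yield
      integrability of the squared error together with its bound.\<close>
    have "(\<integral>\<^sup>+x. ennreal ((mollify \<kappa> f x - f x)\<^sup>2) \<partial>lborel)
      \<le> (\<integral>\<^sup>+x. \<integral>\<^sup>+z. ennreal (2 * (\<kappa> z * \<bar>g (x + z) - g x\<bar>)) \<partial>lborel \<partial>lborel)"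
    proof (rule nn_integral_mono)
      fix x
      show "ennreal ((mollify \<kappa> f x - f x)\<^sup>2) \<le> (\<integral>\<^sup>+z. ennreal (2 * (\<kappa> z * \<bar>g (x + z) - g x\<bar>)) \<partial>lborel)"
        using kC kgi[of x] pt[of x] by (subst nn_integral_eq_integral) (auto intro!: ennreal_leI)
    qed
    also have "\<dots> = (\<integral>\<^sup>+z. \<integral>\<^sup>+x. ennreal (2 * (\<kappa> z * \<bar>g (x + z) - g x\<bar>)) \<partial>lborel \<partial>lborel)"
      by (rule lborel_pair.Fubini') measurable
    also have "\<dots> \<le> (\<integral>\<^sup>+z. ennreal (e * \<kappa> z) \<partial>lborel)"
    proof (rule nn_integral_mono)
      fix z :: 'a
      have i: "integrable lborel (\<lambda>x. 2 * (\<kappa> z * \<bar>g (x + z) - g x\<bar>))"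
        using g integrable_lborel_translate[OF g, of z] by simp
      have "(LINT x|lborel. 2 * (\<kappa> z * \<bar>g (x + z) - g x\<bar>)) = 2 * (\<kappa> z * L1_modulus g z)"
        by (simp add: L1_modulus_def)
      also have "\<dots> \<le> e * \<kappa> z"
        using d'[of z] kC kd mult_right_mono[of "L1_modulus g z" "e/2" "\<kappa> z"]
        by (cases "norm z < d") (auto simp: mult_ac)
      finally show "(\<integral>\<^sup>+x. ennreal (2 * (\<kappa> z * \<bar>g (x + z) - g x\<bar>)) \<partial>lborel) \<le> ennreal (e * \<kappa> z)"
        using i kC by (subst nn_integral_eq_integral) (auto intro!: ennreal_leI)
    qed
    also have "\<dots> = ennreal e"
      using ki k1 kC \<open>e > 0\<close> by (subst nn_integral_eq_integral) auto
    finally have *: "(\<integral>\<^sup>+x. ennreal ((mollify \<kappa> f x - f x)\<^sup>2) \<partial>lborel) \<le> ennreal e" .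
    have i: "integrable lborel (\<lambda>x. (mollify \<kappa> f x - f x)\<^sup>2)"
      using * by (intro integrableI_bounded) (auto intro: order_le_less_trans)
    moreover have "(LINT x|lborel. (mollify \<kappa> f x - f x)\<^sup>2) \<le> e"
      using * \<open>e > 0\<close> i by (subst (asm) nn_integral_eq_integral) auto
    ultimately show "integrable lborel (\<lambda>x. (mollify \<kappa> f x - f x)\<^sup>2) \<and>
      (LINT x|lborel. (mollify \<kappa> f x - f x)\<^sup>2) \<le> e" ..
  qed
qed

section \<open>Approximation of weakly differentiable functions\<close>

abbreviation lborel_ball :: "real \<Rightarrow> 'a::euclidean_space measure" where
  "lborel_ball r \<equiv> restrict_space lborel (ball 0 r)"

lemma integrable_lborel_ball:
  fixes f :: "'a::euclidean_space \<Rightarrow> real"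
  assumes "integrable lborel f"
  shows "integrable (lborel_ball r) f"
  using integrable_mult_indicator[of "ball 0 r" lborel f] assms
  by (subst integrable_restrict_space) auto

lemma integral_lborel_ball_mono:
  fixes f :: "'a::euclidean_space \<Rightarrow> real"
  assumes "integrable lborel f" "\<And>x. 0 \<le> f x"
  shows "(LINT x|lborel_ball r. f x) \<le> (LINT x|lborel. f x)"
proof -
  have "(LINT x|lborel_ball r. f x) = (LINT x|lborel. indicat_real (ball 0 r) x *\<^sub>R f x)"
    by (subst integral_restrict_space) auto
  also have "\<dots> \<le> (LINT x|lborel. f x)"
    using assms integrable_mult_indicator[of "ball 0 r" lborel f]
    by (intro integral_mono) (auto simp: indicator_def)
  finally show ?thesis .
qed

definition C1_on :: "'a::euclidean_space set \<Rightarrow> ('a \<Rightarrow> real) \<Rightarrow> ('a \<Rightarrow> 'a) \<Rightarrow> bool" where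
  "C1_on S w k \<longleftrightarrow> (\<forall>x\<in>S. (w has_derivative (\<lambda>v. k x \<bullet> v)) (at x)) \<and> continuous_on S k"

lemma C1_on_continuous: "C1_on S w k \<Longrightarrow> continuous_on S w"
  unfolding C1_on_def
  by (auto intro!: continuous_at_imp_continuous_on dest: has_derivative_continuous)

lemma C1_on_subset: "C1_on S w k \<Longrightarrow> T \<subseteq> S \<Longrightarrow> C1_on T w k"
  unfolding C1_on_def by (meson continuous_on_subset subsetD)

text \<open>Two points at distance below 1 lie both in the ball of radius R + 1 or both outside the
  ball of radius R.\<close>

lemma uniformly_continuous_compact_support:
  fixes f :: "'a::euclidean_space \<Rightarrow> 'b::real_normed_vector"
  assumes f: "continuous_on UNIV f" and supp: "\<And>x. norm x > R \<Longrightarrow> f x = 0"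
  shows "uniformly_continuous_on UNIV f"
  unfolding uniformly_continuous_on_def
proof (intro allI impI)
  fix e :: real assume "e > 0"
  have "uniformly_continuous_on (cball 0 (R + 1)) f"
    by (intro compact_uniformly_continuous continuous_on_subset[OF f]) auto
  with \<open>e > 0\<close> obtain d where d: "d > 0"
    "\<And>x y. x \<in> cball 0 (R + 1) \<Longrightarrow> y \<in> cball 0 (R + 1) \<Longrightarrow> dist y x < d \<Longrightarrow> dist (f y) (f x) < e"
    unfolding uniformly_continuous_on_def by metis
  show "\<exists>d>0. \<forall>x\<in>UNIV. \<forall>y\<in>UNIV. dist y x < d \<longrightarrow> dist (f y) (f x) < e"
  proof (intro exI[of _ "min d 1"] conjI ballI impI)
    fix x y :: 'a assume xy: "dist y x < min d 1"
    show "dist (f y) (f x) < e"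
    proof (cases "norm x \<le> R + 1 \<and> norm y \<le> R + 1")
      case True then show ?thesis using d xy by auto
    next
      case False
      moreover have "\<bar>norm x - norm y\<bar> < 1"
        using xy norm_triangle_ineq3[of x y] by (auto simp: dist_norm norm_minus_commute)
      ultimately have "norm x > R" "norm y > R" by auto
      then show ?thesis using supp \<open>e > 0\<close> by simp
    qed
  qed (use d in auto)
qed

lemma bounded_compact_support:
  fixes f :: "'a::euclidean_space \<Rightarrow> 'b::real_normed_vector"
  assumes f: "continuous_on UNIV f" and supp: "\<And>x. norm x > R \<Longrightarrow> f x = 0"
  shows "\<exists>B\<ge>0. \<forall>x. norm (f x) \<le> B"
proof -
  have "bounded (f ` cball 0 R)"
    by (intro compact_imp_bounded compact_continuous_image continuous_on_subset[OF f]) auto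
  then obtain B where "\<forall>z\<in>cball 0 R. norm (f z) \<le> B"
    by (auto simp: bounded_iff)
  then have "norm (f z) \<le> \<bar>B\<bar>" for z
    using supp[of z] by (cases "norm z \<le> R") force+
  then show ?thesis by (intro exI[of _ "\<bar>B\<bar>"]) simp
qed

lemma integrable_compact_support:
  fixes f :: "'a::euclidean_space \<Rightarrow> real"
  assumes f: "continuous_on UNIV f" and supp: "\<And>x. norm x > R \<Longrightarrow> f x = 0"
  shows "integrable lborel f"
proof -
  have "integrable lborel (\<lambda>x. indicat_real (cball 0 R) x *\<^sub>R f x)"
    by (intro borel_integrable_compact continuous_on_subset[OF f]) auto
  moreover have "(\<lambda>x. indicat_real (cball 0 R) x *\<^sub>R f x) = f"
    using supp by (auto simp: indicator_def fun_eq_iff)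
  ultimately show ?thesis by simp
qed

lemma integrable_scaleR_translate:
  fixes f :: "'a::euclidean_space \<Rightarrow> real" and G :: "'a \<Rightarrow> 'a"
  assumes f: "integrable lborel f" and G: "continuous_on UNIV G" and B: "\<And>z. norm (G z) \<le> B"
  shows "integrable lborel (\<lambda>y. f y *\<^sub>R G (y - x))"
proof (rule Bochner_Integration.integrable_bound[of _ "\<lambda>y. B * f y"])
  have [measurable]: "f \<in> borel_measurable borel" "G \<in> borel_measurable borel"
    using borel_measurable_integrable[OF f] G by (simp_all add: borel_measurable_continuous_onI)
  show "(\<lambda>y. f y *\<^sub>R G (y - x)) \<in> borel_measurable lborel" by measurable
  show "AE y in lborel. norm (f y *\<^sub>R G (y - x)) \<le> norm (B * f y)"
  proof (rule AE_I2)
    fix y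
    have "0 \<le> B" using order_trans[OF norm_ge_zero B] .
    then show "norm (f y *\<^sub>R G (y - x)) \<le> norm (B * f y)"
      using mult_right_mono[OF B[of "y - x"], of "\<bar>f y\<bar>"] by (simp add: abs_mult mult.commute)
  qed
qed (use f in simp)

text \<open>All regularity sits in the kernel: uniform continuity of \<open>G\<close> makes the
  linearisation error of \<open>\<kappa> (y - x)\<close> small uniformly in y, and it is then
  integrated against \<open>f\<close>. The minus sign comes from differentiating in x.\<close>

lemma mollify_has_derivative:
  fixes \<kappa> :: "'a::euclidean_space \<Rightarrow> real"
  assumes \<kappa>: "\<And>z. (\<kappa> has_derivative (\<lambda>v. G z \<bullet> v)) (at z)" and G: "continuous_on UNIV G"
    and supp: "\<And>z. norm z > R \<Longrightarrow> G z = 0" and kb: "\<And>z. \<bar>\<kappa> z\<bar> \<le> C"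
    and f: "integrable lborel f"
  shows "(mollify \<kappa> f has_derivative (\<lambda>v. - (LINT y|lborel. f y *\<^sub>R G (y - x)) \<bullet> v)) (at x)"
proof -
  have [measurable]: "f \<in> borel_measurable borel"
    using borel_measurable_integrable[OF f] by simp
  have [measurable]: "G \<in> borel_measurable borel"
    using G by (simp add: borel_measurable_continuous_onI)
  have "continuous_on UNIV \<kappa>"
    by (intro continuous_at_imp_continuous_on ballI has_derivative_continuous[OF \<kappa>])
  then have [measurable]: "\<kappa> \<in> borel_measurable borel"
    by (simp add: borel_measurable_continuous_onI)
  have unif: "uniformly_continuous_on UNIV G"
    using G supp by (rule uniformly_continuous_compact_support)
  have eq: "mollify \<kappa> f x = (LINT y|lborel. \<kappa> (y - x) * f y)" for x
    using integral_lborel_translate[of "\<lambda>y. \<kappa> (y - x) * f y" x]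
    by (simp add: mollify_def add.commute)
  have int: "integrable lborel (\<lambda>y. \<kappa> (y - x) * f y)" for x
    using kb by (intro integrable_bounded_mult[OF f]) auto
  obtain B where B: "\<And>z. norm (G z) \<le> B"
    using bounded_compact_support[OF G supp] by blast
  have intG: "integrable lborel (\<lambda>y. f y *\<^sub>R G (y - x))" for x
    by (rule integrable_scaleR_translate[OF f G B])
  define I where "I = (LINT y|lborel. \<bar>f y\<bar>)"
  have I: "I \<ge> 0" by (simp add: I_def)
  show ?thesis
    unfolding has_derivative_at_alt
  proof (intro conjI allI impI)
    show "bounded_linear (\<lambda>v. - (LINT y|lborel. f y *\<^sub>R G (y - x)) \<bullet> v)"
      by (rule bounded_linear_inner_right)
    fix e :: real assume e: "e > 0"
    \<comment> \<open>The added 1 keeps the quotient meaningful when \<open>f\<close> vanishes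
      almost everywhere.\<close>
    define e' where "e' = e / (I + 1)"
    have e': "e' > 0" using e I by (simp add: e'_def)
    with unif obtain d where "d > 0" and d0: "\<forall>x\<in>UNIV. \<forall>y\<in>UNIV. dist y x < d \<longrightarrow> dist (G y) (G x) < e'"
      unfolding uniformly_continuous_on_def by blast
    then have d: "d > 0" "\<And>x y. norm (y - x) < d \<Longrightarrow> norm (G y - G x) < e'"
      by (simp_all add: dist_norm)
    \<comment> \<open>The mean value inequality for \<open>\<kappa>\<close> minus its linear part at
      z; the gradient of the difference is G y - G z, which is small near z.\<close>
    have lin: "\<bar>\<kappa> (z - v) - \<kappa> z + G z \<bullet> v\<bar> \<le> e' * norm v" if v: "norm v < d" for z v
    proof -
      have "norm ((\<kappa> (z - v) - G z \<bullet> (z - v)) - (\<kappa> z - G z \<bullet> z)) \<le> e' * norm ((z - v) - z)"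
      proof (rule differentiable_bound[of "ball z d" "\<lambda>y. \<kappa> y - G z \<bullet> y" "\<lambda>y v. (G y - G z) \<bullet> v"])
        fix y assume y: "y \<in> ball z d"
        show "((\<lambda>y. \<kappa> y - G z \<bullet> y) has_derivative (\<lambda>v. (G y - G z) \<bullet> v)) (at y within ball z d)"
          by (auto intro!: derivative_eq_intros has_derivative_at_withinI[OF \<kappa>] simp: inner_diff_left)
        show "onorm (\<lambda>v. (G y - G z) \<bullet> v) \<le> e'"
        proof (rule onorm_le)
          fix v
          have "norm (G y - G z) \<le> e'"
            using d(2)[of y z] y by (simp add: dist_norm norm_minus_commute)
          then show "norm ((G y - G z) \<bullet> v) \<le> e' * norm v"
            using order_trans[OF Cauchy_Schwarz_ineq2[of "G y - G z" v] mult_right_mono[of _ e' "norm v"]]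
            by simp
        qed
      qed (use v d in \<open>auto simp: dist_norm\<close>)
      then show ?thesis by (simp add: inner_diff_right)
    qed
    show "\<exists>d>0. \<forall>y. norm (y - x) < d \<longrightarrow>
      norm (mollify \<kappa> f y - mollify \<kappa> f x - - (LINT y|lborel. f y *\<^sub>R G (y - x)) \<bullet> (y - x)) \<le> e * norm (y - x)"
    proof (intro exI[of _ d] conjI allI impI)
      fix x' assume x': "norm (x' - x) < d"
      define v where "v = x' - x"
      have "(LINT y|lborel. f y *\<^sub>R G (y - x)) \<bullet> v = (LINT y|lborel. (f y *\<^sub>R G (y - x)) \<bullet> v)"
        by (rule integral_inner_left[symmetric]) (rule intG)
      moreover have iGv: "integrable lborel (\<lambda>y. (f y *\<^sub>R G (y - x)) \<bullet> v)"
        using intG by (intro integrable_inner_left) auto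
      ultimately have "mollify \<kappa> f x' - mollify \<kappa> f x - - (LINT y|lborel. f y *\<^sub>R G (y - x)) \<bullet> v
        = (LINT y|lborel. \<kappa> (y - x') * f y - \<kappa> (y - x) * f y + (f y *\<^sub>R G (y - x)) \<bullet> v)"
        using int by (simp add: eq)
      also have "\<bar>\<dots>\<bar> \<le> (LINT y|lborel. e' * norm v * \<bar>f y\<bar>)"
      proof (rule order_trans[OF integral_abs_bound integral_mono])
        fix y
        have "\<kappa> (y - x') * f y - \<kappa> (y - x) * f y + (f y *\<^sub>R G (y - x)) \<bullet> v
          = (\<kappa> ((y - x) - v) - \<kappa> (y - x) + G (y - x) \<bullet> v) * f y"
          by (simp add: v_def algebra_simps)
        then show "\<bar>\<kappa> (y - x') * f y - \<kappa> (y - x) * f y + (f y *\<^sub>R G (y - x)) \<bullet> v\<bar> \<le> e' * norm v * \<bar>f y\<bar>"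
          using lin[of v "y - x"] x' by (simp add: abs_mult v_def mult_right_mono)
      qed (use f int iGv in auto)
      also have "\<dots> = e * norm v * (I / (I + 1))"
        by (simp add: I_def e'_def)
      also have "\<dots> \<le> e * norm v"
        using I e by (intro mult_left_le) auto
      finally show "norm (mollify \<kappa> f x' - mollify \<kappa> f x - - (LINT y|lborel. f y *\<^sub>R G (y - x)) \<bullet> (x' - x)) \<le> e * norm (x' - x)"
        by (simp add: v_def)
    qed (use d in auto)
  qed
qed

text \<open>Extension by zero makes translations and convolution on the whole space available. Since
  test functions are supported inside the ball, nothing is claimed about a weak gradient across the
  unit sphere.\<close>

definition weak_pair :: "('a::euclidean_space \<Rightarrow> real) \<Rightarrow> ('a \<Rightarrow> 'a) \<Rightarrow> bool" where
  "weak_pair u h \<longleftrightarrow>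
     u \<in> borel_measurable borel \<and> h \<in> borel_measurable borel \<and>
     integrable lborel (\<lambda>x. (u x)\<^sup>2) \<and> integrable lborel (\<lambda>x. (norm (h x))\<^sup>2) \<and>
     (\<forall>x. x \<notin> hyp_ball \<longrightarrow> u x = 0 \<and> h x = 0) \<and>
     (\<forall>\<phi>. test_function \<phi> \<longrightarrow> (\<forall>i\<in>Basis.
        (LINT x|lborel. u x * frechet_derivative \<phi> (at x) i) = - (LINT x|lborel. (h x \<bullet> i) * \<phi> x)))"

text \<open>
  Unlike the weak formulation, approximability by continuously differentiable functions is visibly
  stable under multiplication by and addition of such functions.
\<close>

definition grad_approx :: "real \<Rightarrow> ('a::euclidean_space \<Rightarrow> real) \<Rightarrow> ('a \<Rightarrow> 'a) \<Rightarrow> bool" where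
  "grad_approx r u h \<longleftrightarrow> (\<forall>e>0. \<exists>w k. C1_on (ball 0 r) w k \<and>
     integrable (lborel_ball r) (\<lambda>x. (w x - u x)\<^sup>2 + (norm (k x - h x))\<^sup>2) \<and>
     (LINT x|lborel_ball r. (w x - u x)\<^sup>2 + (norm (k x - h x))\<^sup>2) \<le> e)"

lemma integrable_of_square_in_ball:
  fixes f :: "'a::euclidean_space \<Rightarrow> real"
  assumes "f \<in> borel_measurable borel" "integrable lborel (\<lambda>x. (f x)\<^sup>2)" "\<And>x. x \<notin> ball 0 1 \<Longrightarrow> f x = 0"
  shows "integrable lborel f"
proof (rule Bochner_Integration.integrable_bound[of _ "\<lambda>x. indicat_real (ball 0 1) x + (f x)\<^sup>2"])
  show "integrable lborel (\<lambda>x. indicat_real (ball 0 1) x + (f x)\<^sup>2)"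
    using assms(2) emeasure_lborel_ball_finite[of "0::'a" 1]
    by (intro Bochner_Integration.integrable_add) (auto simp: integrable_indicator_iff)
  show "AE x in lborel. norm (f x) \<le> norm (indicat_real (ball 0 1) x + (f x)\<^sup>2)"
  proof (rule AE_I2)
    fix x :: 'a
    have *: "\<bar>t\<bar> \<le> 1 + t\<^sup>2" for t :: real
    proof (cases "\<bar>t\<bar> \<le> 1")
      case False
      then have "\<bar>t\<bar> * 1 \<le> \<bar>t\<bar> * \<bar>t\<bar>" by (intro mult_left_mono) auto
      then show ?thesis by (simp add: power2_eq_square)
    qed (simp add: add_increasing2)
    show "norm (f x) \<le> norm (indicat_real (ball 0 1) x + (f x)\<^sup>2)"
    proof (cases "x \<in> ball 0 1")
      case True
      then show ?thesis using *[of "f x"] by (simp add: indicator_def)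
    next
      case False
      then show ?thesis using assms(3)[OF False] by simp
    qed
  qed
  show "f \<in> borel_measurable lborel" using assms(1) by simp
qed

lemma standard_bump_nonneg: "0 \<le> standard_bump \<epsilon> z"
  by (simp add: standard_bump_def bump_nonneg)

lemma standard_bump_le_1: "standard_bump \<epsilon> z \<le> 1"
  by (simp add: standard_bump_def bump_def)

lemma standard_bump_eq_0: "\<epsilon> > 0 \<Longrightarrow> norm z \<ge> \<epsilon> \<Longrightarrow> standard_bump \<epsilon> z = 0"
  using standard_bump_pos_iff[of \<epsilon> z] standard_bump_nonneg[of \<epsilon> z] by linarith

lemma continuous_standard_bump: "continuous_on UNIV (standard_bump \<epsilon>)"
  by (intro continuous_at_imp_continuous_on ballI has_derivative_continuous[OF standard_bump_has_derivative])

lemma integrable_standard_bump: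
  assumes "\<epsilon> > 0"
  shows "integrable lborel (standard_bump \<epsilon> :: 'a::euclidean_space \<Rightarrow> real)"
proof (rule Bochner_Integration.integrable_bound[of _ "indicat_real (ball (0::'a) \<epsilon>)"])
  show "integrable lborel (indicat_real (ball (0::'a) \<epsilon>))"
    using emeasure_lborel_ball_finite[of "0::'a" \<epsilon>] by (auto simp: integrable_indicator_iff)
  show "AE x in lborel. norm (standard_bump \<epsilon> x) \<le> norm (indicat_real (ball (0::'a) \<epsilon>) x)"
  proof (rule AE_I2)
    fix x :: 'a
    show "norm (standard_bump \<epsilon> x) \<le> norm (indicat_real (ball (0::'a) \<epsilon>) x)"
      by (cases "norm x < \<epsilon>")
         (simp_all add: standard_bump_eq_0[OF assms] abs_of_nonneg[OF standard_bump_nonneg] standard_bump_le_1)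
  qed
  show "standard_bump \<epsilon> \<in> borel_measurable (lborel :: 'a measure)"
    using borel_measurable_continuous_onI[OF continuous_standard_bump] by simp
qed

lemma integral_standard_bump_pos:
  assumes "\<epsilon> > 0"
  shows "(LINT z|lborel. standard_bump \<epsilon> (z::'a::euclidean_space)) > 0"
proof (rule ccontr)
  assume "\<not> ?thesis"
  then have "(LINT z|lborel. standard_bump \<epsilon> (z::'a)) = 0"
    by (intro order_antisym Bochner_Integration.integral_nonneg standard_bump_nonneg) simp
  then have ae: "AE z in lborel. standard_bump \<epsilon> (z::'a) = 0"
    using integral_nonneg_eq_0_iff_AE[OF integrable_standard_bump[OF assms]] standard_bump_nonneg by auto
  have "AE z in lborel. z \<notin> ball (0::'a) \<epsilon>"
    using ae by eventually_elim (use standard_bump_pos_iff[OF assms] in force)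
  then have "emeasure lborel (ball (0::'a) \<epsilon>) = 0"
    by (subst (asm) AE_iff_measurable[of "ball 0 \<epsilon>"]) auto
  then show False
    using assms content_ball_pos[of \<epsilon> "0::'a"] by (simp add: measure_def)
qed

text \<open>On the ball of radius r the gradient of the mollified \<open>u\<close> is the mollified
  \<open>h\<close>: the weak identity is tested with the kernel centred at x, which is admissible as
  its radius is at most 1 - r. Both mollifications then approximate in the square mean.\<close>

lemma weak_pair_grad_approx:
  fixes u :: "'a::euclidean_space \<Rightarrow> real"
  assumes wp: "weak_pair u h" and r: "r < 1"
  shows "grad_approx r u h"
  unfolding grad_approx_def
proof (intro allI impI)
  fix e :: real assume e: "e > 0"
  have um[measurable]: "u \<in> borel_measurable borel" and hm[measurable]: "h \<in> borel_measurable borel"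
    and u2: "integrable lborel (\<lambda>x. (u x)\<^sup>2)" and hn: "integrable lborel (\<lambda>x. (norm (h x))\<^sup>2)"
    and out: "\<And>x. x \<notin> hyp_ball \<Longrightarrow> u x = 0" "\<And>x. x \<notin> hyp_ball \<Longrightarrow> h x = 0"
    and weak: "\<And>\<phi> i. test_function \<phi> \<Longrightarrow> i \<in> Basis \<Longrightarrow>
        (LINT x|lborel. u x * frechet_derivative \<phi> (at x) i) = - (LINT x|lborel. (h x \<bullet> i) * \<phi> x)"
    using wp unfolding weak_pair_def by blast+
  have h2: "integrable lborel (\<lambda>x. (h x \<bullet> i)\<^sup>2)" if "i \<in> Basis" for i
  proof (rule Bochner_Integration.integrable_bound[of _ "\<lambda>x. (norm (h x))\<^sup>2"])
    show "AE x in lborel. norm ((h x \<bullet> i)\<^sup>2) \<le> norm ((norm (h x))\<^sup>2)"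
      using Basis_le_norm[OF that] by (intro AE_I2) (simp add: abs_le_square_iff[symmetric])
  qed (use hn in simp_all)
  have u1: "integrable lborel u"
    by (rule integrable_of_square_in_ball[OF um u2 out(1)])
  have h1: "integrable lborel (\<lambda>x. h x \<bullet> i)" if "i \<in> Basis" for i
    by (rule integrable_of_square_in_ball[OF _ h2[OF that]]) (measurable, simp add: out(2))
  \<comment> \<open>One share of the error for \<open>u\<close> and one for each component of
    \<open>h\<close>.\<close>
  define e' where "e' = e / (DIM('a) + 1)"
  have e': "e' > 0" using e by (simp add: e'_def)
  define Q where "Q d f \<longleftrightarrow> (\<forall>\<kappa> C. continuous_on UNIV \<kappa> \<and> integrable lborel \<kappa> \<and> (LINT z|lborel. \<kappa> z) = 1
      \<and> (\<forall>z. 0 \<le> \<kappa> z \<and> \<kappa> z \<le> C) \<and> (\<forall>z. norm z \<ge> d \<longrightarrow> \<kappa> z = 0) \<longrightarrow>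
      integrable lborel (\<lambda>x. (mollify \<kappa> f x - f x)\<^sup>2) \<and>
      (LINT x|lborel. (mollify \<kappa> f x - f x)\<^sup>2) \<le> e')" for d and f :: "'a \<Rightarrow> real"
  obtain du where du: "du > 0" "Q du u"
    using mollify_L2_approx[OF u1 u2 e'] unfolding Q_def by blast
  have "\<forall>i\<in>Basis. \<exists>d>0. Q d (\<lambda>x. h x \<bullet> i)"
    using mollify_L2_approx[OF h1 h2 e'] unfolding Q_def by blast
  then obtain dh where dh: "\<And>i. i \<in> Basis \<Longrightarrow> dh i > 0" "\<And>i. i \<in> Basis \<Longrightarrow> Q (dh i) (\<lambda>x. h x \<bullet> i)"
    by metis
  define \<epsilon> where "\<epsilon> = Min (insert (1 - r) (insert du (dh ` Basis)))"
  have \<epsilon>: "\<epsilon> > 0" "\<epsilon> \<le> 1 - r" "\<epsilon> \<le> du" "\<And>i. i \<in> Basis \<Longrightarrow> \<epsilon> \<le> dh i"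
    unfolding \<epsilon>_def using r du(1) dh(1) by (subst Min_gr_iff; force) (rule Min_le; simp)+
  define c where "c = (LINT z|lborel. standard_bump \<epsilon> (z::'a))"
  have c: "c > 0" unfolding c_def by (rule integral_standard_bump_pos[OF \<epsilon>(1)])
  define \<kappa> where "\<kappa> z = standard_bump \<epsilon> z / c" for z :: 'a
  \<comment> \<open>The gradient of \<open>\<kappa>\<close>: \<open>bump 2\<close> is the derivative
    of \<open>bump 0\<close>, and -2 z is the gradient of
    \<open>\<epsilon>\<^sup>2 - z \<bullet> z\<close>.\<close>
  define G where "G z = ((- 2 * bump 2 (\<epsilon>\<^sup>2 - z \<bullet> z)) / c) *\<^sub>R z" for z :: 'a
  have \<kappa>D: "(\<kappa> has_derivative (\<lambda>v. G z \<bullet> v)) (at z)" for z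
    using has_derivative_scaleR_right[OF standard_bump_has_derivative[of \<epsilon> z], of "1 / c"]
    unfolding \<kappa>_def[abs_def] G_def by (simp add: mult_ac)
  have Gc: "continuous_on UNIV G"
    unfolding G_def using c
    by (intro continuous_intros continuous_on_compose2[OF continuous_on_bump[of UNIV 2]]) auto
  have Gs: "G z = 0" if "norm z > \<epsilon>" for z
    using that \<epsilon>(1) by (simp add: G_def bump_zero dot_square_norm power_mono)
  have \<kappa>c: "continuous_on UNIV \<kappa>"
    unfolding \<kappa>_def using c by (intro continuous_intros continuous_standard_bump) auto
  have \<kappa>b: "0 \<le> \<kappa> z" "\<kappa> z \<le> 1 / c" for z
    using c by (simp_all add: \<kappa>_def divide_right_mono standard_bump_nonneg standard_bump_le_1)
  have \<kappa>i: "integrable lborel \<kappa>" "(LINT z|lborel. \<kappa> z) = 1"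
  proof -
    show "integrable lborel \<kappa>"
      unfolding \<kappa>_def[abs_def] by (intro integrable_divide_zero integrable_standard_bump \<epsilon>(1))
    show "(LINT z|lborel. \<kappa> z) = 1"
      using c by (simp add: \<kappa>_def[abs_def] c_def[symmetric])
  qed
  have \<kappa>s: "\<kappa> z = 0" if "norm z \<ge> \<epsilon>" for z
    using standard_bump_eq_0[OF \<epsilon>(1) that] by (simp add: \<kappa>_def)
  have Qapp: "integrable lborel (\<lambda>x. (mollify \<kappa> f x - f x)\<^sup>2)" "(LINT x|lborel. (mollify \<kappa> f x - f x)\<^sup>2) \<le> e'"
    if "Q d f" "\<epsilon> \<le> d" for d f
  proof -
    have "continuous_on UNIV \<kappa> \<and> integrable lborel \<kappa> \<and> (LINT z|lborel. \<kappa> z) = 1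
      \<and> (\<forall>z. 0 \<le> \<kappa> z \<and> \<kappa> z \<le> 1 / c) \<and> (\<forall>z. norm z \<ge> d \<longrightarrow> \<kappa> z = 0)"
      using that(2) \<kappa>c \<kappa>i \<kappa>b \<kappa>s by auto
    with that(1) show "integrable lborel (\<lambda>x. (mollify \<kappa> f x - f x)\<^sup>2)" "(LINT x|lborel. (mollify \<kappa> f x - f x)\<^sup>2) \<le> e'"
      unfolding Q_def by blast+
  qed
  have mD: "(mollify \<kappa> f has_derivative (\<lambda>v. - (LINT y|lborel. f y *\<^sub>R G (y - x)) \<bullet> v)) (at x)"
    if "integrable lborel f" for f x
    using \<kappa>b by (intro mollify_has_derivative[OF \<kappa>D Gc Gs _ that, where C="1/c"]) (auto simp: abs_of_nonneg)
  have mc: "continuous_on S (mollify \<kappa> f)" if "integrable lborel f" for f S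
    by (intro continuous_at_imp_continuous_on ballI has_derivative_continuous[OF mD[OF that]])
  define k where "k x = (\<Sum>i\<in>Basis. mollify \<kappa> (\<lambda>x. h x \<bullet> i) x *\<^sub>R i)" for x
  obtain B where B: "\<And>z. norm (G z) \<le> B"
    using bounded_compact_support[OF Gc Gs] by blast
  have intG: "integrable lborel (\<lambda>y. u y *\<^sub>R G (y - x))" for x
    by (rule integrable_scaleR_translate[OF u1 Gc B])
  \<comment> \<open>Differentiating the kernel in its centre x instead of in y reverses the sign;
    this cancels the sign in the weak identity.\<close>
  have grad: "k x = - (LINT y|lborel. u y *\<^sub>R G (y - x))" if x: "x \<in> ball 0 r" for x
  proof (rule euclidean_eqI)
    fix i :: 'a assume i: "i \<in> Basis"
    have "cball x \<epsilon> \<subseteq> hyp_ball"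
    proof
      fix y assume "y \<in> cball x \<epsilon>"
      then show "y \<in> hyp_ball"
        using x \<epsilon>(2) norm_triangle_ineq2[of y x] by (auto simp: dist_norm norm_minus_commute)
    qed
    from weak[OF test_function_standard_bump[OF \<epsilon>(1) this] i]
    have "(LINT y|lborel. u y * frechet_derivative (\<lambda>y. standard_bump \<epsilon> (y - x)) (at y) i)
        = - (LINT y|lborel. (h y \<bullet> i) * standard_bump \<epsilon> (y - x))"
      .
    moreover have "frechet_derivative (\<lambda>y. standard_bump \<epsilon> (y - x)) (at y) i = c * (G (y - x) \<bullet> i)" for y
    proof -
      have "((\<lambda>y. standard_bump \<epsilon> (y - x)) has_derivative (\<lambda>v. (- 2 * bump 2 (\<epsilon>\<^sup>2 - (y - x) \<bullet> (y - x))) *\<^sub>R (y - x) \<bullet> v)) (at y)"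
        by (rule has_derivative_compose[of "\<lambda>y. y - x" "\<lambda>v. v", OF _ standard_bump_has_derivative])
           (auto intro!: derivative_eq_intros)
      from frechet_derivative_at[OF this, symmetric] show ?thesis
        using c by (simp add: G_def)
    qed
    moreover have "standard_bump \<epsilon> (y - x) = c * \<kappa> (y - x)" for y
      using c by (simp add: \<kappa>_def)
    ultimately have "c * (LINT y|lborel. u y * (G (y - x) \<bullet> i)) = - (c * (LINT y|lborel. \<kappa> (y - x) * (h y \<bullet> i)))"
      by (simp add: mult.left_commute mult.commute[of "h _ \<bullet> i"])
    then have "(LINT y|lborel. u y * (G (y - x) \<bullet> i)) = - (LINT y|lborel. \<kappa> (y - x) * (h y \<bullet> i))"
      using c by (simp only: mult_minus_right[symmetric] mult_cancel_left) simp
    also have "(LINT y|lborel. \<kappa> (y - x) * (h y \<bullet> i)) = mollify \<kappa> (\<lambda>x. h x \<bullet> i) x"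
    proof -
      have [measurable]: "\<kappa> \<in> borel_measurable borel"
        using \<kappa>c by (simp add: borel_measurable_continuous_onI)
      show ?thesis
      using integral_lborel_translate[of "\<lambda>y. \<kappa> (y - x) * (h y \<bullet> i)" x]
      by (simp add: mollify_def add.commute)
    qed
    also have "(LINT y|lborel. u y * (G (y - x) \<bullet> i)) = (LINT y|lborel. u y *\<^sub>R G (y - x)) \<bullet> i"
      using intG[of x] by (subst integral_inner_left[symmetric]) auto
    finally show "k x \<bullet> i = - (LINT y|lborel. u y *\<^sub>R G (y - x)) \<bullet> i"
      using i by (simp add: k_def inner_sum_left inner_Basis if_distrib sum.delta cong: if_cong)
  qed
  have C1: "C1_on (ball 0 r) (mollify \<kappa> u) k"
    unfolding C1_on_def
  proof (intro conjI ballI)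
    fix x :: 'a assume x: "x \<in> ball 0 r"
    show "(mollify \<kappa> u has_derivative (\<lambda>v. k x \<bullet> v)) (at x)"
      unfolding grad[OF x] by (rule mD[OF u1])
  next
    show "continuous_on (ball 0 r) k"
      unfolding k_def[abs_def]
      by (rule continuous_on_sum, rule continuous_on_scaleR[OF _ continuous_on_const], rule mc, rule h1)
  qed
  define E where "E x = (mollify \<kappa> u x - u x)\<^sup>2 + (norm (k x - h x))\<^sup>2" for x
  have E: "E x = (mollify \<kappa> u x - u x)\<^sup>2 + (\<Sum>i\<in>Basis. (mollify \<kappa> (\<lambda>x. h x \<bullet> i) x - h x \<bullet> i)\<^sup>2)" for x
  proof -
    have "(norm (k x - h x))\<^sup>2 = (\<Sum>i\<in>Basis. ((k x - h x) \<bullet> i)\<^sup>2)"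
      by (simp add: norm_eq_sqrt_inner euclidean_inner[of "k x - h x" "k x - h x"] power2_eq_square sum_nonneg)
    also have "\<dots> = (\<Sum>i\<in>Basis. (mollify \<kappa> (\<lambda>x. h x \<bullet> i) x - h x \<bullet> i)\<^sup>2)"
      by (intro sum.cong) (auto simp: k_def inner_diff_left inner_sum_left inner_Basis if_distrib sum.delta cong: if_cong)
    finally show ?thesis by (simp add: E_def)
  qed
  have E0: "0 \<le> E x" for x
    by (simp add: E_def)
  have Ei: "integrable lborel E"
    unfolding E using Qapp(1)[OF du(2) \<epsilon>(3)] Qapp(1)[OF dh(2) \<epsilon>(4)] by auto
  have "(LINT x|lborel. E x) = (LINT x|lborel. (mollify \<kappa> u x - u x)\<^sup>2) + (\<Sum>i\<in>Basis. (LINT x|lborel. (mollify \<kappa> (\<lambda>x. h x \<bullet> i) x - h x \<bullet> i)\<^sup>2))"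
    unfolding E using Qapp(1)[OF du(2) \<epsilon>(3)] Qapp(1)[OF dh(2) \<epsilon>(4)]
    by (subst Bochner_Integration.integral_add) auto
  also have "\<dots> \<le> e' + (\<Sum>i\<in>(Basis::'a set). e')"
    using Qapp(2)[OF du(2) \<epsilon>(3)] Qapp(2)[OF dh(2) \<epsilon>(4)] by (intro add_mono sum_mono) auto
  also have "\<dots> = e' * (DIM('a) + 1)"
    by (simp add: algebra_simps)
  also have "\<dots> = e"
    unfolding e'_def by (rule nonzero_eq_divide_eq[THEN iffD1]) simp_all
  finally have Ele: "(LINT x|lborel. E x) \<le> e" .
  show "\<exists>w k. C1_on (ball 0 r) w k \<and>
     integrable (lborel_ball r) (\<lambda>x. (w x - u x)\<^sup>2 + (norm (k x - h x))\<^sup>2) \<and>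
     (LINT x|lborel_ball r. (w x - u x)\<^sup>2 + (norm (k x - h x))\<^sup>2) \<le> e"
    using C1 integrable_lborel_ball[OF Ei, of r] order_trans[OF integral_lborel_ball_mono[OF Ei, of r] Ele] E0
    by (intro exI[of _ "mollify \<kappa> u"] exI[of _ k]) (auto simp: E_def[abs_def])
qed

section \<open>The Poincare inequality on Euclidean balls\<close>

text \<open>Difference quotients have integral 0 by translation invariance, and they converge
  dominatedly: \<open>F\<close> is Lipschitz, and steps no longer than \<open>norm i\<close> keep
  the quotients supported in the ball of radius \<open>R + norm i\<close>.\<close>

lemma integral_derivative_compact_support:
  fixes F :: "'a::euclidean_space \<Rightarrow> real"
  assumes F: "C1_on UNIV F G" and supp: "\<And>x. norm x > R \<Longrightarrow> F x = 0 \<and> G x = 0"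
  shows "(LINT x|lborel. G x \<bullet> i) = 0"
proof -
  have FD: "(F has_derivative (\<lambda>v. G x \<bullet> v)) (at x)" and Gc: "continuous_on UNIV G" for x
    using F by (auto simp: C1_on_def)
  have Fc: "continuous_on UNIV F" using F by (rule C1_on_continuous)
  have [measurable]: "F \<in> borel_measurable borel" "G \<in> borel_measurable borel"
    using Gc Fc by (simp_all add: borel_measurable_continuous_onI)
  obtain B where B0: "B \<ge> 0" and B: "\<And>z. norm (G z) \<le> B"
    using bounded_compact_support[of G R] Gc supp by blast
  have lip: "\<bar>F y - F x\<bar> \<le> B * norm (y - x)" for x y
  proof -
    have "norm (F y - F x) \<le> B * norm (y - x)"
    proof (rule differentiable_bound[of UNIV F "\<lambda>x v. G x \<bullet> v"])
      show "onorm (\<lambda>v. G x \<bullet> v) \<le> B" for x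
      proof (rule onorm_le)
        fix v
        show "norm (G x \<bullet> v) \<le> B * norm v"
          using order_trans[OF Cauchy_Schwarz_ineq2[of "G x" v] mult_right_mono[OF B, of "norm v"]] by simp
      qed
    qed (use FD in auto)
    then show ?thesis by simp
  qed
  have Fi: "integrable lborel F"
    using supp by (intro integrable_compact_support[OF Fc, of R]) simp
  define s where "s n x = (F (x + (1 / real (Suc n)) *\<^sub>R i) - F x) * real (Suc n)" for n x
  have "(\<lambda>n. LINT x|lborel. s n x) \<longlonglongrightarrow> (LINT x|lborel. G x \<bullet> i)"
  proof (rule integral_dominated_convergence[where w="\<lambda>x. indicat_real (cball 0 (R + norm i)) x * (B * norm i)"])
    show "integrable lborel (\<lambda>x::'a. indicat_real (cball 0 (R + norm i)) x * (B * norm i))"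
      using emeasure_lborel_cball_finite[of "0::'a" "R + norm i"]
      by (intro integrable_mult_left) (auto simp: integrable_indicator_iff)
    show "AE x in lborel. (\<lambda>n. s n x) \<longlonglongrightarrow> G x \<bullet> i"
    proof (rule AE_I2)
      fix x
      have lin: "((\<lambda>t. x + t *\<^sub>R i) has_derivative (\<lambda>t. t *\<^sub>R i)) (at 0)"
        by (auto intro!: derivative_eq_intros)
      have "((\<lambda>t. F (x + t *\<^sub>R i)) has_derivative (\<lambda>t. G x \<bullet> (t *\<^sub>R i))) (at 0)"
        using has_derivative_compose[OF lin, of F "\<lambda>v. G x \<bullet> v"] FD[of x] by simp
      then have "((\<lambda>t. F (x + t *\<^sub>R i)) has_real_derivative (G x \<bullet> i)) (at 0)"
        by (simp add: has_field_derivative_def) (simp only: mult.commute[of _ "G x \<bullet> i"])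
      then have "((\<lambda>t. (F (x + t *\<^sub>R i) - F x) / t) \<longlongrightarrow> G x \<bullet> i) (at 0)"
        by (simp add: DERIV_def)
      moreover have "filterlim (\<lambda>n. 1 / real (Suc n)) (at 0) sequentially"
        by (simp add: filterlim_at LIMSEQ_Suc[OF lim_1_over_n] del: of_nat_Suc)
      ultimately have "(\<lambda>n. (F (x + (1 / real (Suc n)) *\<^sub>R i) - F x) / (1 / real (Suc n))) \<longlonglongrightarrow> G x \<bullet> i"
        by (rule filterlim_compose)
      then show "(\<lambda>n. s n x) \<longlonglongrightarrow> G x \<bullet> i"
        by (simp add: s_def del: of_nat_Suc)
    qed
    show "AE x in lborel. norm (s n x) \<le> indicat_real (cball 0 (R + norm i)) x * (B * norm i)" for n
    proof (rule AE_I2)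
      fix x
      define h where "h = (1 / real (Suc n)) *\<^sub>R i"
      have nh: "norm h \<le> norm i" "norm h * real (Suc n) = norm i"
        by (simp_all add: h_def divide_simps mult_left_le del: of_nat_Suc) (simp add: field_simps)
      have "norm (s n x) \<le> (B * norm h) * real (Suc n)"
        using lip[of "x + h" x] by (simp add: s_def h_def[symmetric] abs_mult mult_right_mono del: of_nat_Suc)
      then have 1: "norm (s n x) \<le> B * norm i"
        using nh(2) by (simp add: mult.assoc)
      show "norm (s n x) \<le> indicat_real (cball 0 (R + norm i)) x * (B * norm i)"
      proof (cases "norm x \<le> R + norm i")
        case True
        then show ?thesis using 1 by simp
      next
        case False
        moreover have "norm x \<le> norm (x + h) + norm h"
          using norm_triangle_ineq4[of "x + h" h] by simp
        ultimately have "norm x > R" "norm (x + h) > R"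
          using nh(1) norm_ge_zero[of i] by linarith+
        then have "F (x + h) = 0" "F x = 0" using supp by blast+
        moreover have "s n x = (F (x + h) - F x) * real (Suc n)" by (simp only: s_def h_def)
        ultimately show ?thesis using B0 by simp
      qed
    qed
  qed (auto simp: s_def)
  moreover have "(LINT x|lborel. s n x) = 0" for n
    using integral_lborel_translate[of F "(1 / real (Suc n)) *\<^sub>R i"]
      Fi integrable_lborel_translate[OF Fi, of "(1 / real (Suc n)) *\<^sub>R i"]
    by (simp add: s_def del: of_nat_Suc)
  ultimately show ?thesis
    by (simp add: LIMSEQ_const_iff)
qed

lemma nn_integral_lborel_affine:
  fixes f :: "'a::euclidean_space \<Rightarrow> ennreal"
  assumes [measurable]: "f \<in> borel_measurable borel" and "c \<noteq> 0"
  shows "(\<integral>\<^sup>+x. f x \<partial>lborel) = ennreal (\<bar>c\<bar> ^ DIM('a)) * (\<integral>\<^sup>+x. f (t + c *\<^sub>R x) \<partial>lborel)"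
proof -
  have "(\<integral>\<^sup>+x. f x \<partial>lborel) = (\<integral>\<^sup>+x. f x \<partial>density (distr lborel borel (\<lambda>x. t + c *\<^sub>R x)) (\<lambda>_. \<bar>c\<bar>^DIM('a)))"
    using lborel_affine[OF assms(2), of t] by simp
  also have "\<dots> = (\<integral>\<^sup>+x. ennreal (\<bar>c\<bar> ^ DIM('a)) * f (t + c *\<^sub>R x) \<partial>lborel)"
    by (simp add: nn_integral_density nn_integral_distr)
  finally show ?thesis by (simp add: nn_integral_cmult)
qed

text \<open>The fundamental theorem of calculus along the segment, followed by Jensen on [0, 1];
  \<open>2 * r\<close> bounds the length of the segment. Indicators and nonnegative integrals
  prepare the exchange of integrations in \<open>Poincare_ball_C1\<close>.\<close>

lemma square_diff_le_segment_integral: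
  fixes w :: "'a::euclidean_space \<Rightarrow> real"
  assumes w: "C1_on (ball 0 r) w k" and x: "x \<in> ball 0 r" and y: "y \<in> ball 0 r"
  shows "ennreal ((w x - w y)\<^sup>2) \<le> ennreal ((2 * r)\<^sup>2) *
    (\<integral>\<^sup>+t. indicator {0..1} t * (indicator (ball 0 r) (y + t *\<^sub>R (x - y)) * ennreal ((norm (k (y + t *\<^sub>R (x - y))))\<^sup>2)) \<partial>lborel)"
proof -
  define p where "p t = y + t *\<^sub>R (x - y)" for t
  have p: "p t \<in> ball 0 r" if "t \<in> {0..1}" for t
  proof -
    have "p t = (1 - t) *\<^sub>R y + t *\<^sub>R x" by (simp add: p_def algebra_simps)
    then show ?thesis using convexD_alt[OF convex_ball y x, of t] that by simp
  qed
  have wD: "\<And>z. z \<in> ball 0 r \<Longrightarrow> (w has_derivative (\<lambda>v. k z \<bullet> v)) (at z)" and kc: "continuous_on (ball 0 r) k"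
    using w by (auto simp: C1_on_def)
  have pc: "continuous_on {0..1} p" unfolding p_def by (intro continuous_intros)
  have kpc: "continuous_on {0..1} (\<lambda>t. k (p t))"
    using p by (intro continuous_on_compose2[OF kc pc]) auto
  have "(LINT t|lborel. indicat_real {0..1} t *\<^sub>R (k (p t) \<bullet> (x - y))) = w (p 1) - w (p 0)"
  proof (rule integral_FTC_Icc)
    fix t :: real assume t: "0 \<le> t" "t \<le> 1"
    have "(p has_derivative (\<lambda>s. s *\<^sub>R (x - y))) (at t)"
      unfolding p_def[abs_def] by (auto intro!: derivative_eq_intros)
    from has_derivative_compose[OF this wD] t p
    have "((\<lambda>t. w (p t)) has_derivative (\<lambda>s. k (p t) \<bullet> (s *\<^sub>R (x - y)))) (at t)" by simp
    then show "((\<lambda>t. w (p t)) has_vector_derivative k (p t) \<bullet> (x - y)) (at t within {0..1})"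
      by (simp add: has_vector_derivative_def has_derivative_at_withinI)
  next
    show "continuous_on {0..1} (\<lambda>t. k (p t) \<bullet> (x - y))"
      by (intro continuous_intros kpc)
  qed simp
  then have ftc: "w x - w y = (LINT t|lborel. indicat_real {0..1} t * (k (p t) \<bullet> (x - y)))"
    by (simp add: p_def)
  have i1: "integrable lborel (\<lambda>t. indicat_real {0..1} t * f t)" if "continuous_on {0..1} f" for f :: "real \<Rightarrow> real"
    using borel_integrable_compact[OF compact_Icc that] by simp
  have "(w x - w y)\<^sup>2 \<le> (LINT t|lborel. indicat_real {0..1} t * (k (p t) \<bullet> (x - y))\<^sup>2)"
    unfolding ftc
    by (rule Jensen_square) (auto intro!: i1 continuous_intros kpc simp: integrable_indicator_iff)
  also have "\<dots> \<le> (LINT t|lborel. (2 * r)\<^sup>2 * (indicat_real {0..1} t * (norm (k (p t)))\<^sup>2))"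
  proof (rule integral_mono)
    fix t :: real
    have "norm (x - y) \<le> 2 * r"
      using x y norm_triangle_ineq4[of x y] by auto
    then have "(norm (k (p t)) * norm (x - y))\<^sup>2 \<le> (norm (k (p t)) * (2 * r))\<^sup>2"
      by (intro power_mono mult_left_mono) auto
    moreover have "(k (p t) \<bullet> (x - y))\<^sup>2 \<le> (norm (k (p t)) * norm (x - y))\<^sup>2"
      using Cauchy_Schwarz_ineq2[of "k (p t)" "x - y"] by (simp add: abs_le_square_iff[symmetric])
    ultimately have "(k (p t) \<bullet> (x - y))\<^sup>2 \<le> (2 * r)\<^sup>2 * (norm (k (p t)))\<^sup>2"
      by (simp add: power_mult_distrib mult_ac)
    then show "indicat_real {0..1} t * (k (p t) \<bullet> (x - y))\<^sup>2 \<le> (2 * r)\<^sup>2 * (indicat_real {0..1} t * (norm (k (p t)))\<^sup>2)"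
      by (auto simp: indicator_def)
  qed (intro i1 integrable_mult_right continuous_intros kpc)+
  also have "\<dots> = (2 * r)\<^sup>2 * (LINT t|lborel. indicat_real {0..1} t * (norm (k (p t)))\<^sup>2)"
    by simp
  finally have "ennreal ((w x - w y)\<^sup>2) \<le> ennreal ((2 * r)\<^sup>2) * ennreal (LINT t|lborel. indicat_real {0..1} t * (norm (k (p t)))\<^sup>2)"
    by (subst ennreal_mult[symmetric]) (auto intro: ennreal_leI)
  also have "ennreal (LINT t|lborel. indicat_real {0..1} t * (norm (k (p t)))\<^sup>2)
    = (\<integral>\<^sup>+t. ennreal (indicat_real {0..1} t * (norm (k (p t)))\<^sup>2) \<partial>lborel)"
    by (subst nn_integral_eq_integral) (auto intro!: i1 continuous_intros kpc)
  also have "\<dots> = (\<integral>\<^sup>+t. indicator {0..1} t * (indicator (ball 0 r) (p t) * ennreal ((norm (k (p t)))\<^sup>2)) \<partial>lborel)"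
    using p by (intro nn_integral_cong) (auto simp: indicator_def)
  finally show ?thesis by (simp add: p_def)
qed

text \<open>The square of w x - w y, averaged over all pairs, is controlled through the joining
  segments; some y has its inner integral below the average plus \<open>\<delta>\<close>, and c = w
  y. A value of \<open>w\<close> is taken instead of its mean because integrability of
  \<open>w\<close> on the ball is not known beforehand.\<close>

lemma Poincare_ball_C1:
  fixes w :: "'a::euclidean_space \<Rightarrow> real"
  assumes w: "C1_on (ball 0 r) w k" and k2: "integrable (lborel_ball r) (\<lambda>x. (norm (k x))\<^sup>2)"
    and "\<delta> > 0" "r > 0"
  shows "\<exists>c. integrable (lborel_ball r) (\<lambda>x. (w x - c)\<^sup>2) \<and>
    (LINT x|lborel_ball r. (w x - c)\<^sup>2) \<le> (2 * r)\<^sup>2 * 2 ^ DIM('a) * (LINT x|lborel_ball r. (norm (k x))\<^sup>2) + \<delta>"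
proof -
  define B where "B = ball (0::'a) r"
  have [measurable]: "B \<in> sets borel" by (simp add: B_def)
  have kc: "continuous_on B k" and wc: "continuous_on B w"
    using w C1_on_continuous by (auto simp: C1_on_def B_def)
  \<comment> \<open>Cut off by an indicator, the functions become Borel on the whole space, where
    the integrations can be exchanged.\<close>
  define w' where "w' x = indicat_real B x *\<^sub>R w x" for x
  define k' where "k' x = indicat_real B x *\<^sub>R k x" for x
  have [measurable]: "w' \<in> borel_measurable borel" "k' \<in> borel_measurable borel"
    unfolding w'_def[abs_def] k'_def[abs_def]
    by (rule borel_measurable_continuous_on_indicator[OF _ wc] borel_measurable_continuous_on_indicator[OF _ kc], simp)+
  define K where "K z = ennreal ((norm (k' z))\<^sup>2)" for z
  have [measurable]: "K \<in> borel_measurable borel" unfolding K_def[abs_def] by measurable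
  have K: "K z = indicator (ball 0 r) z * ennreal ((norm (k z))\<^sup>2)" for z
    by (auto simp: K_def k'_def B_def indicator_def)
  define m where "m = measure lborel B"
  have m: "m > 0" using \<open>r > 0\<close> by (simp add: m_def B_def content_ball_pos)
  have em: "emeasure lborel B = ennreal m"
    unfolding m_def B_def using emeasure_lborel_ball_finite[of "0::'a" r]
    by (simp add: emeasure_eq_ennreal_measure)
  define I where "I = (LINT x|lborel_ball r. (norm (k x))\<^sup>2)"
  have I0: "I \<ge> 0" by (simp add: I_def)
  have IK: "(\<integral>\<^sup>+z. K z \<partial>lborel) = ennreal I"
  proof -
    have "ennreal I = (\<integral>\<^sup>+z. ennreal ((norm (k z))\<^sup>2) \<partial>lborel_ball r)"
      unfolding I_def by (rule nn_integral_eq_integral[symmetric, OF k2]) simp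
    also have "\<dots> = (\<integral>\<^sup>+z. K z \<partial>lborel)"
      unfolding K[abs_def] by (subst nn_integral_restrict_space) (simp_all add: mult.commute)
    finally show ?thesis by simp
  qed
  \<comment> \<open>Substituting a + t x costs the factor 1 / t ^ N, which is at most 2 ^ N for t
    \<ge> 1/2.\<close>
  have aff: "(\<integral>\<^sup>+x. K (a + t *\<^sub>R x) \<partial>lborel) \<le> ennreal (2 ^ DIM('a) * I)" if t: "t \<ge> 1 / 2" for a t
  proof -
    have "ennreal I = ennreal (\<bar>t\<bar> ^ DIM('a)) * (\<integral>\<^sup>+x. K (a + t *\<^sub>R x) \<partial>lborel)"
      using t by (subst IK[symmetric], subst nn_integral_lborel_affine[of K t a]) auto
    then have "ennreal (2 ^ DIM('a)) * ennreal I = ennreal (2 ^ DIM('a)) * ennreal (\<bar>t\<bar> ^ DIM('a)) * (\<integral>\<^sup>+x. K (a + t *\<^sub>R x) \<partial>lborel)"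
      by (simp add: mult.assoc)
    also have "ennreal (2 ^ DIM('a)) * ennreal (\<bar>t\<bar> ^ DIM('a)) = ennreal ((2 * t) ^ DIM('a))"
      using t by (simp add: ennreal_mult[symmetric] power_mult_distrib)
    also have "\<dots> * (\<integral>\<^sup>+x. K (a + t *\<^sub>R x) \<partial>lborel) \<ge> 1 * (\<integral>\<^sup>+x. K (a + t *\<^sub>R x) \<partial>lborel)"
      using t one_le_power[of "2 * t" "DIM('a)"]
      by (intro mult_right_mono) (simp_all only: ennreal_1[symmetric] ennreal_leI, simp_all)
    finally show ?thesis using I0 by (simp add: ennreal_mult)
  qed
  define J where "J = (\<lambda>t x y. indicator B x * indicator B y * K (y + t *\<^sub>R (x - y)))"
  have Jm[measurable]: "(\<lambda>(t, x, y). J t x y) \<in> borel_measurable (lborel \<Otimes>\<^sub>M lborel \<Otimes>\<^sub>M lborel)"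
    unfolding J_def by measurable
  \<comment> \<open>Of the two weights \<open>t\<close> and \<open>1 - t\<close> one is at least \<open>1/2\<close>; substitute in the corresponding variable.\<close>
  have Jt: "(\<integral>\<^sup>+x. \<integral>\<^sup>+y. J t x y \<partial>lborel \<partial>lborel) \<le> ennreal (2 ^ DIM('a) * I * m)" for t
  proof -
    have bnd: "(\<integral>\<^sup>+x. \<integral>\<^sup>+y. indicator B x * K (s *\<^sub>R x + (1 - s) *\<^sub>R y) \<partial>lborel \<partial>lborel) \<le> ennreal (2 ^ DIM('a) * I * m)"
      if "1 - s \<ge> 1 / 2" for s
    proof -
      have "(\<integral>\<^sup>+x. \<integral>\<^sup>+y. indicator B x * K (s *\<^sub>R x + (1 - s) *\<^sub>R y) \<partial>lborel \<partial>lborel)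
        \<le> (\<integral>\<^sup>+x. indicator B x * ennreal (2 ^ DIM('a) * I) \<partial>(lborel :: 'a measure))"
      proof (rule nn_integral_mono)
        fix x :: 'a
        show "(\<integral>\<^sup>+y. indicator B x * K (s *\<^sub>R x + (1 - s) *\<^sub>R y) \<partial>lborel) \<le> indicator B x * ennreal (2 ^ DIM('a) * I)"
          using aff[OF that, of "s *\<^sub>R x"] by (subst nn_integral_cmult) (auto intro!: mult_left_mono)
      qed
      also have "\<dots> = ennreal (2 ^ DIM('a) * I * m)"
        using m I0 by (subst nn_integral_multc) (auto simp: em ennreal_mult[symmetric] mult.commute)
      finally show ?thesis .
    qed
    show ?thesis
    proof (cases "t \<le> 1 / 2")
      case True
      have "(\<integral>\<^sup>+x. \<integral>\<^sup>+y. J t x y \<partial>lborel \<partial>lborel)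
        \<le> (\<integral>\<^sup>+x. \<integral>\<^sup>+y. indicator B x * K (t *\<^sub>R x + (1 - t) *\<^sub>R y) \<partial>lborel \<partial>lborel)"
        by (intro nn_integral_mono) (auto simp: J_def indicator_def algebra_simps)
      also have "\<dots> \<le> ennreal (2 ^ DIM('a) * I * m)" using True by (intro bnd) auto
      finally show ?thesis .
    next
      case False
      have "(\<integral>\<^sup>+x. \<integral>\<^sup>+y. J t x y \<partial>lborel \<partial>lborel) = (\<integral>\<^sup>+y. \<integral>\<^sup>+x. J t x y \<partial>lborel \<partial>lborel)"
        by (rule lborel_pair.Fubini') (unfold J_def, measurable)
      also have "\<dots> \<le> (\<integral>\<^sup>+y. \<integral>\<^sup>+x. indicator B y * K ((1 - t) *\<^sub>R y + (1 - (1 - t)) *\<^sub>R x) \<partial>lborel \<partial>lborel)"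
        by (intro nn_integral_mono) (auto simp: J_def indicator_def algebra_simps)
      also have "\<dots> \<le> ennreal (2 ^ DIM('a) * I * m)" using False by (intro bnd) auto
      finally show ?thesis .
    qed
  qed
  define f where "f y = (\<integral>\<^sup>+x. indicator B x * ennreal ((w' x - w' y)\<^sup>2) \<partial>lborel)" for y
  have [measurable]: "f \<in> borel_measurable borel" unfolding f_def[abs_def] by measurable
  have pt: "indicator B x * indicator B y * ennreal ((w' x - w' y)\<^sup>2) \<le>
      ennreal ((2 * r)\<^sup>2) * (\<integral>\<^sup>+t. indicator {0..1} t * J t x y \<partial>lborel)" for x y
  proof (cases "x \<in> B \<and> y \<in> B")
    case True
    then show ?thesis
      using square_diff_le_segment_integral[OF w, of x y]
      by (simp add: B_def[symmetric] J_def K w'_def)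
  next
    case False
    then show ?thesis by (auto simp: indicator_def)
  qed
  have tot: "(\<integral>\<^sup>+y. indicator B y * f y \<partial>lborel) \<le> ennreal ((2 * r)\<^sup>2 * (2 ^ DIM('a) * I * m))"
  proof -
    have "(\<integral>\<^sup>+y. indicator B y * f y \<partial>lborel) = (\<integral>\<^sup>+y. \<integral>\<^sup>+x. indicator B x * indicator B y * ennreal ((w' x - w' y)\<^sup>2) \<partial>lborel \<partial>lborel)"
      unfolding f_def by (subst nn_integral_cmult[symmetric]) (auto simp: mult_ac)
    also have "\<dots> = (\<integral>\<^sup>+x. \<integral>\<^sup>+y. indicator B x * indicator B y * ennreal ((w' x - w' y)\<^sup>2) \<partial>lborel \<partial>lborel)"
      by (rule lborel_pair.Fubini') measurable
    also have "\<dots> \<le> (\<integral>\<^sup>+x. \<integral>\<^sup>+y. ennreal ((2 * r)\<^sup>2) * (\<integral>\<^sup>+t. indicator {0..1} t * J t x y \<partial>lborel) \<partial>lborel \<partial>lborel)"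
      by (intro nn_integral_mono pt)
    also have "\<dots> = ennreal ((2 * r)\<^sup>2) * (\<integral>\<^sup>+x. \<integral>\<^sup>+y. \<integral>\<^sup>+t. indicator {0..1} t * J t x y \<partial>lborel \<partial>lborel \<partial>lborel)"
      unfolding J_def by (simp add: nn_integral_cmult)
    also have "(\<integral>\<^sup>+x. \<integral>\<^sup>+y. \<integral>\<^sup>+t. indicator {0..1} t * J t x y \<partial>lborel \<partial>lborel \<partial>lborel)
      = (\<integral>\<^sup>+x. \<integral>\<^sup>+t. \<integral>\<^sup>+y. indicator {0..1} t * J t x y \<partial>lborel \<partial>lborel \<partial>lborel)"
      by (intro nn_integral_cong lborel_pair.Fubini') (unfold J_def, measurable)
    also have "\<dots> = (\<integral>\<^sup>+t. \<integral>\<^sup>+x. \<integral>\<^sup>+y. indicator {0..1} t * J t x y \<partial>lborel \<partial>lborel \<partial>lborel)"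
      by (rule lborel_pair.Fubini') (unfold J_def, measurable)
    also have "\<dots> = (\<integral>\<^sup>+t. indicator {0..1} t * (\<integral>\<^sup>+x. \<integral>\<^sup>+y. J t x y \<partial>lborel \<partial>lborel) \<partial>lborel)"
      unfolding J_def by (simp add: nn_integral_cmult)
    also have "\<dots> \<le> (\<integral>\<^sup>+t. indicator {0..1} t * ennreal (2 ^ DIM('a) * I * m) \<partial>(lborel :: real measure))"
      by (intro nn_integral_mono mult_left_mono Jt) auto
    also have "\<dots> = ennreal (2 ^ DIM('a) * I * m)"
      by (subst nn_integral_multc) auto
    finally show ?thesis
      using m I0 by (simp add: ennreal_mult mult_left_mono)
  qed
  define M where "M = (2 * r)\<^sup>2 * 2 ^ DIM('a) * I"
  have M0: "M \<ge> 0" using I0 by (simp add: M_def)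
  \<comment> \<open>If \<open>f\<close> exceeded M + \<delta> on all of \<open>B\<close>, its
    integral over \<open>B\<close> would exceed the bound M m from \<open>tot\<close>.\<close>
  have "\<exists>y\<in>B. f y \<le> ennreal (M + \<delta>)"
  proof (rule ccontr)
    assume "\<not> ?thesis"
    then have "(\<integral>\<^sup>+y. indicator B y * ennreal (M + \<delta>) \<partial>lborel) \<le> (\<integral>\<^sup>+y. indicator B y * f y \<partial>lborel)"
      by (intro nn_integral_mono) (auto simp: indicator_def not_le intro: less_imp_le)
    also have "\<dots> \<le> ennreal (M * m)" using tot by (simp add: M_def mult_ac)
    also have "(\<integral>\<^sup>+y. indicator B y * ennreal (M + \<delta>) \<partial>lborel) = ennreal m * ennreal (M + \<delta>)"
      by (subst nn_integral_multc) (auto simp: em)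
    also have "\<dots> = ennreal ((M + \<delta>) * m)"
      using m M0 \<open>\<delta> > 0\<close> by (subst ennreal_mult[symmetric]) (auto simp: mult.commute)
    finally have "ennreal ((M + \<delta>) * m) \<le> ennreal (M * m)" .
    then show False using m M0 \<open>\<delta> > 0\<close> by (simp add: ennreal_le_iff)
  qed
  then obtain y where y: "y \<in> B" "f y \<le> ennreal (M + \<delta>)" by blast
  have fy: "(\<integral>\<^sup>+x. ennreal ((w x - w y)\<^sup>2) \<partial>lborel_ball r) = f y"
    unfolding f_def using y(1)
    by (subst nn_integral_restrict_space) (auto simp: B_def w'_def indicator_def intro!: nn_integral_cong)
  have wm: "w \<in> borel_measurable (lborel_ball r)"
    using borel_measurable_continuous_on_restrict[OF wc]
    by (simp add: B_def measurable_cong_sets[of "lborel_ball r" "restrict_space borel (ball 0 r)"] sets_restrict_space)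
  have int: "integrable (lborel_ball r) (\<lambda>x. (w x - w y)\<^sup>2)"
    using wm y(2) by (intro integrableI_bounded) (auto simp: fy intro: order_le_less_trans)
  moreover have "(LINT x|lborel_ball r. (w x - w y)\<^sup>2) \<le> M + \<delta>"
  proof -
    have "ennreal (LINT x|lborel_ball r. (w x - w y)\<^sup>2) \<le> ennreal (M + \<delta>)"
      using y(2) nn_integral_eq_integral[OF int] unfolding fy by simp
    then show ?thesis using M0 \<open>\<delta> > 0\<close> by (subst (asm) ennreal_le_iff) auto
  qed
  ultimately show ?thesis unfolding M_def I_def by blast
qed

section \<open>Integration by parts\<close>

lemma C1_on_has_derivative: "C1_on S f F \<Longrightarrow> x \<in> S \<Longrightarrow> (f has_derivative (\<lambda>v. F x \<bullet> v)) (at x)"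
  by (simp add: C1_on_def)

lemma C1_on_add: "C1_on S f F \<Longrightarrow> C1_on S g G \<Longrightarrow> C1_on S (\<lambda>x. f x + g x) (\<lambda>x. F x + G x)"
  by (auto simp: C1_on_def inner_add_left intro!: has_derivative_add continuous_intros)

lemma C1_on_mult:
  assumes "C1_on S f F" "C1_on S g G"
  shows "C1_on S (\<lambda>x. f x * g x) (\<lambda>x. f x *\<^sub>R G x + g x *\<^sub>R F x)"
  unfolding C1_on_def
proof (intro conjI ballI)
  fix x assume "x \<in> S"
  then have "((\<lambda>x. f x * g x) has_derivative (\<lambda>v. f x * (G x \<bullet> v) + (F x \<bullet> v) * g x)) (at x)"
    by (intro has_derivative_mult C1_on_has_derivative[OF assms(1)] C1_on_has_derivative[OF assms(2)])
  then show "((\<lambda>x. f x * g x) has_derivative (\<lambda>v. (f x *\<^sub>R G x + g x *\<^sub>R F x) \<bullet> v)) (at x)"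
    by (simp add: inner_add_left mult.commute)
next
  show "continuous_on S (\<lambda>x. f x *\<^sub>R G x + g x *\<^sub>R F x)"
    using assms C1_on_continuous[OF assms(1)] C1_on_continuous[OF assms(2)]
    by (auto simp: C1_on_def intro!: continuous_intros)
qed

lemma C1_on_const: "C1_on S (\<lambda>x. c) (\<lambda>x. 0)"
  by (simp add: C1_on_def)

lemma C1_on_inner: "C1_on S (\<lambda>x. x \<bullet> i) (\<lambda>x. i)"
  by (auto simp: C1_on_def inner_commute[of i] intro!: derivative_eq_intros)

text \<open>The open ball of radius r and the open set b < |x| cover the space, and
  differentiability and continuity are local.\<close>

lemma C1_on_extend_zero:
  fixes f :: "'a::euclidean_space \<Rightarrow> real"
  assumes f: "C1_on (ball 0 r) f F" and supp: "\<And>x. norm x > b \<Longrightarrow> f x = 0 \<and> F x = 0" and "b < r"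
  shows "C1_on UNIV f F"
  unfolding C1_on_def
proof (intro conjI ballI)
  have op: "open {x::'a. b < norm x}"
    by (intro open_Collect_less continuous_intros)
  fix x :: 'a
  show "(f has_derivative (\<lambda>v. F x \<bullet> v)) (at x)"
  proof (cases "norm x < r")
    case True
    then show ?thesis using f by (simp add: C1_on_def)
  next
    case False
    then have x: "x \<in> {x. b < norm x}" using \<open>b < r\<close> by simp
    have "((\<lambda>x. 0) has_derivative (\<lambda>v. F x \<bullet> v)) (at x)"
      using supp x by simp
    then show ?thesis
      by (rule has_derivative_transform_within_open[OF _ op x]) (use supp in auto)
  qed
next
  have op: "open {x::'a. b < norm x}"
    by (intro open_Collect_less continuous_intros)
  have "continuous_on (ball 0 r) F" using f by (simp add: C1_on_def)
  moreover have "continuous_on {x. b < norm x} F"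
    using supp by (subst continuous_on_cong[OF refl, of _ _ "\<lambda>_. 0"]) auto
  ultimately have "continuous_on (ball 0 r \<union> {x. b < norm x}) F"
    by (intro continuous_on_open_Un op) auto
  moreover have "ball 0 r \<union> {x::'a. b < norm x} = UNIV"
    using \<open>b < r\<close> by auto
  ultimately show "continuous_on UNIV F" by simp
qed

text \<open>At the origin the gradient formula gives 0, which is right because f' vanishes there;
  continuity at the origin follows since the gradient has length at most |f' (norm x)|.\<close>

lemma C1_on_radial:
  fixes f f' :: "real \<Rightarrow> real"
  assumes f: "\<And>s. \<bar>s\<bar> < 1 \<Longrightarrow> (f has_real_derivative f' s) (at s)"
    and f'c: "continuous_on {-1<..<1} f'" and f'0: "f' 0 = 0"
  shows "C1_on (ball (0::'a::euclidean_space) 1) (\<lambda>x. f (norm x)) (\<lambda>x. (f' (norm x) / norm x) *\<^sub>R x)"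
  unfolding C1_on_def
proof (intro conjI ballI)
  fix x :: 'a assume x: "x \<in> ball 0 1"
  show "((\<lambda>x. f (norm x)) has_derivative (\<lambda>v. (f' (norm x) / norm x) *\<^sub>R x \<bullet> v)) (at x)"
  proof (cases "x = 0")
    case False
    then have "(norm has_derivative (\<lambda>v. v \<bullet> sgn x)) (at x)"
      by (rule has_derivative_norm)
    from DERIV_compose_FDERIV[OF f this] x False show ?thesis
      by (simp add: sgn_div_norm inner_commute divide_inverse mult_ac)
  next
    case True
    have "\<exists>d>0. \<forall>y::'a. norm y < d \<longrightarrow> \<bar>f (norm y) - f 0\<bar> \<le> e * norm y" if "e > 0" for e
    proof -
      have "(f has_derivative (\<lambda>v. 0)) (at 0)"
      proof -
        have "(*) (0::real) = (\<lambda>v. 0)" by auto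
        then show ?thesis using f[of 0] f'0 by (simp add: has_field_derivative_def)
      qed
      then obtain d where d: "d > 0" "\<And>y. norm y < d \<Longrightarrow> \<bar>f y - f 0\<bar> \<le> e * \<bar>y\<bar>"
        using \<open>e > 0\<close> by (auto simp: has_derivative_at_alt)
      show ?thesis using d(1) d(2)[of "norm _"] by auto
    qed
    then show ?thesis
      using True by (simp add: has_derivative_at_alt)
  qed
next
  show "continuous_on (ball 0 1) (\<lambda>x::'a. (f' (norm x) / norm x) *\<^sub>R x)"
    unfolding continuous_on_eq_continuous_at[OF open_ball]
  proof
    fix x :: 'a assume x: "x \<in> ball 0 1"
    have f'i: "isCont f' s" if "\<bar>s\<bar> < 1" for s
      using f'c that continuous_on_eq_continuous_at[of "{-1<..<1}" f'] by (auto simp: abs_less_iff)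
    show "isCont (\<lambda>x. (f' (norm x) / norm x) *\<^sub>R x) x"
    proof (cases "x = 0")
      case False
      have "isCont (\<lambda>x. f' (norm x)) x"
        using x by (intro isCont_o2[OF _ f'i] continuous_intros) auto
      then show ?thesis using False by (intro continuous_intros) auto
    next
      case True
      have "isCont (\<lambda>x::'a. f' (norm x)) 0"
        by (intro isCont_o2[OF _ f'i] continuous_intros) auto
      then have "((\<lambda>x::'a. f' (norm x)) \<longlongrightarrow> f' (norm (0::'a))) (at 0)"
        by (simp add: isCont_def)
      from tendsto_rabs[OF this] have lim: "((\<lambda>x::'a. \<bar>f' (norm x)\<bar>) \<longlongrightarrow> 0) (at 0)"
        by (simp add: f'0)
      have "((\<lambda>x::'a. (f' (norm x) / norm x) *\<^sub>R x) \<longlongrightarrow> 0) (at 0)"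
      proof (rule Lim_null_comparison[OF always_eventually lim], rule allI)
        fix x :: 'a
        show "norm ((f' (norm x) / norm x) *\<^sub>R x) \<le> \<bar>f' (norm x)\<bar>"
          by (cases "x = 0") auto
      qed
      then show ?thesis using True by (simp add: isCont_def)
    qed
  qed
qed

section \<open>Transfer from C^1 functions to weakly differentiable ones\<close>

lemma measurable_lborel_ball_continuous:
  "continuous_on (ball 0 r) f \<Longrightarrow> f \<in> borel_measurable (lborel_ball r)"
  using borel_measurable_continuous_on_restrict[of "ball 0 r" f]
  by (simp add: measurable_cong_sets[of "lborel_ball r" "restrict_space borel (ball 0 r)"] sets_restrict_space)

lemma measurable_lborel_ball: "f \<in> borel_measurable borel \<Longrightarrow> f \<in> borel_measurable (lborel_ball r)"
  by (rule measurable_restrict_space1) simp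

lemma integrable_lborel_ball_bound:
  fixes f g :: "'a::euclidean_space \<Rightarrow> real"
  assumes g: "integrable (lborel_ball r) g" and f: "f \<in> borel_measurable borel"
    and le: "\<And>x. norm x < r \<Longrightarrow> \<bar>f x\<bar> \<le> g x"
  shows "integrable (lborel_ball r) f"
proof (rule Bochner_Integration.integrable_bound[OF g measurable_lborel_ball[OF f] AE_I2])
  fix x :: 'a assume "x \<in> space (lborel_ball r)"
  then have "\<bar>f x\<bar> \<le> g x" by (intro le) (simp add: space_restrict_space)
  then show "norm (f x) \<le> norm (g x)" by simp
qed

lemma norm_add_square_le: "(norm (a + b))\<^sup>2 \<le> 2 * (norm a)\<^sup>2 + 2 * (norm (b :: 'a::real_normed_vector))\<^sup>2"
proof -
  have "(norm (a + b))\<^sup>2 \<le> (norm a + norm b)\<^sup>2"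
    by (intro power_mono norm_triangle_ineq) auto
  also have "\<dots> \<le> 2 * (norm a)\<^sup>2 + 2 * (norm b)\<^sup>2"
    using sum_squares_bound[of "norm a" "norm b"] by (simp add: power2_sum)
  finally show ?thesis .
qed

text \<open>The product rule survives the approximation. It serves to subtract a Gaussian
  (\<open>f\<close> = 1) and to divide by one (\<open>g\<close> = 0). On the closed ball of radius r
  < 1 the factor and its gradient are bounded by some \<open>M\<close>; in the factor
  \<open>3 * M\<^sup>2\<close> one \<open>M\<^sup>2\<close> comes from the values and two from the
  gradients, while \<open>g\<close> cancels.\<close>

lemma grad_approx_affine:
  fixes u :: "'a::euclidean_space \<Rightarrow> real"
  assumes ga: "grad_approx r u h" and "r < 1"
    and um: "u \<in> borel_measurable borel" and hm: "h \<in> borel_measurable borel"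
    and f: "C1_on (ball 0 1) f F" and g: "C1_on (ball 0 1) g G"
  shows "grad_approx r (\<lambda>x. f x * u x + g x) (\<lambda>x. f x *\<^sub>R h x + u x *\<^sub>R F x + G x)"
  unfolding grad_approx_def
proof (intro allI impI)
  fix e :: real assume e: "e > 0"
  have sub: "cball (0::'a) r \<subseteq> ball 0 1" using \<open>r < 1\<close> by auto
  have fr: "C1_on (ball 0 r) f F" and gr: "C1_on (ball 0 r) g G"
    using f g \<open>r < 1\<close> by (auto intro: C1_on_subset)
  have cf: "continuous_on (ball 0 1) f" "continuous_on (ball 0 1) F"
    using f C1_on_continuous by (auto simp: C1_on_def)
  have "bounded (f ` cball 0 r)" "bounded (F ` cball 0 r)"
    by (intro compact_imp_bounded compact_continuous_image continuous_on_subset[OF _ sub] cf compact_cball)+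
  then obtain a b where ab: "\<forall>x\<in>cball 0 r. norm (f x) \<le> a" "\<forall>x\<in>cball 0 r. norm (F x) \<le> b"
    by (auto simp: bounded_iff)
  define M where "M = \<bar>a\<bar> + \<bar>b\<bar> + 1"
  have M: "M > 0" by (simp add: M_def)
  have fM: "\<bar>f x\<bar> \<le> M" "norm (F x) \<le> M" if "x \<in> ball 0 r" for x
    using ab that by (auto simp: M_def abs_if intro: order_trans dest!: bspec[of _ _ x])
  obtain w k where w: "C1_on (ball 0 r) w k"
     "integrable (lborel_ball r) (\<lambda>x. (w x - u x)\<^sup>2 + (norm (k x - h x))\<^sup>2)"
     "(LINT x|lborel_ball r. (w x - u x)\<^sup>2 + (norm (k x - h x))\<^sup>2) \<le> e / (3 * M\<^sup>2)"
  proof -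
    have "e / (3 * M\<^sup>2) > 0" using e M by simp
    from ga[unfolded grad_approx_def, rule_format, OF this] that show thesis by (elim exE conjE)
  qed
  define W where "W x = f x * w x + g x" for x
  define K where "K x = f x *\<^sub>R k x + w x *\<^sub>R F x + G x" for x
  have C1: "C1_on (ball 0 r) W K"
    using C1_on_add[OF C1_on_mult[OF fr w(1)] gr] by (simp add: W_def[abs_def] K_def[abs_def])
  let ?L = "\<lambda>x. (W x - (f x * u x + g x))\<^sup>2 + (norm (K x - (f x *\<^sub>R h x + u x *\<^sub>R F x + G x)))\<^sup>2"
  let ?R = "\<lambda>x. 3 * M\<^sup>2 * ((w x - u x)\<^sup>2 + (norm (k x - h x))\<^sup>2)"
  have le: "?L x \<le> ?R x" if "x \<in> ball 0 r" for x
  proof -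
    have f2: "(f x)\<^sup>2 \<le> M\<^sup>2" "(norm (F x))\<^sup>2 \<le> M\<^sup>2"
      using fM[OF that] M by (auto simp: abs_le_square_iff[symmetric])
    have 1: "(W x - (f x * u x + g x))\<^sup>2 = (f x)\<^sup>2 * (w x - u x)\<^sup>2"
      by (simp add: W_def power_mult_distrib[symmetric] algebra_simps)
    have "K x - (f x *\<^sub>R h x + u x *\<^sub>R F x + G x) = f x *\<^sub>R (k x - h x) + (w x - u x) *\<^sub>R F x"
      by (simp add: K_def algebra_simps)
    then have "(norm (K x - (f x *\<^sub>R h x + u x *\<^sub>R F x + G x)))\<^sup>2
      \<le> 2 * (norm (f x *\<^sub>R (k x - h x)))\<^sup>2 + 2 * (norm ((w x - u x) *\<^sub>R F x))\<^sup>2"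
      by (simp only: norm_add_square_le)
    also have "\<dots> = 2 * ((f x)\<^sup>2 * (norm (k x - h x))\<^sup>2) + 2 * ((norm (F x))\<^sup>2 * (w x - u x)\<^sup>2)"
      by (simp add: power_mult_distrib)
    also have "\<dots> \<le> 2 * (M\<^sup>2 * (norm (k x - h x))\<^sup>2) + 2 * (M\<^sup>2 * (w x - u x)\<^sup>2)"
      using f2 by (intro add_mono mult_left_mono mult_right_mono) auto
    finally have 2: "(norm (K x - (f x *\<^sub>R h x + u x *\<^sub>R F x + G x)))\<^sup>2 \<le> 2 * (M\<^sup>2 * (norm (k x - h x))\<^sup>2) + 2 * (M\<^sup>2 * (w x - u x)\<^sup>2)" .
    have "(W x - (f x * u x + g x))\<^sup>2 \<le> M\<^sup>2 * (w x - u x)\<^sup>2"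
      unfolding 1 using f2 by (intro mult_right_mono) auto
    with 2 have "?L x \<le> M\<^sup>2 * (w x - u x)\<^sup>2 + (2 * (M\<^sup>2 * (norm (k x - h x))\<^sup>2) + 2 * (M\<^sup>2 * (w x - u x)\<^sup>2))"
      by (rule add_mono[rotated])
    also have "\<dots> \<le> ?R x"
      using mult_nonneg_nonneg[of "M\<^sup>2" "(norm (k x - h x))\<^sup>2"] by (simp add: distrib_left) 
    finally show ?thesis .
  qed
  have Ri: "integrable (lborel_ball r) ?R" using w(2) by simp
  have Wm: "W \<in> borel_measurable (lborel_ball r)" "K \<in> borel_measurable (lborel_ball r)"
    "f \<in> borel_measurable (lborel_ball r)" "F \<in> borel_measurable (lborel_ball r)"
    "g \<in> borel_measurable (lborel_ball r)" "G \<in> borel_measurable (lborel_ball r)"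
    using C1 fr gr C1_on_continuous by (auto simp: C1_on_def intro!: measurable_lborel_ball_continuous)
  note [measurable] = Wm measurable_lborel_ball[OF um] measurable_lborel_ball[OF hm]
  have Li: "integrable (lborel_ball r) ?L"
  proof (rule Bochner_Integration.integrable_bound[OF Ri])
    show "?L \<in> borel_measurable (lborel_ball r)" by measurable
    show "AE x in lborel_ball r. norm (?L x) \<le> norm (?R x)"
      using le by (intro AE_I2) (auto simp: space_restrict_space)
  qed
  have "integral\<^sup>L (lborel_ball r) ?L \<le> integral\<^sup>L (lborel_ball r) ?R"
    using le by (intro integral_mono[OF Li Ri]) (auto simp: space_restrict_space)
  also have "\<dots> = 3 * M\<^sup>2 * (LINT x|lborel_ball r. (w x - u x)\<^sup>2 + (norm (k x - h x))\<^sup>2)"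
    by simp
  also have "\<dots> \<le> 3 * M\<^sup>2 * (e / (3 * M\<^sup>2))"
    using w(3) M by (intro mult_left_mono) auto
  also have "\<dots> = e" using M by simp
  finally have "integral\<^sup>L (lborel_ball r) ?L \<le> e" .
  with C1 Li show "\<exists>w k. C1_on (ball 0 r) w k \<and>
     integrable (lborel_ball r) (\<lambda>x. (w x - (f x * u x + g x))\<^sup>2 + (norm (k x - (f x *\<^sub>R h x + u x *\<^sub>R F x + G x)))\<^sup>2) \<and>
     (LINT x|lborel_ball r. (w x - (f x * u x + g x))\<^sup>2 + (norm (k x - (f x *\<^sub>R h x + u x *\<^sub>R F x + G x)))\<^sup>2) \<le> e"
    by blast
qed

text \<open>\<open>Poincare_ball_C1\<close> for an approximating function; passing from its gradient
  to \<open>h\<close> and from it back to \<open>u\<close> costs a factor 2 each.\<close>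

lemma Poincare_ball:
  fixes u :: "'a::euclidean_space \<Rightarrow> real"
  assumes ga: "grad_approx r u h" and "r > 0" and "\<delta> > 0"
    and um: "u \<in> borel_measurable borel" and hm: "h \<in> borel_measurable borel"
    and h2: "integrable (lborel_ball r) (\<lambda>x. (norm (h x))\<^sup>2)"
  shows "\<exists>c. integrable (lborel_ball r) (\<lambda>x. (u x - c)\<^sup>2) \<and>
    (LINT x|lborel_ball r. (u x - c)\<^sup>2) \<le> 4 * ((2 * r)\<^sup>2 * 2 ^ DIM('a)) * (LINT x|lborel_ball r. (norm (h x))\<^sup>2) + \<delta>"
proof -
  define C where "C = (2 * r)\<^sup>2 * 2 ^ DIM('a)"
  have C: "C > 0" using \<open>r > 0\<close> by (simp add: C_def)
  \<comment> \<open>Chosen so that the errors 2 e + 2 (2 C e + e) add up to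
    \<open>\<delta>\<close>.\<close>
  define e where "e = \<delta> / (4 * C + 4)"
  have e: "e > 0" using C \<open>\<delta> > 0\<close> by (simp add: e_def)
  obtain w k where w: "C1_on (ball 0 r) w k"
     "integrable (lborel_ball r) (\<lambda>x. (w x - u x)\<^sup>2 + (norm (k x - h x))\<^sup>2)"
     "(LINT x|lborel_ball r. (w x - u x)\<^sup>2 + (norm (k x - h x))\<^sup>2) \<le> e"
    using ga[unfolded grad_approx_def, rule_format, OF e] by (elim exE conjE)
  have Wm: "w \<in> borel_measurable (lborel_ball r)" "k \<in> borel_measurable (lborel_ball r)"
    using w(1) C1_on_continuous by (auto simp: C1_on_def intro!: measurable_lborel_ball_continuous)
  note [measurable] = Wm measurable_lborel_ball[OF um] measurable_lborel_ball[OF hm]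
  let ?E = "\<lambda>x. (w x - u x)\<^sup>2 + (norm (k x - h x))\<^sup>2"
  have Rk: "integrable (lborel_ball r) (\<lambda>x. 2 * ?E x + 2 * (norm (h x))\<^sup>2)"
    by (rule Bochner_Integration.integrable_add[OF integrable_mult_right[OF w(2)] integrable_mult_right[OF h2]])
  have kle: "(norm (k x))\<^sup>2 \<le> 2 * ?E x + 2 * (norm (h x))\<^sup>2" for x
    by (rule order_trans[OF norm_add_square_le[of "k x - h x" "h x", unfolded diff_add_cancel]]) simp
  have k2: "integrable (lborel_ball r) (\<lambda>x. (norm (k x))\<^sup>2)"
    by (rule Bochner_Integration.integrable_bound[OF Rk], measurable, rule AE_I2)
       (simp only: real_norm_def abs_power2 order_trans[OF kle abs_ge_self])
  have "(LINT x|lborel_ball r. (norm (k x))\<^sup>2) \<le> (LINT x|lborel_ball r. 2 * ?E x + 2 * (norm (h x))\<^sup>2)"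
    by (intro integral_mono k2 Rk kle)
  also have "\<dots> = 2 * (LINT x|lborel_ball r. ?E x) + 2 * (LINT x|lborel_ball r. (norm (h x))\<^sup>2)"
    by (simp only: Bochner_Integration.integral_add[OF integrable_mult_right[OF w(2)] integrable_mult_right[OF h2]]
        integral_mult_right_zero)
  finally have kI: "(LINT x|lborel_ball r. (norm (k x))\<^sup>2) \<le> 2 * e + 2 * (LINT x|lborel_ball r. (norm (h x))\<^sup>2)"
    using w(3) by linarith
  obtain c where c: "integrable (lborel_ball r) (\<lambda>x. (w x - c)\<^sup>2)"
    "(LINT x|lborel_ball r. (w x - c)\<^sup>2) \<le> C * (LINT x|lborel_ball r. (norm (k x))\<^sup>2) + e"
    using Poincare_ball_C1[OF w(1) k2 e \<open>r > 0\<close>] unfolding C_def by blast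
  have Rc: "integrable (lborel_ball r) (\<lambda>x. 2 * ?E x + 2 * (w x - c)\<^sup>2)"
    by (rule Bochner_Integration.integrable_add[OF integrable_mult_right[OF w(2)] integrable_mult_right[OF c(1)]])
  have cle: "(u x - c)\<^sup>2 \<le> 2 * ?E x + 2 * (w x - c)\<^sup>2" for x
  proof -
    have "(u x - c)\<^sup>2 \<le> 2 * (w x - u x)\<^sup>2 + 2 * (w x - c)\<^sup>2"
      using norm_add_square_le[of "u x - w x" "w x - c"] power2_commute[of "u x" "w x"] by simp
    then show ?thesis by (rule order_trans) simp
  qed
  have ci: "integrable (lborel_ball r) (\<lambda>x. (u x - c)\<^sup>2)"
    by (rule Bochner_Integration.integrable_bound[OF Rc], measurable, rule AE_I2)
       (simp only: real_norm_def abs_power2 order_trans[OF cle abs_ge_self])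
  have "(LINT x|lborel_ball r. (u x - c)\<^sup>2) \<le> (LINT x|lborel_ball r. 2 * ?E x + 2 * (w x - c)\<^sup>2)"
    by (intro integral_mono ci Rc cle)
  also have "\<dots> = 2 * (LINT x|lborel_ball r. ?E x) + 2 * (LINT x|lborel_ball r. (w x - c)\<^sup>2)"
    by (simp only: Bochner_Integration.integral_add[OF integrable_mult_right[OF w(2)] integrable_mult_right[OF c(1)]]
        integral_mult_right_zero)
  also have "\<dots> \<le> 2 * e + 2 * (C * (2 * e + 2 * (LINT x|lborel_ball r. (norm (h x))\<^sup>2)) + e)"
  proof -
    have "2 * x + 2 * y \<le> 2 * e + 2 * (z' + e)" if "x \<le> e" "y \<le> z + e" "z \<le> z'" for x y z z' :: real
      using that by argo
    from this[OF w(3) c(2) mult_left_mono[OF kI less_imp_le[OF C]]] show ?thesis .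
  qed
  also have "\<dots> = 4 * C * (LINT x|lborel_ball r. (norm (h x))\<^sup>2) + e * (4 * C + 4)"
    by (simp add: algebra_simps)
  also have "e * (4 * C + 4) = \<delta>"
    using C by (simp add: e_def)
  finally show ?thesis using ci unfolding C_def by blast
qed

section \<open>Integration by parts against a compactly supported radial field\<close>

lemma eq_zero_of_le_small_multiple:
  fixes I C :: real
  assumes "\<And>t. 0 < t \<Longrightarrow> t < 1 \<Longrightarrow> \<bar>I\<bar> \<le> t * C"
  shows "I = 0"
proof -
  have "((\<lambda>t. t * C) \<longlongrightarrow> 0 * C) (at_right 0)"
    by (intro tendsto_intros)
  moreover have "\<forall>\<^sub>F t in at_right 0. \<bar>I\<bar> \<le> t * C"
    using assms by (auto simp: eventually_at_right_field intro: exI[of _ 1])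
  ultimately have "\<bar>I\<bar> \<le> 0 * C"
    by (intro tendsto_lowerbound[of _ _ "at_right 0"]) auto
  then show ?thesis by simp
qed

text \<open>Each product of an error with \<open>u\<close> or \<open>h\<close> is split by Young's
  inequality, with weight t on the fixed functions and 1 / t on the errors. Squared errors of order
  t^2 then leave a bound of order t.\<close>

lemma product_diff_le:
  fixes u w t :: real and h k :: "'a::real_inner"
  assumes t: "0 < t"
  shows "\<bar>u\<^sup>2 - w\<^sup>2\<bar> + 2 * norm (u *\<^sub>R h - w *\<^sub>R k)
    \<le> 2 * t * (u\<^sup>2 + (norm h)\<^sup>2) + (2 / t + 2) * ((w - u)\<^sup>2 + (norm (k - h))\<^sup>2)"
proof -
  define a where "a = \<bar>w - u\<bar>"
  define b where "b = norm (k - h)"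
  define U where "U = \<bar>u\<bar>"
  define H where "H = norm h"
  define q where "q = 1 / t"
  have q: "q > 0" using t by (simp add: q_def)
  have am: "2 * (x * y) \<le> t * x\<^sup>2 + q * y\<^sup>2" for x y :: real
  proof -
    have "0 \<le> (t * x - y)\<^sup>2 / t" using t by simp
    also have "\<dots> = t * x\<^sup>2 + y\<^sup>2 / t - 2 * (x * y)"
      using t by (simp add: power2_eq_square field_simps)
    finally show ?thesis by (simp add: q_def)
  qed
  have "u\<^sup>2 - w\<^sup>2 = - (w - u) * (2 * u + (w - u))" by (simp add: power2_eq_square algebra_simps)
  then have "\<bar>u\<^sup>2 - w\<^sup>2\<bar> = a * \<bar>2 * u + (w - u)\<bar>" by (simp add: abs_mult a_def abs_minus_commute)
  also have "\<dots> \<le> a * (2 * U + a)" by (intro mult_left_mono) (auto simp: a_def U_def)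
  finally have 1: "\<bar>u\<^sup>2 - w\<^sup>2\<bar> \<le> 2 * (U * a) + a\<^sup>2" by (simp add: power2_eq_square algebra_simps)
  have "u *\<^sub>R h - w *\<^sub>R k = - ((w - u) *\<^sub>R h + u *\<^sub>R (k - h) + (w - u) *\<^sub>R (k - h))"
    by (simp add: algebra_simps)
  then have "norm (u *\<^sub>R h - w *\<^sub>R k) \<le> norm ((w - u) *\<^sub>R h) + norm (u *\<^sub>R (k - h)) + norm ((w - u) *\<^sub>R (k - h))"
    by (simp only: norm_minus_cancel) (intro order_trans[OF norm_triangle_ineq] add_mono order_refl norm_triangle_ineq)
  then have 2: "norm (u *\<^sub>R h - w *\<^sub>R k) \<le> H * a + U * b + a * b"
    by (simp add: a_def b_def U_def H_def mult.commute)
  have 3: "2 * (a * b) \<le> a\<^sup>2 + b\<^sup>2" using sum_squares_bound[of a b] by simp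
  have "\<bar>u\<^sup>2 - w\<^sup>2\<bar> + 2 * norm (u *\<^sub>R h - w *\<^sub>R k)
    \<le> 2 * t * (U\<^sup>2 + H\<^sup>2) + (2 * q + 2) * (a\<^sup>2 + b\<^sup>2)"
  proof -
    have "0 \<le> q * b\<^sup>2" "0 \<le> t * H\<^sup>2" "0 \<le> b\<^sup>2"
      using t q by auto
    moreover have "2 * t * (U\<^sup>2 + H\<^sup>2) + (2 * q + 2) * (a\<^sup>2 + b\<^sup>2)
      = 2 * (t * U\<^sup>2) + 2 * (t * H\<^sup>2) + 2 * (q * a\<^sup>2) + 2 * (q * b\<^sup>2) + 2 * a\<^sup>2 + 2 * b\<^sup>2"
      by (simp add: algebra_simps)
    ultimately show ?thesis
      using 1 2 3 am[of U a] am[of H a] am[of U b] by linarith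
  qed
  then show ?thesis by (simp add: a_def b_def U_def H_def q_def)
qed

text \<open>Formally the integrand is the divergence of u^2 \<sigma>(x) x. For C^1 functions this is
  exact and the integral vanishes by compact support; \<open>u\<close> is approximated on a ball
  that extends beyond the support of \<open>\<sigma>\<close>.\<close>

lemma integration_by_parts_radial:
  fixes u \<sigma> :: "'a::euclidean_space \<Rightarrow> real"
  assumes ga: "\<And>r. r < 1 \<Longrightarrow> grad_approx r u h"
    and um: "u \<in> borel_measurable borel" and hm: "h \<in> borel_measurable borel"
    and u2: "integrable (lborel_ball 1) (\<lambda>x. (u x)\<^sup>2)" and h2: "integrable (lborel_ball 1) (\<lambda>x. (norm (h x))\<^sup>2)"
    and \<sigma>: "C1_on (ball 0 1) \<sigma> S" and supp: "\<And>x. norm x > b \<Longrightarrow> \<sigma> x = 0 \<and> S x = 0" and b: "b < 1"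
  shows "(LINT x|lborel_ball 1. (u x)\<^sup>2 * (DIM('a) * \<sigma> x + S x \<bullet> x) + 2 * u x * \<sigma> x * (h x \<bullet> x)) = 0"
proof -
  \<comment> \<open>A positive radius strictly between \<open>b\<close> and 1; \<open>b\<close>
    itself may be negative.\<close>
  define r where "r = (max b 0 + 1) / 2"
  have r: "b < r" "r < 1" "0 < r"
    using b by (auto simp: r_def)
  have \<sigma>c: "continuous_on (ball 0 1) \<sigma>" "continuous_on (ball 0 1) S"
    using \<sigma> C1_on_continuous by (auto simp: C1_on_def)
  have sub: "cball (0::'a) r \<subseteq> ball 0 1" using \<open>r < 1\<close> by auto
  have "bounded (\<sigma> ` cball 0 r)" "bounded (S ` cball 0 r)"
    by (intro compact_imp_bounded compact_continuous_image continuous_on_subset[OF _ sub] \<sigma>c compact_cball)+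
  then obtain a s where ab: "\<forall>x\<in>cball 0 r. norm (\<sigma> x) \<le> a" "\<forall>x\<in>cball 0 r. norm (S x) \<le> s"
    by (auto simp: bounded_iff)
  define d where "d x = DIM('a) * \<sigma> x + S x \<bullet> x" for x
  define M where "M = DIM('a) * \<bar>a\<bar> + \<bar>s\<bar>"
  have M0: "M \<ge> 0" by (simp add: M_def)
  have dM: "\<bar>d x\<bar> \<le> M" and \<sigma>M: "\<bar>\<sigma> x\<bar> * norm x \<le> M" for x
  proof -
    have "\<bar>\<sigma> x\<bar> \<le> \<bar>a\<bar> \<and> norm (S x) \<le> \<bar>s\<bar> \<and> norm x \<le> 1 \<or> \<sigma> x = 0 \<and> S x = 0"
    proof (cases "norm x \<le> r")
      case True
      then have "norm (\<sigma> x) \<le> a" "norm (S x) \<le> s" using ab by auto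
      then show ?thesis using True r by auto
    next
      case False
      then show ?thesis using supp[of x] r by auto
    qed
    then consider "\<sigma> x = 0" "S x = 0" | "\<bar>\<sigma> x\<bar> \<le> \<bar>a\<bar>" "norm (S x) \<le> \<bar>s\<bar>" "norm x \<le> 1" by blast
    then have "\<bar>d x\<bar> \<le> M \<and> \<bar>\<sigma> x\<bar> * norm x \<le> M"
    proof cases
      case 1
      then show ?thesis using M0 by (simp add: d_def)
    next
      case 2
      have "\<bar>S x \<bullet> x\<bar> \<le> \<bar>s\<bar> * 1"
        using order_trans[OF Cauchy_Schwarz_ineq2 mult_mono[OF 2(2,3)]] by simp
      moreover have "\<bar>DIM('a) * \<sigma> x\<bar> \<le> DIM('a) * \<bar>a\<bar>"
        using 2(1) by (simp add: abs_mult mult_left_mono)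
      moreover have "\<bar>\<sigma> x\<bar> * norm x \<le> \<bar>a\<bar> * 1"
        using 2 by (intro mult_mono) auto
      moreover have "\<bar>a\<bar> * 1 \<le> DIM('a) * \<bar>a\<bar>"
        using DIM_positive[where 'a='a] mult_right_mono[of 1 "real DIM('a)" "\<bar>a\<bar>"] by simp
      ultimately show ?thesis unfolding d_def M_def by linarith
    qed
    then show "\<bar>d x\<bar> \<le> M" "\<bar>\<sigma> x\<bar> * norm x \<le> M" by auto
  qed
  define P where "P w k x = (w x)\<^sup>2 * d x + 2 * w x * \<sigma> x * (k x \<bullet> x)" for w :: "'a \<Rightarrow> real" and k x
  have smooth: "integrable lborel (P w k) \<and> (LINT x|lborel. P w k x) = 0" if wk: "C1_on (ball 0 r) w k" for w k
  proof -
    \<comment> \<open>The gradient of w^2 \<sigma> (x \<bullet> i), in the shape produced by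
      \<open>C1_on_mult\<close>; its i-th components add up to the divergence
      \<open>P w k\<close>.\<close>
    define G where "G i x = (w x * w x) *\<^sub>R (\<sigma> x *\<^sub>R i + (x \<bullet> i) *\<^sub>R S x)
        + (\<sigma> x * (x \<bullet> i)) *\<^sub>R (w x *\<^sub>R k x + w x *\<^sub>R k x)" for i x
    have \<sigma>r: "C1_on (ball 0 r) \<sigma> S" using \<sigma> r by (auto intro: C1_on_subset)
    have F: "C1_on UNIV (\<lambda>x. w x * w x * (\<sigma> x * (x \<bullet> i))) (G i)" for i
      using C1_on_mult[OF C1_on_mult[OF wk wk] C1_on_mult[OF \<sigma>r C1_on_inner[of _ i]]]
      by (intro C1_on_extend_zero[of r _ _ b] r) (auto simp: G_def[abs_def] supp)
    have G0: "G i x = 0" if "norm x > b" for i x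
      using supp[OF that] by (simp add: G_def)
    have Gi: "integrable lborel (\<lambda>x. G i x \<bullet> i)" for i
      using F[of i] G0 by (intro integrable_compact_support[of _ b]) (auto simp: C1_on_def intro!: continuous_intros)
    have P: "P w k x = (\<Sum>i\<in>Basis. G i x \<bullet> i)" for x
    proof -
      have "(\<Sum>i\<in>Basis. G i x \<bullet> i) = (\<Sum>i\<in>Basis. (w x)\<^sup>2 * \<sigma> x + (w x)\<^sup>2 * ((S x \<bullet> i) * (x \<bullet> i))
          + 2 * w x * \<sigma> x * ((k x \<bullet> i) * (x \<bullet> i)))"
        by (intro sum.cong) (auto simp: G_def inner_add_left algebra_simps power2_eq_square)
      also have "\<dots> = DIM('a) * ((w x)\<^sup>2 * \<sigma> x) + (w x)\<^sup>2 * (S x \<bullet> x) + 2 * w x * \<sigma> x * (k x \<bullet> x)"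
        unfolding euclidean_inner[of "S x" x] euclidean_inner[of "k x" x]
        by (simp only: sum.distrib sum_distrib_left sum_constant)
      also have "\<dots> = P w k x"
        by (simp add: P_def d_def algebra_simps)
      finally show ?thesis by simp
    qed
    have "(LINT x|lborel. G i x \<bullet> i) = 0" for i
      by (rule integral_derivative_compact_support[OF F, of b]) (auto simp: supp G0)
    then show ?thesis
      unfolding P[abs_def] using Gi by (simp add: Bochner_Integration.integral_sum)
  qed
  have idm: "(\<lambda>x::'a. x) \<in> borel_measurable (lborel_ball 1)"
    by (rule measurable_lborel_ball) simp
  note [measurable] = idm measurable_lborel_ball[OF um] measurable_lborel_ball[OF hm]
    measurable_lborel_ball_continuous[OF \<sigma>c(1)] measurable_lborel_ball_continuous[OF \<sigma>c(2)]
  have uh2: "integrable (lborel_ball 1) (\<lambda>x. M * (2 * (u x)\<^sup>2 + (norm (h x))\<^sup>2))"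
    using u2 h2 by simp
  have Pdiff: "\<bar>P u h x - P w k x\<bar> \<le> M * (\<bar>(u x)\<^sup>2 - (w x)\<^sup>2\<bar> + 2 * norm (u x *\<^sub>R h x - w x *\<^sub>R k x))" for w k x
  proof -
    have "P u h x - P w k x = ((u x)\<^sup>2 - (w x)\<^sup>2) * d x + 2 * \<sigma> x * ((u x *\<^sub>R h x - w x *\<^sub>R k x) \<bullet> x)"
      by (simp add: P_def algebra_simps)
    also have "\<bar>\<dots>\<bar> \<le> \<bar>(u x)\<^sup>2 - (w x)\<^sup>2\<bar> * \<bar>d x\<bar> + 2 * (\<bar>\<sigma> x\<bar> * \<bar>(u x *\<^sub>R h x - w x *\<^sub>R k x) \<bullet> x\<bar>)"
      by (rule order_trans[OF abs_triangle_ineq]) (simp add: abs_mult)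
    also have "\<dots> \<le> \<bar>(u x)\<^sup>2 - (w x)\<^sup>2\<bar> * M + 2 * (\<bar>\<sigma> x\<bar> * (norm (u x *\<^sub>R h x - w x *\<^sub>R k x) * norm x))"
      by (intro add_mono mult_left_mono dM Cauchy_Schwarz_ineq2) auto
    also have "\<dots> = \<bar>(u x)\<^sup>2 - (w x)\<^sup>2\<bar> * M + 2 * norm (u x *\<^sub>R h x - w x *\<^sub>R k x) * (\<bar>\<sigma> x\<bar> * norm x)"
      by simp
    also have "\<dots> \<le> \<bar>(u x)\<^sup>2 - (w x)\<^sup>2\<bar> * M + 2 * norm (u x *\<^sub>R h x - w x *\<^sub>R k x) * M"
      by (intro add_mono mult_left_mono \<sigma>M) auto
    finally show ?thesis by (simp add: algebra_simps)
  qed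
  have Pm: "P u h \<in> borel_measurable (lborel_ball 1)"
    unfolding P_def[abs_def] d_def by measurable
  have Pi: "integrable (lborel_ball 1) (P u h)"
  proof (rule Bochner_Integration.integrable_bound[OF uh2 Pm], rule AE_I2)
    fix x
    have "\<bar>P u h x\<bar> \<le> M * ((u x)\<^sup>2 + 2 * (\<bar>u x\<bar> * norm (h x)))"
      using Pdiff[of x "\<lambda>x. 0" "\<lambda>x. 0"] by (simp add: P_def)
    also have "\<dots> \<le> M * (2 * (u x)\<^sup>2 + (norm (h x))\<^sup>2)"
      using sum_squares_bound[of "\<bar>u x\<bar>" "norm (h x)"] M0 by (intro mult_left_mono) auto
    finally show "norm (P u h x) \<le> norm (M * (2 * (u x)\<^sup>2 + (norm (h x))\<^sup>2))" by simp
  qed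
  define V where "V = (LINT x|lborel_ball 1. (u x)\<^sup>2 + (norm (h x))\<^sup>2)"
  have "(LINT x|lborel_ball 1. P u h x) = 0"
  proof (rule eq_zero_of_le_small_multiple[where C="M * (2 * V + 4)"])
    fix t :: real assume t: "0 < t" "t < 1"
    \<comment> \<open>Accuracy t^2 absorbs the factor 2 / t + 2 of \<open>product_diff_le\<close>:
      for t < 1 the product is at most 4 t.\<close>
    obtain w k where w: "C1_on (ball 0 r) w k"
     "integrable (lborel_ball r) (\<lambda>x. (w x - u x)\<^sup>2 + (norm (k x - h x))\<^sup>2)"
     "(LINT x|lborel_ball r. (w x - u x)\<^sup>2 + (norm (k x - h x))\<^sup>2) \<le> t\<^sup>2"
    proof -
      have "t\<^sup>2 > 0" using t by simp
      from ga[OF r(2), unfolded grad_approx_def, rule_format, OF this] that show thesis by (elim exE conjE)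
    qed
    define E where "E x = indicat_real (ball 0 r) x * ((w x - u x)\<^sup>2 + (norm (k x - h x))\<^sup>2)" for x
    have Ei': "integrable lborel E" and EI': "(LINT x|lborel. E x) \<le> t\<^sup>2"
      using w(2,3) by (simp_all add: integrable_restrict_space integral_restrict_space E_def[abs_def])
    have E0: "0 \<le> E x" for x by (simp add: E_def)
    have Ei: "integrable (lborel_ball 1) E" and EI: "(LINT x|lborel_ball 1. E x) \<le> t\<^sup>2"
      using integrable_lborel_ball[OF Ei'] integral_lborel_ball_mono[OF Ei' E0, of 1] EI' by auto
    have Pw: "integrable (lborel_ball 1) (P w k)" using smooth[OF w(1)] integrable_lborel_ball by blast
    have Pw0: "P w k x = 0" if "norm x > b" for w k x
      using supp[OF that] by (simp add: P_def d_def)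
    have "(LINT x|lborel_ball 1. P w k x) = (LINT x|lborel. indicat_real (ball 0 1) x *\<^sub>R P w k x)"
      by (rule integral_restrict_space) simp
    also have "\<dots> = (LINT x|lborel. P w k x)"
      using Pw0[of _ w k] b by (intro Bochner_Integration.integral_cong) (auto simp: indicator_def)
    finally have PwI: "(LINT x|lborel_ball 1. P w k x) = 0" using smooth[OF w(1)] by simp
    let ?R = "\<lambda>x. M * (2 * t * ((u x)\<^sup>2 + (norm (h x))\<^sup>2) + (2 / t + 2) * E x)"
    have Ri: "integrable (lborel_ball 1) ?R" using u2 h2 Ei by simp
    have le: "\<bar>P u h x - P w k x\<bar> \<le> ?R x" for x
    proof (cases "norm x < r")
      case True
      have "\<bar>P u h x - P w k x\<bar> \<le> M * (\<bar>(u x)\<^sup>2 - (w x)\<^sup>2\<bar> + 2 * norm (u x *\<^sub>R h x - w x *\<^sub>R k x))"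
        by (rule Pdiff)
      also have "\<dots> \<le> ?R x"
        using product_diff_le[OF t(1), of "u x" "w x" "h x" "k x"] M0 True
        by (intro mult_left_mono) (auto simp: E_def)
      finally show ?thesis .
    next
      case False
      then have "P u h x = 0" "P w k x = 0" using Pw0 r by auto
      then show ?thesis using M0 t E0[of x] by simp
    qed
    have "\<bar>LINT x|lborel_ball 1. P u h x\<bar> = \<bar>LINT x|lborel_ball 1. P u h x - P w k x\<bar>"
      using Pi Pw PwI by simp
    also have "\<dots> \<le> (LINT x|lborel_ball 1. ?R x)"
      using Pi Pw le by (intro order_trans[OF integral_abs_bound integral_mono[OF _ Ri]]) auto
    also have "\<dots> = M * (2 * t * V + (2 / t + 2) * (LINT x|lborel_ball 1. E x))"
      using u2 h2 Ei by (simp add: V_def)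
    also have "\<dots> \<le> M * (2 * t * V + (2 / t + 2) * t\<^sup>2)"
      using M0 t EI by (intro mult_left_mono add_mono) auto
    also have "\<dots> = M * (2 * t * V + 2 * t + 2 * t\<^sup>2)"
      using t by (simp add: power2_eq_square field_simps)
    also have "\<dots> \<le> M * (2 * t * V + 2 * t + 2 * t)"
      using M0 t by (intro mult_left_mono add_mono) (auto simp: power2_eq_square mult_left_le)
    finally show "\<bar>LINT x|lborel_ball 1. P u h x\<bar> \<le> t * (M * (2 * V + 4))"
      by (simp add: algebra_simps)
  qed
  then show ?thesis by (simp add: P_def d_def)
qed

section \<open>Radial functions on the ball model\<close>

text \<open>Radial calculus runs over -1 < s < 1, so that derivatives at the centre are two-sided;
  for negative s this is the odd extension of the distance.\<close>

definition rad_dist :: "real \<Rightarrow> real" where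
  "rad_dist s = ln ((1 + s) / (1 - s))"

definition conf :: "'a::euclidean_space \<Rightarrow> real" where
  "conf x = 2 / (1 - (norm x)\<^sup>2)"

lemma hyp_dist0_eq: "hyp_dist0 x = rad_dist (norm x)"
  by (simp add: hyp_dist0_def rad_dist_def)

lemma one_minus_square_pos: "\<bar>s\<bar> < 1 \<Longrightarrow> 0 < 1 - s\<^sup>2" for s :: real
  by (simp add: abs_square_less_1)

lemma rad_dist_deriv:
  assumes "\<bar>s\<bar> < 1"
  shows "(rad_dist has_real_derivative 2 / (1 - s\<^sup>2)) (at s)"
proof -
  have s: "1 + s > 0" "1 - s > 0" using assms by auto
  have "((\<lambda>s. ln (1 + s) - ln (1 - s)) has_real_derivative (1 / (1 + s) + 1 / (1 - s))) (at s)"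
    using s by (auto intro!: derivative_eq_intros)
  moreover have "1 / (1 + s) + 1 / (1 - s) = 2 / (1 - s\<^sup>2)"
    using s by (simp add: add_frac_eq power2_eq_square algebra_simps)
  ultimately have "((\<lambda>s. ln (1 + s) - ln (1 - s)) has_real_derivative 2 / (1 - s\<^sup>2)) (at s)" by simp
  then show ?thesis
    by (rule has_field_derivative_transform_within_open[of _ _ _ "{-1<..<1}"])
       (use assms in \<open>auto simp: rad_dist_def ln_div\<close>)
qed

lemma exp_rad_dist: "\<bar>s\<bar> < 1 \<Longrightarrow> exp (rad_dist s) = (1 + s) / (1 - s)"
  unfolding rad_dist_def by (subst exp_ln) (auto simp: abs_less_iff)

lemma cosh_rad_dist: "\<bar>s\<bar> < 1 \<Longrightarrow> cosh (rad_dist s) = (1 + s\<^sup>2) / (1 - s\<^sup>2)"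
proof -
  assume s: "\<bar>s\<bar> < 1"
  then have "1 + s \<noteq> 0" "1 - s \<noteq> 0" "1 - s\<^sup>2 = (1 + s) * (1 - s)"
    by (auto simp: power2_eq_square algebra_simps)
  then show ?thesis
    using exp_rad_dist[OF s]
    by (simp add: cosh_field_def exp_minus) (simp add: divide_simps, simp add: power2_eq_square algebra_simps)
qed

lemma sinh_rad_dist: "\<bar>s\<bar> < 1 \<Longrightarrow> sinh (rad_dist s) = 2 * s / (1 - s\<^sup>2)"
proof -
  assume s: "\<bar>s\<bar> < 1"
  then have "1 + s \<noteq> 0" "1 - s \<noteq> 0" "1 - s\<^sup>2 = (1 + s) * (1 - s)"
    by (auto simp: power2_eq_square algebra_simps)
  then show ?thesis
    using exp_rad_dist[OF s]
    by (simp add: sinh_field_def exp_minus) (simp add: divide_simps, simp add: power2_eq_square algebra_simps)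
qed

lemma rad_dist_ge: "0 \<le> s \<Longrightarrow> s < 1 \<Longrightarrow> s \<le> rad_dist s"
proof -
  assume s: "0 \<le> s" "s < 1"
  have "ln ((1 - s) / (1 + s)) \<le> (1 - s) / (1 + s) - 1"
    using s by (intro ln_le_minus_one) auto
  also have "\<dots> = - (2 * s / (1 + s))" using s by (simp add: field_simps)
  also have "ln ((1 - s) / (1 + s)) = - rad_dist s"
    using s by (simp add: rad_dist_def ln_div)
  finally have "2 * s / (1 + s) \<le> rad_dist s" by simp
  moreover have "s \<le> 2 * s / (1 + s)"
    using s by (simp add: field_simps mult_left_le)
  ultimately show ?thesis by simp
qed

lemma rad_dist_nonpos: "-1 < s \<Longrightarrow> s \<le> 0 \<Longrightarrow> rad_dist s \<le> 0"
  unfolding rad_dist_def by (intro ln_le_zero_iff[THEN iffD2] divide_pos_pos) (auto simp: divide_simps)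

lemma rad_dist_le: "0 \<le> s \<Longrightarrow> s < 1 \<Longrightarrow> rad_dist s \<le> 2 * s / (1 - s)"
proof -
  assume s: "0 \<le> s" "s < 1"
  have "rad_dist s \<le> (1 + s) / (1 - s) - 1"
    unfolding rad_dist_def using s by (intro ln_le_minus_one) auto
  also have "\<dots> = 2 * s / (1 - s)" using s by (simp add: field_simps)
  finally show ?thesis .
qed

text \<open>The left-hand side is \<rho> coth \<rho>. As (1 + s^2) / (2 s) = 1 + (1 - s)^2 / (2 s),
  its excess over \<rho> is controlled by \<open>rad_dist_le\<close>. This is the source of the
  linear growth of the weight.\<close>

lemma rad_dist_coth_le:
  assumes s: "0 < s" "s < 1"
  shows "rad_dist s * ((1 + s\<^sup>2) / (2 * s)) \<le> 1 + rad_dist s"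
proof -
  have "rad_dist s * (1 - s)\<^sup>2 \<le> 2 * s / (1 - s) * (1 - s)\<^sup>2"
    using rad_dist_le[of s] s by (intro mult_right_mono) auto
  also have "\<dots> = 2 * s * (1 - s)" using s by (simp add: power2_eq_square)
  also have "\<dots> \<le> 2 * s" using s by simp
  finally have "rad_dist s * (1 - s)\<^sup>2 / (2 * s) \<le> 1" using s by simp
  moreover have "rad_dist s * ((1 + s\<^sup>2) / (2 * s)) = rad_dist s + rad_dist s * (1 - s)\<^sup>2 / (2 * s)"
    using s by (simp add: field_simps power2_eq_square)
  ultimately show ?thesis by simp
qed

text \<open>At Euclidean radius s the quotient (1 + s^2) / (2 s) equals coth \<rho>, so the weight
  is 1 + (N - 1) \<rho> coth \<rho>, the hyperbolic Laplacian of \<rho>^2 / 2.\<close>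

lemma hyp_weight_eq:
  fixes x :: "'a::euclidean_space"
  assumes "x \<noteq> 0" "norm x < 1"
  shows "hyp_weight x = 1 + (real DIM('a) - 1) * (hyp_dist0 x * ((1 + (norm x)\<^sup>2) / (2 * norm x)))"
proof -
  define s where "s = norm x"
  have s: "0 < s" "s < 1" using assms by (auto simp: s_def)
  have p: "1 - s\<^sup>2 > 0" using one_minus_square_pos[of s] s by simp
  have c: "cosh (rad_dist s) = (1 + s\<^sup>2) / (1 - s\<^sup>2)" "sinh (rad_dist s) = 2 * s / (1 - s\<^sup>2)"
    using cosh_rad_dist[of s] sinh_rad_dist[of s] s by auto
  have ne: "sinh (rad_dist s) \<noteq> 0" using s p unfolding c by simp
  have "(rad_dist s * cosh (rad_dist s) - sinh (rad_dist s)) / sinh (rad_dist s)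
    = rad_dist s * (cosh (rad_dist s) / sinh (rad_dist s)) - 1"
    using ne by (simp add: diff_divide_distrib)
  also have "cosh (rad_dist s) / sinh (rad_dist s) = (1 + s\<^sup>2) / (2 * s)"
    unfolding c using p s by simp
  finally have eq: "(rad_dist s * cosh (rad_dist s) - sinh (rad_dist s)) / sinh (rad_dist s)
    = rad_dist s * ((1 + s\<^sup>2) / (2 * s)) - 1" .
  have "N + (N - 1) * (X - 1) = 1 + (N - 1) * X" for N X :: real
    by (simp add: algebra_simps)
  then show ?thesis
    unfolding hyp_weight_def hyp_dist0_eq s_def[symmetric] eq .
qed

lemma hyp_weight_bounds:
  fixes x :: "'a::euclidean_space"
  assumes "norm x < 1"
  shows "1 \<le> hyp_weight x" "hyp_weight x \<le> DIM('a) + (real DIM('a) - 1) * hyp_dist0 x"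
proof -
  have N: "real DIM('a) \<ge> 1" using DIM_positive[where 'a='a] by linarith
  have r: "hyp_dist0 x \<ge> 0"
    using rad_dist_ge[of "norm x"] assms norm_ge_zero[of x] unfolding hyp_dist0_eq by linarith
  have *: "1 \<le> hyp_weight x \<and> hyp_weight x \<le> DIM('a) + (real DIM('a) - 1) * hyp_dist0 x"
  proof (cases "x = 0")
    case True
    then show ?thesis using N by (simp add: hyp_weight_def hyp_dist0_def)
  next
    case False
    have "hyp_dist0 x * ((1 + (norm x)\<^sup>2) / (2 * norm x)) \<le> 1 + hyp_dist0 x"
      using rad_dist_coth_le[of "norm x"] False assms by (simp add: hyp_dist0_eq)
    then have "(real DIM('a) - 1) * (hyp_dist0 x * ((1 + (norm x)\<^sup>2) / (2 * norm x))) \<le> (real DIM('a) - 1) * (1 + hyp_dist0 x)"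
      using N by (intro mult_left_mono) auto
    moreover have "0 \<le> (real DIM('a) - 1) * (hyp_dist0 x * ((1 + (norm x)\<^sup>2) / (2 * norm x)))"
      using N r by (intro mult_nonneg_nonneg) auto
    ultimately show ?thesis
      unfolding hyp_weight_eq[OF False assms] by (simp add: algebra_simps)
  qed
  then show "1 \<le> hyp_weight x" "hyp_weight x \<le> DIM('a) + (real DIM('a) - 1) * hyp_dist0 x" by auto
qed

section \<open>Truncation of the radial vector field\<close>

lemma max_0_square_deriv: "((\<lambda>y. (max 0 y)\<^sup>2) has_real_derivative 2 * max 0 y) (at (y::real))"
proof -
  consider "y > 0" | "y < 0" | "y = 0" by linarith
  then show ?thesis
  proof cases
    case 1
    have "((\<lambda>y. y\<^sup>2) has_real_derivative 2 * max 0 y) (at y)"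
      using 1 by (auto intro!: derivative_eq_intros)
    then show ?thesis
      by (rule has_field_derivative_transform_within_open[of _ _ _ "{0<..}"]) (use 1 in auto)
  next
    case 2
    have "((\<lambda>y. 0) has_real_derivative 2 * max 0 y) (at y)" using 2 by simp
    then show ?thesis
      by (rule has_field_derivative_transform_within_open[of _ _ _ "{..<0}"]) (use 2 in auto)
  next
    case 3
    have "((\<lambda>h::real. (max 0 h)\<^sup>2 / h) \<longlongrightarrow> 0) (at 0)"
    proof (rule Lim_null_comparison[OF always_eventually], rule allI)
      fix h :: real
      show "norm ((max 0 h)\<^sup>2 / h) \<le> \<bar>h\<bar>"
        by (cases "h > 0") (auto simp: power2_eq_square max_def)
      show "((\<lambda>h::real. \<bar>h\<bar>) \<longlongrightarrow> 0) (at 0)" by (auto intro!: tendsto_eq_intros)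
    qed
    then show ?thesis using 3 by (simp add: DERIV_def)
  qed
qed

text \<open>
  \<open>cutoff a y\<close> equals \<open>y\<close> times a factor that vanishes for \<open>y \<le> 1 / a\<close> and \<open>y \<ge> a\<close>.  Cutting off near
  the origin avoids the regularity question for \<open>\<rho> x / |x|\<close> there and costs nothing in the limit,
  because the derivative of \<open>cutoff a\<close> stays bounded.
\<close>

definition cutoff :: "real \<Rightarrow> real \<Rightarrow> real" where
  "cutoff a y = (max 0 (y - 1 / a))\<^sup>2 * (max 0 (1 - y / a))\<^sup>2 / y"

definition cutoff' :: "real \<Rightarrow> real \<Rightarrow> real" where
  "cutoff' a y = 2 * max 0 (y - 1 / a) * (max 0 (1 - y / a))\<^sup>2 / y
     - 2 / a * (max 0 (y - 1 / a))\<^sup>2 * max 0 (1 - y / a) / y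
     - (max 0 (y - 1 / a))\<^sup>2 * (max 0 (1 - y / a))\<^sup>2 / y\<^sup>2"

lemma cutoff_deriv:
  assumes "y > 0"
  shows "(cutoff a has_real_derivative cutoff' a y) (at y)"
proof -
  have 1: "((\<lambda>y. (max 0 (y - 1 / a))\<^sup>2) has_real_derivative 2 * max 0 (y - 1 / a)) (at y)"
  proof -
    have "((\<lambda>y. y - 1 / a) has_real_derivative 1) (at y)"
      by (auto intro!: derivative_eq_intros)
    from DERIV_chain2[OF max_0_square_deriv this] show ?thesis by simp
  qed
  have 2: "((\<lambda>y. (max 0 (1 - y / a))\<^sup>2) has_real_derivative - 2 / a * max 0 (1 - y / a)) (at y)"
  proof -
    have "((\<lambda>y. 1 - y / a) has_real_derivative - 1 / a) (at y)"
      using DERIV_diff[OF DERIV_const[of 1] DERIV_cdivide[OF DERIV_ident, of a]] by simp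
    from DERIV_chain2[OF max_0_square_deriv this] show ?thesis by simp
  qed
  show ?thesis
    unfolding cutoff_def[abs_def]
    by (rule derivative_eq_intros 1 2 refl)+ (use assms in \<open>auto simp: cutoff'_def field_simps power2_eq_square\<close>)
qed

lemma cutoff_eq_0: "a > 0 \<Longrightarrow> y \<le> 1 / a \<or> y \<ge> a \<Longrightarrow> cutoff a y = 0 \<and> cutoff' a y = 0"
  by (auto simp: cutoff_def cutoff'_def max_def field_simps)

text \<open>The bounds are independent of \<open>a\<close>, as dominated convergence requires. The
  constant 5 = 2 + 2 + 1 has one summand for each term of \<open>cutoff'\<close>; in the second term
  y / a is harmless because the factor beside it vanishes for y \<ge> a.\<close>

lemma cutoff_bounds:
  assumes "y > 0" "a \<ge> 1"
  shows "0 \<le> cutoff a y" "cutoff a y \<le> y" "\<bar>cutoff' a y\<bar> \<le> 5"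
proof -
  define A where "A = max 0 (y - 1 / a)"
  define B where "B = max 0 (1 - y / a)"
  have A: "0 \<le> A" "A \<le> y" using assms by (auto simp: A_def)
  have B: "0 \<le> B" "B \<le> 1" using assms by (auto simp: B_def)
  have B2: "B\<^sup>2 \<le> 1" using B by (simp add: power_le_one)
  have yB: "y / a * B \<le> 1"
  proof (cases "y \<le> a")
    case True
    then have "y / a * B \<le> 1 * 1" using assms B by (intro mult_mono) auto
    then show ?thesis by simp
  next
    case False
    then have "B = 0" using assms by (auto simp: B_def field_simps)
    then show ?thesis by simp
  qed
  have AA: "A\<^sup>2 \<le> y\<^sup>2" using A by (intro power_mono) auto
  show "0 \<le> cutoff a y" using assms by (simp add: cutoff_def)
  have AB0: "A\<^sup>2 * B\<^sup>2 \<le> y\<^sup>2 * 1" using AA B2 by (intro mult_mono) auto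
  then have AB: "A\<^sup>2 * B\<^sup>2 / y\<^sup>2 \<le> 1" using assms by (simp add: field_simps)
  have "cutoff a y = A\<^sup>2 * B\<^sup>2 / y" by (simp add: cutoff_def A_def B_def)
  with AB0 show "cutoff a y \<le> y"
    using assms by (simp add: pos_divide_le_eq power2_eq_square)
  have 1: "2 * A * B\<^sup>2 / y \<le> 2"
    using mult_mono[OF A(2) B2] assms A by (simp add: field_simps)
  have 2: "2 / a * A\<^sup>2 * B / y \<le> 2"
  proof -
    have "A\<^sup>2 * (B / (a * y)) \<le> y\<^sup>2 * (B / (a * y))" using AA B assms by (intro mult_right_mono) auto
    also have "\<dots> = y / a * B" using assms by (simp add: power2_eq_square)
    finally have "A\<^sup>2 * (B / (a * y)) \<le> 1" using yB by simp
    moreover have "2 / a * A\<^sup>2 * B / y = 2 * (A\<^sup>2 * (B / (a * y)))" by simp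
    ultimately show ?thesis by simp
  qed
  have 0: "0 \<le> 2 * A * B\<^sup>2 / y" "0 \<le> 2 / a * A\<^sup>2 * B / y" "0 \<le> A\<^sup>2 * B\<^sup>2 / y\<^sup>2"
    using A B assms by auto
  have "cutoff' a y = 2 * A * B\<^sup>2 / y - 2 / a * A\<^sup>2 * B / y - A\<^sup>2 * B\<^sup>2 / y\<^sup>2"
    by (simp add: cutoff'_def A_def B_def)
  with 0 1 2 AB show "\<bar>cutoff' a y\<bar> \<le> 5" by linarith
qed

lemma cutoff_tendsto:
  assumes "y > 0"
  shows "(\<lambda>n. cutoff (real (Suc n)) y) \<longlonglongrightarrow> y" "(\<lambda>n. cutoff' (real (Suc n)) y) \<longlonglongrightarrow> 1"
proof -
  have i: "(\<lambda>n. 1 / real (Suc n)) \<longlonglongrightarrow> 0"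
    by (rule LIMSEQ_Suc[OF lim_1_over_n])
  have A: "(\<lambda>n. max 0 (y - 1 / real (Suc n))) \<longlonglongrightarrow> y"
    using tendsto_max[OF tendsto_const tendsto_diff[OF tendsto_const i], of 0 y] assms by simp
  have "(\<lambda>n. y * (1 / real (Suc n))) \<longlonglongrightarrow> y * 0"
    by (intro tendsto_intros i)
  then have "(\<lambda>n. y / real (Suc n)) \<longlonglongrightarrow> 0" by simp
  from tendsto_max[OF tendsto_const tendsto_diff[OF tendsto_const this], of 0 1]
  have B: "(\<lambda>n. max 0 (1 - y / real (Suc n))) \<longlonglongrightarrow> 1" by simp
  have "(\<lambda>n. cutoff (real (Suc n)) y) \<longlonglongrightarrow> y\<^sup>2 * 1\<^sup>2 / y"
    unfolding cutoff_def using assms by (intro tendsto_intros A B) auto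
  then show "(\<lambda>n. cutoff (real (Suc n)) y) \<longlonglongrightarrow> y"
    using assms by (simp add: power2_eq_square)
  have "(\<lambda>n. 2 * (1 / real (Suc n)) * (max 0 (y - 1 / real (Suc n)))\<^sup>2 * max 0 (1 - y / real (Suc n)) / y)
    \<longlonglongrightarrow> 2 * 0 * y\<^sup>2 * 1 / y"
    using assms by (intro tendsto_intros A B i) auto
  moreover have "(\<lambda>n. 2 * max 0 (y - 1 / real (Suc n)) * (max 0 (1 - y / real (Suc n)))\<^sup>2 / y) \<longlonglongrightarrow> 2 * y * 1\<^sup>2 / y"
    using assms by (intro tendsto_intros A B) auto
  moreover have "(\<lambda>n. (max 0 (y - 1 / real (Suc n)))\<^sup>2 * (max 0 (1 - y / real (Suc n)))\<^sup>2 / y\<^sup>2) \<longlonglongrightarrow> y\<^sup>2 * 1\<^sup>2 / y\<^sup>2"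
    using assms by (intro tendsto_intros A B) auto
  ultimately have "(\<lambda>n. cutoff' (real (Suc n)) y) \<longlonglongrightarrow> 2 * y * 1\<^sup>2 / y - 2 * 0 * y\<^sup>2 * 1 / y - y\<^sup>2 * 1\<^sup>2 / y\<^sup>2"
    unfolding cutoff'_def by (intro tendsto_diff) simp_all
  then show "(\<lambda>n. cutoff' (real (Suc n)) y) \<longlonglongrightarrow> 1"
    using assms by simp
qed

text \<open>
  The radial vector field \<open>cut_field (N - 1) a |x| x\<close> is the truncation of \<open>\<rho> \<nabla>\<rho>\<close>, written in
  Euclidean terms: \<open>(2 / (1 - |x|\<^sup>2)) ^ (N - 1) \<rho> x / |x|\<close>.
\<close>

definition cut_field :: "nat \<Rightarrow> real \<Rightarrow> real \<Rightarrow> real" where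
  "cut_field m a s = (if s < 1 then (2 / (1 - s\<^sup>2)) ^ m * cutoff a (rad_dist s) / s else 0)"

definition cut_field' :: "nat \<Rightarrow> real \<Rightarrow> real \<Rightarrow> real" where
  "cut_field' m a s = (if s < 1 then
      (real m * (2 / (1 - s\<^sup>2)) ^ (m - 1) * (s * (2 / (1 - s\<^sup>2))\<^sup>2) * cutoff a (rad_dist s)
       + (2 / (1 - s\<^sup>2)) ^ m * (cutoff' a (rad_dist s) * (2 / (1 - s\<^sup>2)))) / s
      - (2 / (1 - s\<^sup>2)) ^ m * cutoff a (rad_dist s) / s\<^sup>2 else 0)"

lemma cut_field_near_0:
  assumes "a > 0" "\<bar>s\<bar> < 1" "rad_dist s \<le> 1 / a"
  shows "cut_field m a s = 0" "cut_field' m a s = 0"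
  using assms cutoff_eq_0 by (auto simp: cut_field_def cut_field'_def)

text \<open>Where \<rho> < 1 / a, in particular for s \<le> 0, both functions vanish on an open set;
  every other point lies in (0, 1), where the formula can be differentiated.\<close>

lemma cut_field_deriv:
  assumes a: "a > 0" and s: "\<bar>s\<bar> < 1"
  shows "(cut_field m a has_real_derivative cut_field' m a s) (at s)" "isCont (cut_field' m a) s"
proof -
  have rc: "continuous_on {-1<..<1} rad_dist"
    by (intro continuous_at_imp_continuous_on ballI DERIV_isCont[OF rad_dist_deriv]) auto
  define U where "U = {-1<..<1} \<inter> rad_dist -` {..<1 / a}"
  have U: "open U" unfolding U_def
    by (intro continuous_open_preimage[OF rc]) auto
  have "(cut_field m a has_real_derivative cut_field' m a s) (at s) \<and> isCont (cut_field' m a) s"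
  proof (cases "s \<in> U")
    case True
    have zero: "cut_field m a t = 0" "cut_field' m a t = 0" if "t \<in> U" for t
      using that a by (auto simp: U_def intro!: cut_field_near_0)
    have "((\<lambda>s. 0) has_real_derivative cut_field' m a s) (at s)" using zero[OF True] by simp
    then have 1: "(cut_field m a has_real_derivative cut_field' m a s) (at s)"
      by (rule has_field_derivative_transform_within_open[OF _ U True]) (simp add: zero)
    have "continuous_on U (cut_field' m a)"
      by (subst continuous_on_cong[OF refl, of _ _ "\<lambda>_. 0"]) (auto simp: zero)
    then have "isCont (cut_field' m a) s"
      using U True by (simp add: continuous_on_eq_continuous_at)
    with 1 show ?thesis by simp
  next
    case False
    then have "rad_dist s \<ge> 1 / a" using s by (auto simp: U_def)
    then have rpos: "rad_dist s > 0" using a by (smt (verit) divide_pos_pos)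
    then have spos: "s > 0" using rad_dist_nonpos[of s] s by (cases "s \<le> 0") auto
    have s1: "s < 1" using s by simp
    have rp: "rad_dist t > 0" if "t \<in> {0<..<1}" for t
      using rad_dist_ge[of t] that by auto
    have p: "((\<lambda>s. 2 / (1 - s\<^sup>2)) has_real_derivative s * (2 / (1 - s\<^sup>2))\<^sup>2) (at s)"
      using one_minus_square_pos[OF s]
      by (auto intro!: derivative_eq_intros simp: field_simps power2_eq_square)
    have c: "((\<lambda>s. cutoff a (rad_dist s)) has_real_derivative cutoff' a (rad_dist s) * (2 / (1 - s\<^sup>2))) (at s)"
      by (rule DERIV_chain2[OF cutoff_deriv[OF rpos] rad_dist_deriv[OF s]])
    have "((\<lambda>s. (2 / (1 - s\<^sup>2)) ^ m * cutoff a (rad_dist s) / s) has_real_derivative cut_field' m a s) (at s)"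
      by (rule derivative_eq_intros DERIV_power[OF p] c refl)+
         (use s1 spos in \<open>auto simp: cut_field'_def divide_simps power2_eq_square\<close>,
          (simp add: algebra_simps)?)
    then have 1: "(cut_field m a has_real_derivative cut_field' m a s) (at s)"
      by (rule has_field_derivative_transform_within_open[of _ _ _ "{0<..<1}"])
         (use s1 spos in \<open>auto simp: cut_field_def\<close>)
    have sq: "1 - t\<^sup>2 \<noteq> 0" if "t \<in> {0<..<1}" for t :: real
      using one_minus_square_pos[of t] that by auto
    have rc': "continuous_on {0<..<1} rad_dist" using rc by (rule continuous_on_subset) auto
    have c0: "continuous_on {0<..<1} (\<lambda>t. cutoff a (rad_dist t))"
      unfolding cutoff_def using rp a by (intro continuous_intros rc') (auto simp: less_imp_neq[THEN not_sym])
    have c1: "continuous_on {0<..<1} (\<lambda>t. cutoff' a (rad_dist t))"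
      unfolding cutoff'_def using rp a by (intro continuous_intros rc') (auto simp: less_imp_neq[THEN not_sym])
    have "continuous_on {0<..<1} (\<lambda>s. (real m * (2 / (1 - s\<^sup>2)) ^ (m - 1) * (s * (2 / (1 - s\<^sup>2))\<^sup>2) * cutoff a (rad_dist s)
       + (2 / (1 - s\<^sup>2)) ^ m * (cutoff' a (rad_dist s) * (2 / (1 - s\<^sup>2)))) / s
      - (2 / (1 - s\<^sup>2)) ^ m * cutoff a (rad_dist s) / s\<^sup>2)"
      using sq by (intro continuous_intros c0 c1) auto
    then have "continuous_on {0<..<1} (cut_field' m a)"
      by (rule continuous_on_eq) (auto simp: cut_field'_def)
    then have "isCont (cut_field' m a) s"
      using s1 spos by (simp add: continuous_on_eq_continuous_at)
    with 1 show ?thesis by simp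
  qed
  then show "(cut_field m a has_real_derivative cut_field' m a s) (at s)" "isCont (cut_field' m a) s" by auto
qed

text \<open>With N = m + 1 the left-hand side is the Euclidean divergence of
  \<open>cut_field m a |x| x\<close> at radius s. Divided by the volume density it is q' + (N - 1) q
  coth \<rho>, the hyperbolic divergence of a radial field of length q =
  \<open>cutoff a \<rho>\<close>.\<close>

lemma cut_field_divergence:
  assumes s: "0 < s" "s < 1"
  shows "real (Suc m) * cut_field m a s + s * cut_field' m a s =
    (2 / (1 - s\<^sup>2)) ^ Suc m * (cutoff' a (rad_dist s) + real m * (cutoff a (rad_dist s) * ((1 + s\<^sup>2) / (2 * s))))"
proof -
  define p where "p = 2 / (1 - s\<^sup>2)"
  define Q where "Q = cutoff a (rad_dist s)"
  define Q' where "Q' = cutoff' a (rad_dist s)"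
  have sq: "1 - s\<^sup>2 > 0" using one_minus_square_pos[of s] s by simp
  have p: "p > 0" using sq by (simp add: p_def)
  have c: "cut_field m a s = p ^ m * Q / s"
    using s by (simp add: cut_field_def p_def Q_def)
  have c': "cut_field' m a s = (real m * p ^ (m - 1) * (s * p\<^sup>2) * Q + p ^ m * (Q' * p)) / s - p ^ m * Q / s\<^sup>2"
    using s by (simp add: cut_field'_def p_def Q_def Q'_def)
  have "real m * p ^ (m - 1) * (s * p\<^sup>2) = real m * (s * (p * p ^ m))"
    by (cases m) (simp_all add: power2_eq_square)
  then have "s * cut_field' m a s = real m * (s * (p * p ^ m)) * Q + p ^ m * (Q' * p) - p ^ m * Q / s"
    using s unfolding c' by (simp add: power2_eq_square right_diff_distrib)
  then have "real (Suc m) * cut_field m a s + s * cut_field' m a s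
    = p ^ Suc m * Q' + real m * p ^ m * Q * (s * p + 1 / s)"
    unfolding c by (simp add: algebra_simps add_divide_distrib)
  also have "s * p + 1 / s = p * ((1 + s\<^sup>2) / (2 * s))"
    using s sq unfolding p_def by (simp add: field_simps power2_eq_square)
  finally show ?thesis
    by (simp add: p_def Q_def Q'_def algebra_simps)
qed

section \<open>The divergence identity\<close>

lemma conf_ge_1: "norm x < 1 \<Longrightarrow> 1 \<le> conf x"
  using one_minus_square_pos[of "norm x"] by (simp add: conf_def field_simps)

lemma hyp_dist0_nonneg: "norm x < 1 \<Longrightarrow> 0 \<le> hyp_dist0 x"
  using rad_dist_ge[of "norm x"] norm_ge_zero[of x] unfolding hyp_dist0_eq by linarith

lemma hyp_dist0_measurable[measurable]: "hyp_dist0 \<in> borel_measurable borel"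
  unfolding hyp_dist0_def[abs_def] by measurable

lemma conf_measurable[measurable]: "conf \<in> borel_measurable borel"
  unfolding conf_def[abs_def] by measurable

lemma hyp_weight_measurable[measurable]: "hyp_weight \<in> borel_measurable borel"
  unfolding hyp_weight_def[abs_def] cosh_field_def sinh_field_def by measurable

lemma hyp_gaussian_measurable[measurable]: "hyp_gaussian l \<in> borel_measurable borel"
  unfolding hyp_gaussian_def[abs_def] by measurable

text \<open>Membership in W^(1,2) with finite second moment, in Euclidean terms and for Borel
  functions. The exponent N - 2 arises because the hyperbolic length of the gradient is its
  Euclidean length divided by \<open>conf x\<close>.\<close>

definition hyp_admissible :: "('a::euclidean_space \<Rightarrow> real) \<Rightarrow> ('a \<Rightarrow> 'a) \<Rightarrow> bool" where
  "hyp_admissible u h \<longleftrightarrow>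
     u \<in> borel_measurable borel \<and> h \<in> borel_measurable borel \<and> (\<forall>r<1. grad_approx r u h) \<and>
     integrable (lborel_ball 1) (\<lambda>x. conf x ^ DIM('a) * (u x)\<^sup>2) \<and>
     integrable (lborel_ball 1) (\<lambda>x. conf x ^ DIM('a) * ((hyp_dist0 x)\<^sup>2 * (u x)\<^sup>2)) \<and>
     integrable (lborel_ball 1) (\<lambda>x. conf x ^ (DIM('a) - 2) * (norm (h x))\<^sup>2)"

lemma AE_lborel_ball_nonzero: "AE x in lborel_ball r. x \<noteq> (0::'a::euclidean_space)"
  using AE_lborel_singleton[of "0::'a"] by (subst AE_restrict_space_iff) auto

text \<open>The weight \<open>conf x ^ (N - 1)\<close> is the geometric mean of the two weights on
  the right, so 2 a b \<le> a^2 + b^2 applies. With any q up to \<rho> the bound covers the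
  truncated fields and their limit alike.\<close>

lemma mixed_term_bound:
  fixes h x :: "'a::euclidean_space"
  assumes N: "DIM('a) \<ge> 2" and x: "norm x < 1" and q: "0 \<le> q" "q \<le> hyp_dist0 x"
  shows "\<bar>2 * (conf x ^ (DIM('a) - 1) * q * t * (h \<bullet> x) / norm x)\<bar>
    \<le> conf x ^ DIM('a) * ((hyp_dist0 x)\<^sup>2 * t\<^sup>2) + conf x ^ (DIM('a) - 2) * (norm h)\<^sup>2"
proof -
  define n where "n = DIM('a) - 2"
  have n: "DIM('a) - 1 = Suc n" "DIM('a) = Suc (Suc n)" "DIM('a) - 2 = n" using N by (auto simp: n_def)
  define p where "p = conf x"
  have p: "p \<ge> 1" using conf_ge_1[OF x] by (simp add: p_def)
  define \<rho> where "\<rho> = hyp_dist0 x"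
  have hx: "\<bar>h \<bullet> x\<bar> / norm x \<le> norm h"
    using Cauchy_Schwarz_ineq2[of h x] by (cases "x = 0") (auto simp: field_simps)
  have "\<bar>2 * (p ^ Suc n * q * t * (h \<bullet> x) / norm x)\<bar> = 2 * (p ^ Suc n * q * \<bar>t\<bar>) * (\<bar>h \<bullet> x\<bar> / norm x)"
    using p q by (simp add: abs_mult)
  also have "\<dots> \<le> 2 * (p ^ Suc n * \<rho> * \<bar>t\<bar>) * norm h"
    using p q hx by (intro mult_mono) (auto simp: \<rho>_def intro!: mult_mono)
  also have "\<dots> = p ^ n * (2 * (p * \<rho> * \<bar>t\<bar>) * norm h)" by simp
  also have "\<dots> \<le> p ^ n * ((p * \<rho> * \<bar>t\<bar>)\<^sup>2 + (norm h)\<^sup>2)"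
    using p sum_squares_bound[of "p * \<rho> * \<bar>t\<bar>" "norm h"] by (intro mult_left_mono) auto
  also have "\<dots> = p ^ Suc (Suc n) * (\<rho>\<^sup>2 * t\<^sup>2) + p ^ n * (norm h)\<^sup>2"
    by (simp add: power_mult_distrib power2_eq_square algebra_simps)
  finally have *: "\<bar>2 * (p ^ Suc n * q * t * (h \<bullet> x) / norm x)\<bar> \<le> p ^ Suc (Suc n) * (\<rho>\<^sup>2 * t\<^sup>2) + p ^ n * (norm h)\<^sup>2" .
  have "conf x ^ (DIM('a) - 1) = p ^ Suc n" "conf x ^ DIM('a) = p ^ Suc (Suc n)" "conf x ^ (DIM('a) - 2) = p ^ n"
    using n by (simp_all only: p_def)
  then show ?thesis using * by (simp only: \<rho>_def)
qed

lemma hyp_admissible_integrable: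
  fixes u :: "'a::euclidean_space \<Rightarrow> real"
  assumes adm: "hyp_admissible u h" and N: "DIM('a) \<ge> 2"
  shows "integrable (lborel_ball 1) (\<lambda>x. (u x)\<^sup>2)" (is ?A)
    and "integrable (lborel_ball 1) (\<lambda>x. (norm (h x))\<^sup>2)" (is ?B)
    and "integrable (lborel_ball 1) (\<lambda>x. conf x ^ DIM('a) * (hyp_weight x * (u x)\<^sup>2))" (is ?C)
    and "integrable (lborel_ball 1)
          (\<lambda>x. 2 * (conf x ^ (DIM('a) - 1) * hyp_dist0 x * u x * (h x \<bullet> x) / norm x))" (is ?D)
proof -
  have [measurable]: "u \<in> borel_measurable borel" "h \<in> borel_measurable borel"
    and i1: "integrable (lborel_ball 1) (\<lambda>x. conf x ^ DIM('a) * (u x)\<^sup>2)"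
    and i2: "integrable (lborel_ball 1) (\<lambda>x. conf x ^ DIM('a) * ((hyp_dist0 x)\<^sup>2 * (u x)\<^sup>2))"
    and i3: "integrable (lborel_ball 1) (\<lambda>x. conf x ^ (DIM('a) - 2) * (norm (h x))\<^sup>2)"
    using adm unfolding hyp_admissible_def by auto
  have p1: "1 \<le> conf x ^ k" if "norm x < 1" for x :: 'a and k
    using conf_ge_1[OF that] by simp
  show ?A
  proof (rule integrable_lborel_ball_bound[OF i1])
    fix x :: 'a assume "norm x < 1"
    then have "1 * (u x)\<^sup>2 \<le> conf x ^ DIM('a) * (u x)\<^sup>2"
      by (intro mult_right_mono p1) auto
    then show "\<bar>(u x)\<^sup>2\<bar> \<le> conf x ^ DIM('a) * (u x)\<^sup>2" by simp
  qed measurable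
  show ?B
  proof (rule integrable_lborel_ball_bound[OF i3])
    fix x :: 'a assume "norm x < 1"
    then have "1 * (norm (h x))\<^sup>2 \<le> conf x ^ (DIM('a) - 2) * (norm (h x))\<^sup>2"
      by (intro mult_right_mono p1) auto
    then show "\<bar>(norm (h x))\<^sup>2\<bar> \<le> conf x ^ (DIM('a) - 2) * (norm (h x))\<^sup>2" by simp
  qed measurable
  have i12: "integrable (lborel_ball 1) (\<lambda>x. 2 * DIM('a) * (conf x ^ DIM('a) * (u x)\<^sup>2)
      + DIM('a) * (conf x ^ DIM('a) * ((hyp_dist0 x)\<^sup>2 * (u x)\<^sup>2)))"
    using i1 i2 by simp
  show ?C
  proof (rule integrable_lborel_ball_bound[OF i12])
    fix x :: 'a assume x: "norm x < 1"
    define \<rho> where "\<rho> = hyp_dist0 x"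
    have "\<rho> \<ge> 0" using hyp_dist0_nonneg[OF x] by (simp add: \<rho>_def)
    have "0 \<le> (\<rho> - 1)\<^sup>2" by simp
    then have r2: "\<rho> \<le> 1 + \<rho>\<^sup>2" using \<open>\<rho> \<ge> 0\<close> by (simp add: power2_diff)
    have "hyp_weight x \<le> DIM('a) + (real DIM('a) - 1) * \<rho>"
      using hyp_weight_bounds[OF x] by (simp add: \<rho>_def)
    also have "\<dots> \<le> DIM('a) + real DIM('a) * (1 + \<rho>\<^sup>2)"
      using r2 \<open>\<rho> \<ge> 0\<close> by (intro add_left_mono mult_mono) auto
    finally have w: "hyp_weight x \<le> 2 * DIM('a) + DIM('a) * \<rho>\<^sup>2" by (simp add: algebra_simps)
    have "conf x ^ DIM('a) * (hyp_weight x * (u x)\<^sup>2) \<le> conf x ^ DIM('a) * ((2 * DIM('a) + DIM('a) * \<rho>\<^sup>2) * (u x)\<^sup>2)"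
      using w p1[OF x, of "DIM('a)"] by (intro mult_left_mono mult_right_mono) auto
    also have "\<dots> = 2 * DIM('a) * (conf x ^ DIM('a) * (u x)\<^sup>2) + DIM('a) * (conf x ^ DIM('a) * (\<rho>\<^sup>2 * (u x)\<^sup>2))"
      by (simp add: algebra_simps)
    finally have le: "conf x ^ DIM('a) * (hyp_weight x * (u x)\<^sup>2) \<le> \<dots>" .
    have "0 \<le> conf x ^ DIM('a) * (hyp_weight x * (u x)\<^sup>2)"
      using hyp_weight_bounds(1)[OF x] p1[OF x, of "DIM('a)"] by (intro mult_nonneg_nonneg) auto
    with le show "\<bar>conf x ^ DIM('a) * (hyp_weight x * (u x)\<^sup>2)\<bar> \<le>
       2 * DIM('a) * (conf x ^ DIM('a) * (u x)\<^sup>2) + DIM('a) * (conf x ^ DIM('a) * ((hyp_dist0 x)\<^sup>2 * (u x)\<^sup>2))"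
      unfolding \<rho>_def by linarith
  qed measurable
  have i23: "integrable (lborel_ball 1) (\<lambda>x. conf x ^ DIM('a) * ((hyp_dist0 x)\<^sup>2 * (u x)\<^sup>2) + conf x ^ (DIM('a) - 2) * (norm (h x))\<^sup>2)"
    using i2 i3 by simp
  show ?D
    by (rule integrable_lborel_ball_bound[OF i23], measurable)
       (rule mixed_term_bound[OF N _ hyp_dist0_nonneg order_refl])
qed

text \<open>The witness \<open>b\<close> is tanh (a / 2), the Euclidean radius at which \<rho> =
  a.\<close>

lemma cut_field_support:
  fixes x :: "'a::euclidean_space"
  assumes "a \<ge> 1"
  shows "\<exists>b<1. \<forall>s>b. cut_field m a s = 0 \<and> cut_field' m a s = 0"
proof -
  define b where "b = (exp a - 1) / (exp a + 1)"
  have e: "exp a > 0" by simp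
  have "b < 1" unfolding b_def by (subst pos_divide_less_eq) (use e in linarith, simp)
  moreover have "cut_field m a s = 0 \<and> cut_field' m a s = 0" if "s > b" for s
  proof (cases "s < 1")
    case True
    have "b \<ge> 0" using assms by (simp add: b_def)
    then have s: "0 < s" "\<bar>s\<bar> < 1" using that True by auto
    have "exp a - 1 < s * (exp a + 1)"
      using that unfolding b_def by (subst (asm) pos_divide_less_eq) (use e in linarith, simp)
    then have "exp a * (1 - s) \<le> 1 + s" by (simp add: algebra_simps)
    then have "exp a \<le> exp (rad_dist s)"
      using s True by (simp add: exp_rad_dist pos_le_divide_eq)
    then have "a \<le> rad_dist s" by simp
    then show ?thesis
      using cutoff_eq_0[of a "rad_dist s"] assms by (simp add: cut_field_def cut_field'_def)
  qed (simp add: cut_field_def cut_field'_def)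
  ultimately show ?thesis by blast
qed

text \<open>The second term is 2 u times the pairing of \<nabla>u with \<rho> \<nabla>\<rho>.
  \<open>integration_by_parts_radial\<close> handles the truncations a = 1, 2, 3, ..., and dominated
  convergence removes them.\<close>

lemma hyp_divergence_identity:
  fixes u :: "'a::euclidean_space \<Rightarrow> real"
  assumes adm: "hyp_admissible u h" and N: "DIM('a) \<ge> 2"
  shows "(LINT x|lborel_ball 1. conf x ^ DIM('a) * (hyp_weight x * (u x)\<^sup>2)
     + 2 * (conf x ^ (DIM('a) - 1) * hyp_dist0 x * u x * (h x \<bullet> x) / norm x)) = 0"
proof -
  have um[measurable]: "u \<in> borel_measurable borel" and hm[measurable]: "h \<in> borel_measurable borel"
    and ga: "\<And>r. r < 1 \<Longrightarrow> grad_approx r u h"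
    and i1: "integrable (lborel_ball 1) (\<lambda>x. conf x ^ DIM('a) * (u x)\<^sup>2)"
    and i2: "integrable (lborel_ball 1) (\<lambda>x. conf x ^ DIM('a) * ((hyp_dist0 x)\<^sup>2 * (u x)\<^sup>2))"
    and i3: "integrable (lborel_ball 1) (\<lambda>x. conf x ^ (DIM('a) - 2) * (norm (h x))\<^sup>2)"
    using adm unfolding hyp_admissible_def by auto
  note iall = hyp_admissible_integrable[OF adm N]
  define m where "m = DIM('a) - 1"
  have m: "DIM('a) = Suc m" "DIM('a) - 1 = m" using N by (auto simp: m_def)
  define a where "a n = real (Suc n)" for n
  have a1: "a n \<ge> 1" for n by (simp add: a_def)
  define \<sigma> where "\<sigma> n x = cut_field m (a n) (norm x)" for n and x :: 'a
  define S where "S n x = (cut_field' m (a n) (norm x) / norm x) *\<^sub>R x" for n and x :: 'a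
  have C1: "C1_on (ball 0 1) (\<sigma> n) (S n)" for n
  proof -
    have an: "a n > 0" using a1[of n] by linarith
    have c: "continuous_on {-1<..<1} (cut_field' m (a n))"
      by (intro continuous_at_imp_continuous_on ballI cut_field_deriv(2)[OF an]) auto
    have "cut_field' m (a n) 0 = 0"
      using an by (intro cut_field_near_0) (auto simp: rad_dist_def)
    from C1_on_radial[OF cut_field_deriv(1)[OF an] c this] show ?thesis
      by (simp add: \<sigma>_def[abs_def] S_def[abs_def])
  qed
  define G where "G n x = (u x)\<^sup>2 * (DIM('a) * \<sigma> n x + S n x \<bullet> x) + 2 * u x * \<sigma> n x * (h x \<bullet> x)" for n x
  have G0: "(LINT x|lborel_ball 1. G n x) = 0" for n
  proof -
    obtain b where b: "b < 1" "\<And>s. s > b \<Longrightarrow> cut_field m (a n) s = 0 \<and> cut_field' m (a n) s = 0"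
      using cut_field_support[OF a1[of n], of m] by blast
    show ?thesis
      unfolding G_def
      by (rule integration_by_parts_radial[OF ga um hm iall(1,2) C1 _ b(1)])
         (auto simp: \<sigma>_def S_def b(2))
  qed
  define F where "F x = conf x ^ DIM('a) * (hyp_weight x * (u x)\<^sup>2)
     + 2 * (conf x ^ (DIM('a) - 1) * hyp_dist0 x * u x * (h x \<bullet> x) / norm x)" for x
  have Geq: "G n x = conf x ^ DIM('a) * ((cutoff' (a n) (hyp_dist0 x)
        + real m * (cutoff (a n) (hyp_dist0 x) * ((1 + (norm x)\<^sup>2) / (2 * norm x)))) * (u x)\<^sup>2)
      + 2 * (conf x ^ (DIM('a) - 1) * cutoff (a n) (hyp_dist0 x) * u x * (h x \<bullet> x) / norm x)"
    if "x \<noteq> 0" "norm x < 1" for n x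
  proof -
    define s where "s = norm x"
    have s: "0 < s" "s < 1" using that by (auto simp: s_def)
    have "S n x \<bullet> x = s * cut_field' m (a n) s"
      using s by (simp add: S_def s_def power2_norm_eq_inner[symmetric] power2_eq_square)
    then have d: "DIM('a) * \<sigma> n x + S n x \<bullet> x = conf x ^ DIM('a) * (cutoff' (a n) (rad_dist s)
        + real m * (cutoff (a n) (rad_dist s) * ((1 + s\<^sup>2) / (2 * s))))"
      using cut_field_divergence[OF s, of m "a n"] by (simp only: m \<sigma>_def s_def[symmetric] conf_def)
    have "\<sigma> n x = conf x ^ m * cutoff (a n) (rad_dist s) / s"
      using s by (simp add: \<sigma>_def cut_field_def conf_def s_def[symmetric])
    then show ?thesis
      unfolding G_def d hyp_dist0_eq s_def[symmetric] m(2) by (simp add: mult_ac)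
  qed
  \<comment> \<open>The majorant collects |\<open>cutoff'\<close>| \<le> 5, then m times \<rho> coth
    \<rho> \<le> 1 + \<rho> \<le> 2 + \<rho>^2, and the two terms of
    \<open>mixed_term_bound\<close>.\<close>
  define W where "W x = (5 + 2 * real m) * (conf x ^ DIM('a) * (u x)\<^sup>2)
     + (real m + 1) * (conf x ^ DIM('a) * ((hyp_dist0 x)\<^sup>2 * (u x)\<^sup>2))
     + conf x ^ (DIM('a) - 2) * (norm (h x))\<^sup>2" for x
  have Wi: "integrable (lborel_ball 1) W"
    unfolding W_def[abs_def] using i1 i2 i3 by simp
  have GW: "\<bar>G n x\<bar> \<le> W x" if x: "x \<noteq> 0" "norm x < 1" for n x
  proof -
    define s where "s = norm x"
    have s: "0 < s" "s < 1" using that by (auto simp: s_def)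
    define \<rho> where "\<rho> = rad_dist s"
    have \<rho>: "\<rho> > 0" "hyp_dist0 x = \<rho>"
      using rad_dist_ge[of s] s unfolding \<rho>_def hyp_dist0_eq s_def by linarith+
    define c where "c = cutoff (a n) \<rho>"
    define c' where "c' = cutoff' (a n) \<rho>"
    have cb: "0 \<le> c" "c \<le> \<rho>" "\<bar>c'\<bar> \<le> 5"
      using cutoff_bounds[OF \<rho>(1) a1[of n]] by (auto simp: c_def c'_def)
    define k where "k = (1 + s\<^sup>2) / (2 * s)"
    have k: "0 \<le> k" "\<rho> * k \<le> 1 + \<rho>"
      using rad_dist_coth_le[OF s] s by (auto simp: k_def \<rho>_def)
    have "0 \<le> (\<rho> - 1)\<^sup>2" by simp
    then have r2: "\<rho> \<le> 1 + \<rho>\<^sup>2" using \<rho> by (simp add: power2_diff)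
    have "c * k \<le> \<rho> * k" using cb k by (intro mult_right_mono) auto
    then have ck: "0 \<le> c * k" "c * k \<le> 2 + \<rho>\<^sup>2" using cb k r2 by auto
    have "\<bar>c' + real m * (c * k)\<bar> \<le> 5 + real m * (2 + \<rho>\<^sup>2)"
      using cb(3) mult_left_mono[OF ck(2), of "real m"] mult_nonneg_nonneg[OF _ ck(1), of "real m"]
      by (simp add: abs_le_iff) 
    then have 1: "\<bar>conf x ^ DIM('a) * ((c' + real m * (c * k)) * (u x)\<^sup>2)\<bar>
      \<le> conf x ^ DIM('a) * ((5 + real m * (2 + \<rho>\<^sup>2)) * (u x)\<^sup>2)"
      using conf_ge_1[OF x(2)] by (simp add: abs_mult mult_left_mono mult_right_mono)
    have 2: "\<bar>2 * (conf x ^ (DIM('a) - 1) * c * u x * (h x \<bullet> x) / norm x)\<bar>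
      \<le> conf x ^ DIM('a) * (\<rho>\<^sup>2 * (u x)\<^sup>2) + conf x ^ (DIM('a) - 2) * (norm (h x))\<^sup>2"
      using mixed_term_bound[OF N x(2) cb(1), of "u x" "h x"] cb(2) \<rho>(2) by simp
    have "\<bar>G n x\<bar> \<le> conf x ^ DIM('a) * ((5 + real m * (2 + \<rho>\<^sup>2)) * (u x)\<^sup>2)
       + (conf x ^ DIM('a) * (\<rho>\<^sup>2 * (u x)\<^sup>2) + conf x ^ (DIM('a) - 2) * (norm (h x))\<^sup>2)"
      unfolding Geq[OF x] \<rho>(2) c_def[symmetric] c'_def[symmetric] s_def[symmetric] k_def[symmetric]
      using 1 2 unfolding s_def[symmetric] by (intro order_trans[OF abs_triangle_ineq add_mono])
    also have "\<dots> = W x" by (simp add: W_def \<rho>(2) algebra_simps)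
    finally show ?thesis .
  qed
  have Fm: "F \<in> borel_measurable (lborel_ball 1)"
    using borel_measurable_integrable[OF iall(3)] borel_measurable_integrable[OF iall(4)]
    unfolding F_def[abs_def] by (rule borel_measurable_add)
  have Gm: "G n \<in> borel_measurable (lborel_ball 1)" for n
  proof -
    have idm: "(\<lambda>x::'a. x) \<in> borel_measurable (lborel_ball 1)"
      by (rule measurable_lborel_ball) simp
    have Sc: "continuous_on (ball 0 1) (S n)" using C1[of n] by (simp add: C1_on_def)
    note [measurable] = idm measurable_lborel_ball[OF um] measurable_lborel_ball[OF hm]
      measurable_lborel_ball_continuous[OF C1_on_continuous[OF C1[of n]]]
      measurable_lborel_ball_continuous[OF Sc]
    show ?thesis unfolding G_def[abs_def] by measurable
  qed
  have nz: "AE x in lborel_ball 1. x \<noteq> (0::'a) \<and> norm x < 1"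
    using AE_lborel_ball_nonzero[of 1] AE_space[of "lborel_ball 1 :: 'a measure"]
    by eventually_elim (simp add: space_restrict_space)
  have "(\<lambda>n. LINT x|lborel_ball 1. G n x) \<longlonglongrightarrow> (LINT x|lborel_ball 1. F x)"
  proof (rule integral_dominated_convergence[OF Fm Gm Wi])
    show "AE x in lborel_ball 1. norm (G n x) \<le> W x" for n
      using nz by eventually_elim (simp add: GW)
    show "AE x in lborel_ball 1. (\<lambda>n. G n x) \<longlonglongrightarrow> F x"
      using nz
    proof eventually_elim
      case (elim x)
      then have x: "x \<noteq> 0" "norm x < 1" by auto
      have \<rho>: "hyp_dist0 x > 0"
        using rad_dist_ge[of "norm x"] x zero_less_norm_iff[of x] unfolding hyp_dist0_eq by linarith
      note lims = cutoff_tendsto[OF \<rho>, folded a_def]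
      have F: "F x = conf x ^ DIM('a) * ((1 + real m * (hyp_dist0 x * ((1 + (norm x)\<^sup>2) / (2 * norm x)))) * (u x)\<^sup>2)
        + 2 * (conf x ^ (DIM('a) - 1) * hyp_dist0 x * u x * (h x \<bullet> x) / norm x)"
        unfolding F_def hyp_weight_eq[OF x] using N by (simp add: m_def of_nat_diff)
      show "(\<lambda>n. G n x) \<longlonglongrightarrow> F x"
        unfolding Geq[OF x] F using x by (intro tendsto_intros lims) auto
    qed
  qed
  then have "(LINT x|lborel_ball 1. F x) = 0"
    unfolding G0 by (simp add: LIMSEQ_const_iff)
  then show ?thesis by (simp add: F_def)
qed

text \<open>
  \<open>l\<^sup>2 hyp_D l u h\<close> is the quantity \<open>D\<close> above when \<open>h\<close> is the Euclidean gradient of \<open>u\<close>; at \<open>x = 0\<close> the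
  quotient is \<open>0\<close>, as it should be.
\<close>

definition hyp_D :: "real \<Rightarrow> ('a::euclidean_space \<Rightarrow> real) \<Rightarrow> ('a \<Rightarrow> 'a) \<Rightarrow> real" where
  "hyp_D l u h = (LINT x|lborel_ball 1. conf x ^ (DIM('a) - 2) *
     (norm (h x + (hyp_dist0 x * conf x * u x / (l\<^sup>2 * norm x)) *\<^sub>R x))\<^sup>2)"

lemma hyp_D_expand:
  fixes u :: "'a::euclidean_space \<Rightarrow> real"
  assumes adm: "hyp_admissible u h" and N: "DIM('a) \<ge> 2" and l: "l > 0"
  shows "l\<^sup>2 * hyp_D l u h =
      l\<^sup>2 * (LINT x|lborel_ball 1. conf x ^ (DIM('a) - 2) * (norm (h x))\<^sup>2)
      + (LINT x|lborel_ball 1. conf x ^ DIM('a) * ((hyp_dist0 x)\<^sup>2 * (u x)\<^sup>2)) / l\<^sup>2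
      - (LINT x|lborel_ball 1. conf x ^ DIM('a) * (hyp_weight x * (u x)\<^sup>2))" (is ?T)
    and "integrable (lborel_ball 1) (\<lambda>x. conf x ^ (DIM('a) - 2) *
     (norm (h x + (hyp_dist0 x * conf x * u x / (l\<^sup>2 * norm x)) *\<^sub>R x))\<^sup>2)" (is ?I)
proof -
  have i2: "integrable (lborel_ball 1) (\<lambda>x. conf x ^ DIM('a) * ((hyp_dist0 x)\<^sup>2 * (u x)\<^sup>2))"
    and i3: "integrable (lborel_ball 1) (\<lambda>x. conf x ^ (DIM('a) - 2) * (norm (h x))\<^sup>2)"
    using adm unfolding hyp_admissible_def by auto
  note iall = hyp_admissible_integrable[OF adm N]
  define n where "n = DIM('a) - 2"
  have n: "DIM('a) - 1 = Suc n" "DIM('a) = Suc (Suc n)" "DIM('a) - 2 = n" using N by (auto simp: n_def)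
  define f1 where "f1 x = conf x ^ (DIM('a) - 2) * (norm (h x))\<^sup>2" for x
  define f2 where "f2 x = conf x ^ DIM('a) * ((hyp_dist0 x)\<^sup>2 * (u x)\<^sup>2)" for x
  define f3 where "f3 x = 2 * (conf x ^ (DIM('a) - 1) * hyp_dist0 x * u x * (h x \<bullet> x) / norm x)" for x
  define f4 where "f4 x = conf x ^ DIM('a) * (hyp_weight x * (u x)\<^sup>2)" for x
  have fi: "integrable (lborel_ball 1) f1" "integrable (lborel_ball 1) f2"
    "integrable (lborel_ball 1) f3" "integrable (lborel_ball 1) f4"
    using i2 i3 iall(3,4) by (simp_all add: f1_def[abs_def] f2_def[abs_def] f3_def[abs_def] f4_def[abs_def])
  have "(LINT x|lborel_ball 1. f4 x + f3 x) = 0"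
    unfolding f3_def f4_def by (rule hyp_divergence_identity[OF adm N])
  then have f34: "(LINT x|lborel_ball 1. f3 x) = - (LINT x|lborel_ball 1. f4 x)"
    using fi by simp
  have eq: "conf x ^ (DIM('a) - 2) * (norm (h x + (hyp_dist0 x * conf x * u x / (l\<^sup>2 * norm x)) *\<^sub>R x))\<^sup>2
      = f1 x + f3 x / l\<^sup>2 + f2 x / l\<^sup>2 / l\<^sup>2" for x
  \<comment> \<open>At the origin \<rho> = 0 and x = 0 leave only \<open>f1\<close> on both
    sides.\<close>
  proof (cases "x = 0")
    case True
    then show ?thesis by (simp add: f1_def f2_def f3_def hyp_dist0_def)
  next
    case False
    define c where "c = hyp_dist0 x * conf x * u x / (l\<^sup>2 * norm x)"
    have "(norm (h x + c *\<^sub>R x))\<^sup>2 = (norm (h x))\<^sup>2 + 2 * c * (h x \<bullet> x) + c\<^sup>2 * (norm x)\<^sup>2"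
      unfolding power2_norm_eq_inner by (simp add: inner_add_left inner_add_right inner_commute power2_eq_square algebra_simps)
    moreover have "c\<^sup>2 * (norm x)\<^sup>2 = (hyp_dist0 x * conf x * u x / l\<^sup>2)\<^sup>2"
      using False l by (simp add: c_def power_divide power_mult_distrib)
    ultimately have "conf x ^ n * (norm (h x + c *\<^sub>R x))\<^sup>2 =
      conf x ^ n * (norm (h x))\<^sup>2 + conf x ^ n * (2 * c * (h x \<bullet> x)) + conf x ^ n * (hyp_dist0 x * conf x * u x / l\<^sup>2)\<^sup>2"
      by (simp add: algebra_simps)
    also have "conf x ^ n * (2 * c * (h x \<bullet> x)) = f3 x / l\<^sup>2"
      unfolding f3_def n(1) c_def by (simp add: mult_ac)
    also have "conf x ^ n * (hyp_dist0 x * conf x * u x / l\<^sup>2)\<^sup>2 = f2 x / l\<^sup>2 / l\<^sup>2"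
      unfolding f2_def n(2) by (simp add: power_divide power_mult_distrib power2_eq_square mult_ac)
    finally show ?thesis unfolding f1_def n(3) c_def .
  qed
  show ?I unfolding eq using fi by simp
  have "hyp_D l u h = (LINT x|lborel_ball 1. f1 x) + (LINT x|lborel_ball 1. f3 x) / l\<^sup>2 + (LINT x|lborel_ball 1. f2 x) / l\<^sup>2 / l\<^sup>2"
    unfolding hyp_D_def eq using fi by simp
  then have "l\<^sup>2 * hyp_D l u h = l\<^sup>2 * (LINT x|lborel_ball 1. f1 x) + (LINT x|lborel_ball 1. f3 x) + (LINT x|lborel_ball 1. f2 x) / l\<^sup>2"
  proof -
    have "L * (A + C / L + B / L / L) = L * A + C + B / L" if "L > 0" for L A B C :: real
      using that by (simp add: distrib_left)
    from this[of "l\<^sup>2"] l \<open>hyp_D l u h = _\<close> show ?thesis by simp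
  qed
  then show ?T unfolding f34 f1_def f2_def f4_def by simp
qed

section \<open>Stability\<close>

lemma conf_eq_cosh: "norm x < 1 \<Longrightarrow> conf x = 1 + cosh (hyp_dist0 x)"
  using cosh_rad_dist[of "norm x"] one_minus_square_pos[of "norm x"]
  by (simp add: conf_def hyp_dist0_eq field_simps)

text \<open>The sign of \<open>k\<close> is left free: a negative one gives the Gaussian, a positive
  one its reciprocal, which multiplies \<open>u\<close> in
  \<open>hyp_local_Poincare\<close>.\<close>

lemma exp_dist_square_C1:
  "C1_on (ball (0::'a::euclidean_space) 1) (\<lambda>x. exp (k * (hyp_dist0 x)\<^sup>2))
     (\<lambda>x. (2 * k * exp (k * (hyp_dist0 x)\<^sup>2) * hyp_dist0 x * conf x / norm x) *\<^sub>R x)"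
proof -
  define f where "f s = exp (k * (rad_dist s)\<^sup>2)" for s
  define f' where "f' s = 2 * k * exp (k * (rad_dist s)\<^sup>2) * rad_dist s * (2 / (1 - s\<^sup>2))" for s
  have d: "(f has_real_derivative f' s) (at s)" if "\<bar>s\<bar> < 1" for s
    unfolding f_def[abs_def] f'_def
    by (rule derivative_eq_intros rad_dist_deriv[OF that] refl)+ simp
  have rc: "continuous_on {-1<..<1} rad_dist"
    by (intro continuous_at_imp_continuous_on ballI DERIV_isCont[OF rad_dist_deriv]) auto
  have sq: "1 - t\<^sup>2 \<noteq> 0" if "t \<in> {-1<..<1}" for t :: real
    using one_minus_square_pos[of t] that by (auto simp: abs_less_iff)
  have c: "continuous_on {-1<..<1} f'"
    unfolding f'_def[abs_def] using sq by (intro continuous_intros rc) auto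
  have "f' 0 = 0" by (simp add: f'_def rad_dist_def)
  from C1_on_radial[OF d c this, where 'a='a] show ?thesis
    unfolding f_def f'_def hyp_dist0_eq[symmetric] conf_def by simp
qed

lemma hyp_gaussian_eq: "hyp_gaussian l x = exp ((- 1 / (2 * l\<^sup>2)) * (hyp_dist0 x)\<^sup>2)"
  by (simp add: hyp_gaussian_def)

lemma hyp_gaussian_C1:
  "C1_on (ball (0::'a::euclidean_space) 1) (hyp_gaussian l)
     (\<lambda>x. (- (hyp_gaussian l x * hyp_dist0 x * conf x / (l\<^sup>2 * norm x))) *\<^sub>R x)"
  using exp_dist_square_C1[of "- 1 / (2 * l\<^sup>2)", where 'a='a]
  unfolding hyp_gaussian_eq[symmetric] by (simp add: mult.assoc)

text \<open>The volume density is at most 2^N exp (N \<rho>), and the Gaussian beats it: the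
  constant comes from completing the square in (N + 1) \<rho> - \<rho>^2 / l^2, the extra \<rho>
  paying for 1 + \<rho>^2 \<le> 2 exp \<rho>. A bound yields integrability, as the Euclidean ball
  has finite measure.\<close>

lemma gaussian_weight_bounded:
  assumes l: "l > 0"
  shows "\<exists>C\<ge>0. \<forall>x::'a::euclidean_space. norm x < 1 \<longrightarrow>
    conf x ^ DIM('a) * (hyp_gaussian l x)\<^sup>2 \<le> C \<and>
    conf x ^ DIM('a) * ((hyp_dist0 x)\<^sup>2 * (hyp_gaussian l x)\<^sup>2) \<le> C"
proof -
  define N where "N = DIM('a)"
  define C where "C = 2 ^ N * 2 * exp ((real N + 1)\<^sup>2 * l\<^sup>2 / 4)"
  have main: "conf x ^ N * ((1 + (hyp_dist0 x)\<^sup>2) * (hyp_gaussian l x)\<^sup>2) \<le> C" if x: "norm x < 1" for x :: 'a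
  proof -
    define \<rho> where "\<rho> = hyp_dist0 x"
    have \<rho>: "\<rho> \<ge> 0" using hyp_dist0_nonneg[OF x] by (simp add: \<rho>_def)
    have "cosh \<rho> \<le> exp \<rho>" using \<rho> by (simp add: cosh_field_def)
    then have "conf x \<le> 2 * exp \<rho>"
      using conf_eq_cosh[OF x] one_le_exp_iff[of \<rho>] \<rho> unfolding \<rho>_def by linarith
    then have "conf x ^ N \<le> (2 * exp \<rho>) ^ N"
      using conf_ge_1[OF x] by (intro power_mono) auto
    also have "\<dots> = 2 ^ N * exp (real N * \<rho>)"
      by (simp add: power_mult_distrib exp_of_nat_mult)
    finally have 1: "conf x ^ N \<le> 2 ^ N * exp (real N * \<rho>)" .
    have 2: "1 + \<rho>\<^sup>2 \<le> 2 * exp \<rho>"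
      using exp_lower_Taylor_quadratic[OF \<rho>] \<rho> by (simp add: field_simps)
    have 3: "(hyp_gaussian l x)\<^sup>2 = exp (- (\<rho>\<^sup>2 / l\<^sup>2))"
      by (simp add: hyp_gaussian_def \<rho>_def exp_double[symmetric])
    have "conf x ^ N * ((1 + \<rho>\<^sup>2) * (hyp_gaussian l x)\<^sup>2)
      \<le> 2 ^ N * exp (real N * \<rho>) * ((2 * exp \<rho>) * exp (- (\<rho>\<^sup>2 / l\<^sup>2)))"
      unfolding 3 using 1 2 conf_ge_1[OF x] by (intro mult_mono) auto
    also have "\<dots> = 2 ^ N * 2 * exp ((real N + 1) * \<rho> - \<rho>\<^sup>2 / l\<^sup>2)"
      by (simp add: exp_add[symmetric] exp_diff exp_minus divide_inverse distrib_right)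
    also have "(real N + 1) * \<rho> - \<rho>\<^sup>2 / l\<^sup>2 \<le> (real N + 1)\<^sup>2 * l\<^sup>2 / 4"
    proof -
      have "0 \<le> (\<rho> / l - (real N + 1) * l / 2)\<^sup>2" by simp
      also have "\<dots> = \<rho>\<^sup>2 / l\<^sup>2 - (real N + 1) * \<rho> + (real N + 1)\<^sup>2 * l\<^sup>2 / 4"
        using l by (simp add: power2_diff power_divide power_mult_distrib)
      finally show ?thesis by simp
    qed
    finally show ?thesis by (simp add: C_def \<rho>_def)
  qed
  have "conf x ^ N * (hyp_gaussian l x)\<^sup>2 \<le> C \<and> conf x ^ N * ((hyp_dist0 x)\<^sup>2 * (hyp_gaussian l x)\<^sup>2) \<le> C"
    if x: "norm x < 1" for x :: 'a
  proof -
    have "0 \<le> conf x ^ N" using conf_ge_1[OF x] by simp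
    then have "conf x ^ N * (1 * (hyp_gaussian l x)\<^sup>2) \<le> conf x ^ N * ((1 + (hyp_dist0 x)\<^sup>2) * (hyp_gaussian l x)\<^sup>2)"
      "conf x ^ N * ((hyp_dist0 x)\<^sup>2 * (hyp_gaussian l x)\<^sup>2) \<le> conf x ^ N * ((1 + (hyp_dist0 x)\<^sup>2) * (hyp_gaussian l x)\<^sup>2)"
      by (intro mult_left_mono mult_right_mono; simp)+
    with main[OF x] show ?thesis by simp
  qed
  moreover have "C \<ge> 0" by (simp add: C_def)
  ultimately show ?thesis unfolding N_def by blast
qed

lemma integrable_lborel_ball_const: "integrable (lborel_ball r :: 'a::euclidean_space measure) (\<lambda>x. c::real)"
proof -
  have "integrable lborel (\<lambda>x::'a. indicat_real (ball 0 r) x *\<^sub>R c)"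
    using emeasure_lborel_ball_finite[of "0::'a" r]
    by (intro integrable_scaleR_left) (auto simp: integrable_indicator_iff)
  then show ?thesis by (subst integrable_restrict_space) auto
qed

lemma hyp_admissible_diff_gaussian:
  fixes u :: "'a::euclidean_space \<Rightarrow> real" and c :: real
  assumes adm: "hyp_admissible u h" and N: "DIM('a) \<ge> 2" and l: "l > 0"
  defines "h' \<equiv> \<lambda>x. h x + (c * hyp_gaussian l x * hyp_dist0 x * conf x / (l\<^sup>2 * norm x)) *\<^sub>R x"
  shows "hyp_admissible (\<lambda>x. u x - c * hyp_gaussian l x) h'" (is ?A)
    and "hyp_D l (\<lambda>x. u x - c * hyp_gaussian l x) h' = hyp_D l u h" (is ?B)
proof -
  have um[measurable]: "u \<in> borel_measurable borel" and hm[measurable]: "h \<in> borel_measurable borel"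
    and ga: "\<And>r. r < 1 \<Longrightarrow> grad_approx r u h"
    and i1: "integrable (lborel_ball 1) (\<lambda>x. conf x ^ DIM('a) * (u x)\<^sup>2)"
    and i2: "integrable (lborel_ball 1) (\<lambda>x. conf x ^ DIM('a) * ((hyp_dist0 x)\<^sup>2 * (u x)\<^sup>2))"
    and i3: "integrable (lborel_ball 1) (\<lambda>x. conf x ^ (DIM('a) - 2) * (norm (h x))\<^sup>2)"
    using adm unfolding hyp_admissible_def by auto
  obtain C where C: "C \<ge> 0" "\<And>x::'a. norm x < 1 \<Longrightarrow> conf x ^ DIM('a) * (hyp_gaussian l x)\<^sup>2 \<le> C"
    "\<And>x::'a. norm x < 1 \<Longrightarrow> conf x ^ DIM('a) * ((hyp_dist0 x)\<^sup>2 * (hyp_gaussian l x)\<^sup>2) \<le> C"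
    using gaussian_weight_bounded[OF l, where 'a='a] by blast
  define v where "v x = u x - c * hyp_gaussian l x" for x
  have vm[measurable]: "v \<in> borel_measurable borel" unfolding v_def[abs_def] by measurable
  have h'm[measurable]: "h' \<in> borel_measurable borel" unfolding h'_def by measurable
  have gav: "grad_approx r v h'" if "r < 1" for r
  proof -
    have one: "C1_on (ball 0 1) (\<lambda>x::'a. 1) (\<lambda>x. 0)" by (rule C1_on_const)
    have g: "C1_on (ball (0::'a) 1) (\<lambda>x. - c * hyp_gaussian l x)
      (\<lambda>x. (- c) *\<^sub>R ((- (hyp_gaussian l x * hyp_dist0 x * conf x / (l\<^sup>2 * norm x))) *\<^sub>R x) + hyp_gaussian l x *\<^sub>R 0)"
      by (rule C1_on_mult[OF C1_on_const hyp_gaussian_C1])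
    have "(\<lambda>x. 1 *\<^sub>R h x + u x *\<^sub>R 0 + ((- c) *\<^sub>R ((- (hyp_gaussian l x * hyp_dist0 x * conf x / (l\<^sup>2 * norm x))) *\<^sub>R x) + hyp_gaussian l x *\<^sub>R 0)) = h'"
      by (simp add: h'_def mult.assoc)
    moreover have "(\<lambda>x. 1 * u x + - c * hyp_gaussian l x) = v"
      by (simp add: v_def[abs_def])
    ultimately show ?thesis
      using grad_approx_affine[OF ga[OF that] that um hm one g] by simp
  qed
  have sq: "(a - b)\<^sup>2 \<le> 2 * a\<^sup>2 + 2 * b\<^sup>2" for a b :: real
    using norm_add_square_le[of a "- b"] by simp
  have j1: "integrable (lborel_ball 1) (\<lambda>x. 2 * (conf x ^ DIM('a) * (u x)\<^sup>2) + 2 * c\<^sup>2 * C)"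
    using i1 integrable_lborel_ball_const by (intro Bochner_Integration.integrable_add) auto
  have v1: "integrable (lborel_ball 1) (\<lambda>x. conf x ^ DIM('a) * (v x)\<^sup>2)"
  proof (rule integrable_lborel_ball_bound[OF j1])
    fix x :: 'a assume x: "norm x < 1"
    have p0: "0 \<le> conf x ^ DIM('a)" using conf_ge_1[OF x] by simp
    have "conf x ^ DIM('a) * (v x)\<^sup>2 \<le> conf x ^ DIM('a) * (2 * (u x)\<^sup>2 + 2 * (c * hyp_gaussian l x)\<^sup>2)"
      unfolding v_def using p0 by (intro mult_left_mono sq) 
    also have "\<dots> = 2 * (conf x ^ DIM('a) * (u x)\<^sup>2) + 2 * c\<^sup>2 * (conf x ^ DIM('a) * (hyp_gaussian l x)\<^sup>2)"
      by (simp add: power_mult_distrib algebra_simps)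
    also have "\<dots> \<le> 2 * (conf x ^ DIM('a) * (u x)\<^sup>2) + 2 * c\<^sup>2 * C"
      using C(2)[OF x] by (intro add_left_mono mult_left_mono) auto
    finally have "conf x ^ DIM('a) * (v x)\<^sup>2 \<le> \<dots>" .
    moreover have "0 \<le> conf x ^ DIM('a) * (v x)\<^sup>2" using p0 by simp
    ultimately show "\<bar>conf x ^ DIM('a) * (v x)\<^sup>2\<bar> \<le> 2 * (conf x ^ DIM('a) * (u x)\<^sup>2) + 2 * c\<^sup>2 * C"
      by linarith
  qed measurable
  have j2: "integrable (lborel_ball 1) (\<lambda>x. 2 * (conf x ^ DIM('a) * ((hyp_dist0 x)\<^sup>2 * (u x)\<^sup>2)) + 2 * c\<^sup>2 * C)"
    using i2 integrable_lborel_ball_const by (intro Bochner_Integration.integrable_add) auto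
  have v2: "integrable (lborel_ball 1) (\<lambda>x. conf x ^ DIM('a) * ((hyp_dist0 x)\<^sup>2 * (v x)\<^sup>2))"
  proof (rule integrable_lborel_ball_bound[OF j2])
    fix x :: 'a assume x: "norm x < 1"
    have p0: "0 \<le> conf x ^ DIM('a)" using conf_ge_1[OF x] by simp
    have "conf x ^ DIM('a) * ((hyp_dist0 x)\<^sup>2 * (v x)\<^sup>2) \<le> conf x ^ DIM('a) * ((hyp_dist0 x)\<^sup>2 * (2 * (u x)\<^sup>2 + 2 * (c * hyp_gaussian l x)\<^sup>2))"
      unfolding v_def using p0 by (intro mult_left_mono sq) auto
    also have "\<dots> = 2 * (conf x ^ DIM('a) * ((hyp_dist0 x)\<^sup>2 * (u x)\<^sup>2)) + 2 * c\<^sup>2 * (conf x ^ DIM('a) * ((hyp_dist0 x)\<^sup>2 * (hyp_gaussian l x)\<^sup>2))"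
      by (simp add: power_mult_distrib algebra_simps)
    also have "\<dots> \<le> 2 * (conf x ^ DIM('a) * ((hyp_dist0 x)\<^sup>2 * (u x)\<^sup>2)) + 2 * c\<^sup>2 * C"
      using C(3)[OF x] by (intro add_left_mono mult_left_mono) auto
    finally have "conf x ^ DIM('a) * ((hyp_dist0 x)\<^sup>2 * (v x)\<^sup>2) \<le> \<dots>" .
    moreover have "0 \<le> conf x ^ DIM('a) * ((hyp_dist0 x)\<^sup>2 * (v x)\<^sup>2)" using p0 by simp
    ultimately show "\<bar>conf x ^ DIM('a) * ((hyp_dist0 x)\<^sup>2 * (v x)\<^sup>2)\<bar> \<le> 2 * (conf x ^ DIM('a) * ((hyp_dist0 x)\<^sup>2 * (u x)\<^sup>2)) + 2 * c\<^sup>2 * C"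
      by linarith
  qed measurable
  define n where "n = DIM('a) - 2"
  have n: "DIM('a) = Suc (Suc n)" "DIM('a) - 2 = n" using N by (auto simp: n_def)
  have j3: "integrable (lborel_ball 1) (\<lambda>x. 2 * (conf x ^ (DIM('a) - 2) * (norm (h x))\<^sup>2) + 2 * (c / l\<^sup>2)\<^sup>2 * C)"
    using i3 integrable_lborel_ball_const by (intro Bochner_Integration.integrable_add) auto
  have v3: "integrable (lborel_ball 1) (\<lambda>x. conf x ^ (DIM('a) - 2) * (norm (h' x))\<^sup>2)"
  proof (rule integrable_lborel_ball_bound[OF j3])
    fix x :: 'a assume x: "norm x < 1"
    have p0: "0 \<le> conf x ^ n" using conf_ge_1[OF x] by simp
    define E where "E = (c * hyp_gaussian l x * hyp_dist0 x * conf x / (l\<^sup>2 * norm x)) *\<^sub>R x"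
    have E: "(norm E)\<^sup>2 = (c / l\<^sup>2)\<^sup>2 * (conf x)\<^sup>2 * ((hyp_dist0 x)\<^sup>2 * (hyp_gaussian l x)\<^sup>2)"
      by (cases "x = 0") (simp_all add: E_def power_divide power_mult_distrib hyp_dist0_def)
    \<comment> \<open>The gradient of the Gaussian is -\<rho> g \<nabla>\<rho> / l^2, so its energy
      density is a multiple of its moment density.\<close>
    have cE: "conf x ^ n * (norm E)\<^sup>2 = (c / l\<^sup>2)\<^sup>2 * (conf x ^ DIM('a) * ((hyp_dist0 x)\<^sup>2 * (hyp_gaussian l x)\<^sup>2))"
      unfolding E n(1) by (simp add: power2_eq_square mult_ac)
    have "conf x ^ n * (norm (h' x))\<^sup>2 \<le> conf x ^ n * (2 * (norm (h x))\<^sup>2 + 2 * (norm E)\<^sup>2)"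
      unfolding h'_def E_def[symmetric] using p0 by (intro mult_left_mono norm_add_square_le)
    also have "\<dots> = 2 * (conf x ^ n * (norm (h x))\<^sup>2) + 2 * (conf x ^ n * (norm E)\<^sup>2)"
      by (simp add: algebra_simps)
    also have "\<dots> \<le> 2 * (conf x ^ n * (norm (h x))\<^sup>2) + 2 * ((c / l\<^sup>2)\<^sup>2 * C)"
      unfolding cE using C(3)[OF x] by (intro add_left_mono mult_left_mono) auto
    finally have "conf x ^ n * (norm (h' x))\<^sup>2 \<le> 2 * (conf x ^ n * (norm (h x))\<^sup>2) + 2 * (c / l\<^sup>2)\<^sup>2 * C"
      by (simp only: mult.assoc)
    moreover have "0 \<le> conf x ^ n * (norm (h' x))\<^sup>2" using p0 by simp
    ultimately show "\<bar>conf x ^ (DIM('a) - 2) * (norm (h' x))\<^sup>2\<bar> \<le> 2 * (conf x ^ (DIM('a) - 2) * (norm (h x))\<^sup>2) + 2 * (c / l\<^sup>2)\<^sup>2 * C"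
      unfolding n(2) by linarith
  qed measurable
  have "hyp_admissible v h'"
    unfolding hyp_admissible_def using vm h'm gav v1 v2 v3 by blast
  then show ?A by (simp add: v_def[abs_def])
  have "h' x + (hyp_dist0 x * conf x * (u x - c * hyp_gaussian l x) / (l\<^sup>2 * norm x)) *\<^sub>R x
      = h x + (hyp_dist0 x * conf x * u x / (l\<^sup>2 * norm x)) *\<^sub>R x" for x
    unfolding h'_def by (simp add: add.assoc scaleR_left_distrib[symmetric] add_divide_distrib[symmetric] algebra_simps)
  then show ?B by (simp add: hyp_D_def)
qed

text \<open>The gradient of u / g is 1 / g times the vector squared in \<open>hyp_D\<close>, and 1 /
  g^2 \<le> exp (R^2) on the ball. The metric drops out through \<open>conf x ^ (N - 2)\<close>
  \<ge> 1 in the energy and \<open>conf x ^ N\<close> \<le> P in the mass. The remaining constant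
  and the l^2 are those of \<open>Poincare_ball\<close>, by r \<le> l R.\<close>

lemma hyp_local_Poincare:
  fixes u :: "'a::euclidean_space \<Rightarrow> real"
  assumes adm: "hyp_admissible u h" and N: "DIM('a) \<ge> 2" and l: "0 < l" "l \<le> \<beta>" and R: "R > 0" and \<delta>: "\<delta> > 0"
  defines "P \<equiv> (1 + cosh (\<beta> * R)) ^ DIM('a)"
  shows "\<exists>c. (LINT x|lborel_ball 1. conf x ^ DIM('a) * (if hyp_dist0 x < l * R then (u x - c * hyp_gaussian l x)\<^sup>2 else 0))
    \<le> P * (16 * R\<^sup>2 * 2 ^ DIM('a) * exp (R\<^sup>2)) * (l\<^sup>2 * hyp_D l u h) + P * \<delta>"
proof -
  have um[measurable]: "u \<in> borel_measurable borel" and hm[measurable]: "h \<in> borel_measurable borel"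
    and ga: "\<And>r. r < 1 \<Longrightarrow> grad_approx r u h"
    using adm unfolding hyp_admissible_def by auto
  \<comment> \<open>The Euclidean radius tanh (l R / 2) of the ball \<rho> < l R.\<close>
  define r where "r = (exp (l * R) - 1) / (exp (l * R) + 1)"
  have e: "exp (l * R) > 1" using l R by simp
  have E: "0 < (E - 1) / (E + 1)" "(E - 1) / (E + 1) < 1" "(1 + (E - 1) / (E + 1)) / (1 - (E - 1) / (E + 1)) = E"
    if "E > 1" for E :: real
    using that by (simp_all add: field_simps)
  have r: "0 < r" "r < 1" unfolding r_def by (rule E[OF e])+
  have rr: "rad_dist r = l * R"
  proof -
    have "(1 + r) / (1 - r) = exp (l * R)" unfolding r_def by (rule E[OF e])
    then show ?thesis by (simp add: rad_dist_def)
  qed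
  have rle: "r \<le> l * R" using rad_dist_ge[of r] r rr by simp
  have mono: "rad_dist s < rad_dist t \<longleftrightarrow> s < t" if "0 \<le> s" "s < 1" "0 \<le> t" "t < 1" for s t
  proof -
    have "rad_dist s < rad_dist t \<longleftrightarrow> (1 + s) / (1 - s) < (1 + t) / (1 - t)"
      unfolding rad_dist_def using that by (intro ln_less_cancel_iff) auto
    also have "\<dots> \<longleftrightarrow> s < t" using that by (simp add: frac_less_eq divide_simps) (simp add: algebra_simps)
    finally show ?thesis .
  qed
  have ball: "hyp_dist0 x < l * R \<longleftrightarrow> x \<in> ball 0 r" if "norm x < 1" for x :: 'a
    using mono[of "norm x" r] that r by (simp add: hyp_dist0_eq rr)
  define G where "G x = exp ((1 / (2 * l\<^sup>2)) * (hyp_dist0 x)\<^sup>2)" for x :: 'a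
  define G' where "G' x = (2 * (1 / (2 * l\<^sup>2)) * G x * hyp_dist0 x * conf x / norm x) *\<^sub>R x" for x :: 'a
  have GC1: "C1_on (ball 0 1) G G'"
    using exp_dist_square_C1[of "1 / (2 * l\<^sup>2)", where 'a='a] by (simp only: G_def[abs_def] G'_def[abs_def])
  have gG: "hyp_gaussian l x * G x = 1" for x :: 'a
    by (simp add: G_def hyp_gaussian_def exp_add[symmetric])
  define k where "k x = G x *\<^sub>R (h x + (hyp_dist0 x * conf x * u x / (l\<^sup>2 * norm x)) *\<^sub>R x)" for x
  have "(\<lambda>x. G x *\<^sub>R h x + u x *\<^sub>R G' x + 0) = k"
    by (auto simp: k_def G'_def scaleR_add_right mult_ac)
  moreover have "(\<lambda>x. G x * u x + 0) = (\<lambda>x. G x * u x)" by simp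
  ultimately have gav: "grad_approx r (\<lambda>x. G x * u x) k"
    using grad_approx_affine[OF ga[OF r(2)] r(2) um hm GC1 C1_on_const[of _ 0]] by simp
  have [measurable]: "G \<in> borel_measurable borel" unfolding G_def[abs_def] by measurable
  have vm: "(\<lambda>x. G x * u x) \<in> borel_measurable borel" by measurable
  have km[measurable]: "k \<in> borel_measurable borel" unfolding k_def[abs_def] by measurable
  let ?d = "\<lambda>x. conf x ^ (DIM('a) - 2) * (norm (h x + (hyp_dist0 x * conf x * u x / (l\<^sup>2 * norm x)) *\<^sub>R x))\<^sup>2"
  have di: "integrable (lborel_ball 1) ?d" by (rule hyp_D_expand(2)[OF adm N l(1)])
  define d1 where "d1 x = indicat_real (ball 0 1) x * ?d x" for x
  have d1i: "integrable lborel d1" and d1I: "(LINT x|lborel. d1 x) = hyp_D l u h"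
    using di by (simp_all add: integrable_restrict_space integral_restrict_space hyp_D_def d1_def[abs_def])
  have d10: "0 \<le> d1 x" for x
    using conf_ge_1[of x] by (auto simp: d1_def indicator_def)
  have d1r: "integrable (lborel_ball r) d1" "(LINT x|lborel_ball r. d1 x) \<le> hyp_D l u h"
    using integrable_lborel_ball[OF d1i] integral_lborel_ball_mono[OF d1i d10, of r] d1I by auto
  have kle: "(norm (k x))\<^sup>2 \<le> exp (R\<^sup>2) * d1 x" if x: "x \<in> ball 0 r" for x
  proof -
    have x1: "norm x < 1" using x r by simp
    have \<rho>: "0 \<le> hyp_dist0 x" "hyp_dist0 x \<le> l * R"
      using hyp_dist0_nonneg[OF x1] ball[OF x1] x by auto
    have "(hyp_dist0 x)\<^sup>2 / l\<^sup>2 \<le> (l * R)\<^sup>2 / l\<^sup>2"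
      using \<rho> by (intro divide_right_mono power_mono) auto
    then have "(hyp_dist0 x)\<^sup>2 / l\<^sup>2 \<le> R\<^sup>2" using l by (simp add: power_mult_distrib)
    then have G2: "(G x)\<^sup>2 \<le> exp (R\<^sup>2)"
      by (simp add: G_def exp_double[symmetric])
    define z where "z = h x + (hyp_dist0 x * conf x * u x / (l\<^sup>2 * norm x)) *\<^sub>R x"
    have "(norm (k x))\<^sup>2 = (G x)\<^sup>2 * (1 * (norm z)\<^sup>2)"
      by (simp add: k_def z_def power_mult_distrib)
    also have "\<dots> \<le> exp (R\<^sup>2) * (conf x ^ (DIM('a) - 2) * (norm z)\<^sup>2)"
      using G2 conf_ge_1[OF x1] by (intro mult_mono) auto
    also have "\<dots> = exp (R\<^sup>2) * d1 x"
      using x1 by (simp add: d1_def z_def)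
    finally show ?thesis .
  qed
  have k2: "integrable (lborel_ball r) (\<lambda>x. (norm (k x))\<^sup>2)"
    by (rule integrable_lborel_ball_bound[of _ "\<lambda>x. exp (R\<^sup>2) * d1 x"])
       (use d1r(1) kle in simp_all)
  have "(LINT x|lborel_ball r. (norm (k x))\<^sup>2) \<le> (LINT x|lborel_ball r. exp (R\<^sup>2) * d1 x)"
    using kle d1r by (intro integral_mono[OF k2]) (auto simp: space_restrict_space)
  also have "\<dots> \<le> exp (R\<^sup>2) * hyp_D l u h" using d1r by simp
  finally have kI: "(LINT x|lborel_ball r. (norm (k x))\<^sup>2) \<le> exp (R\<^sup>2) * hyp_D l u h" .
  obtain c where c: "integrable (lborel_ball r) (\<lambda>x. (G x * u x - c)\<^sup>2)"
    "(LINT x|lborel_ball r. (G x * u x - c)\<^sup>2) \<le> 4 * ((2 * r)\<^sup>2 * 2 ^ DIM('a)) * (LINT x|lborel_ball r. (norm (k x))\<^sup>2) + \<delta>"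
    using Poincare_ball[OF gav r(1) \<delta> vm km k2] by blast
  have P0: "P \<ge> 0" unfolding P_def by (intro zero_le_power add_nonneg_nonneg) auto
  have D0: "hyp_D l u h \<ge> 0" using d1I Bochner_Integration.integral_nonneg[of lborel d1] d10 by simp
  have vI: "(LINT x|lborel_ball r. (G x * u x - c)\<^sup>2) \<le> 16 * R\<^sup>2 * 2 ^ DIM('a) * exp (R\<^sup>2) * (l\<^sup>2 * hyp_D l u h) + \<delta>"
  proof -
    have "r\<^sup>2 \<le> (l * R)\<^sup>2" using r rle by (intro power_mono) auto
    then have A: "4 * ((2 * r)\<^sup>2 * 2 ^ DIM('a)) \<le> 16 * (l * R)\<^sup>2 * 2 ^ DIM('a)"
      by (simp add: power_mult_distrib)
    have "4 * ((2 * r)\<^sup>2 * 2 ^ DIM('a)) * (LINT x|lborel_ball r. (norm (k x))\<^sup>2)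
      \<le> 16 * (l * R)\<^sup>2 * 2 ^ DIM('a) * (exp (R\<^sup>2) * hyp_D l u h)"
      by (rule mult_mono[OF A kI]) auto
    also have "\<dots> = 16 * R\<^sup>2 * 2 ^ DIM('a) * exp (R\<^sup>2) * (l\<^sup>2 * hyp_D l u h)"
      by (simp add: power_mult_distrib mult_ac)
    finally show ?thesis using c(2) by linarith
  qed
  have "(LINT x|lborel_ball 1. conf x ^ DIM('a) * (if hyp_dist0 x < l * R then (u x - c * hyp_gaussian l x)\<^sup>2 else 0))
    = (LINT x|lborel. indicat_real (ball 0 1) x *\<^sub>R (conf x ^ DIM('a) * (if hyp_dist0 x < l * R then (u x - c * hyp_gaussian l x)\<^sup>2 else 0)))"
    by (rule integral_restrict_space) simp
  also have "\<dots> \<le> (LINT x|lborel. P * (indicat_real (ball 0 r) x * (G x * u x - c)\<^sup>2))"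
  proof (rule integral_mono')
    show "integrable lborel (\<lambda>x. P * (indicat_real (ball 0 r) x * (G x * u x - c)\<^sup>2))"
      using c(1) by (simp add: integrable_restrict_space)
  next
    fix x :: 'a
    show "0 \<le> P * (indicat_real (ball 0 r) x * (G x * u x - c)\<^sup>2)"
      using P0 by simp
    show "indicat_real (ball 0 1) x *\<^sub>R (conf x ^ DIM('a) * (if hyp_dist0 x < l * R then (u x - c * hyp_gaussian l x)\<^sup>2 else 0))
      \<le> P * (indicat_real (ball 0 r) x * (G x * u x - c)\<^sup>2)"
    proof (cases "norm x < 1 \<and> hyp_dist0 x < l * R")
      case True
      then have x: "norm x < 1" "x \<in> ball 0 r" "hyp_dist0 x < l * R" using ball by auto
      define g where "g = hyp_gaussian l x"
      have g: "0 \<le> g" "g \<le> 1" by (auto simp: g_def hyp_gaussian_def)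
      have "u x - c * g = g * (G x * u x - c)"
        using gG[of x] by (simp add: g_def algebra_simps)
      then have "(u x - c * g)\<^sup>2 = g\<^sup>2 * (G x * u x - c)\<^sup>2" by (simp add: power_mult_distrib)
      also have "\<dots> \<le> 1 * (G x * u x - c)\<^sup>2"
        using g by (intro mult_right_mono) (auto simp: power_le_one)
      finally have 1: "(u x - c * g)\<^sup>2 \<le> (G x * u x - c)\<^sup>2" by simp
      have "l * R \<le> \<beta> * R" using l R by simp
      then have "cosh (hyp_dist0 x) \<le> cosh (\<beta> * R)"
        using hyp_dist0_nonneg[OF x(1)] x(3) by (subst cosh_real_nonneg_le_iff) auto
      then have "conf x ^ DIM('a) \<le> P"
        unfolding P_def using conf_eq_cosh[OF x(1)] conf_ge_1[OF x(1)] by (intro power_mono) auto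
      then have "conf x ^ DIM('a) * (u x - c * g)\<^sup>2 \<le> P * (G x * u x - c)\<^sup>2"
        using 1 P0 by (intro mult_mono) auto
      then show ?thesis using x by (simp add: g_def)
    next
      case False
      then show ?thesis using P0 by auto
    qed
  qed
  also have "\<dots> = P * (LINT x|lborel_ball r. (G x * u x - c)\<^sup>2)"
    by (simp add: integral_restrict_space)
  also have "\<dots> \<le> P * (16 * R\<^sup>2 * 2 ^ DIM('a) * exp (R\<^sup>2) * (l\<^sup>2 * hyp_D l u h) + \<delta>)"
    using vI P0 by (intro mult_left_mono)
  also have "\<dots> = P * (16 * R\<^sup>2 * 2 ^ DIM('a) * exp (R\<^sup>2)) * (l\<^sup>2 * hyp_D l u h) + P * \<delta>"
    by (simp add: algebra_simps)
  finally show ?thesis by blast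
qed

theorem hyp_stability:
  assumes N: "DIM('a::euclidean_space) \<ge> 2" and \<beta>: "\<beta> > 0"
  shows "\<exists>K>0. \<forall>(u :: 'a \<Rightarrow> real) h l. hyp_admissible u h \<and> 0 < l \<and> l \<le> \<beta> \<longrightarrow>
    (\<forall>\<delta>>0. \<exists>c. K * (LINT x|lborel_ball 1. conf x ^ DIM('a) * (u x - c * hyp_gaussian l x)\<^sup>2)
       \<le> l\<^sup>2 * hyp_D l u h + \<delta>)"
proof -
  define m where "m = real DIM('a) - 1"
  have m: "m \<ge> 1" using N by (simp add: m_def)
  \<comment> \<open>For y = \<rho> / l \<ge> R this gives y^2 \<ge> R y \<ge> m \<beta> y + N + 1,
    which exceeds the weight by at least 1.\<close>
  define R where "R = m * \<beta> + real DIM('a) + 1"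
  have mb: "0 \<le> m * \<beta>" using m \<beta> by simp
  have R: "R \<ge> 1" using mb by (simp add: R_def)
  \<comment> \<open>Bounds the weight on the inner ball, where \<rho> < l R \<le> \<beta> R.\<close>
  define M where "M = real DIM('a) + m * (\<beta> * R)"
  have M: "M \<ge> 0" using m \<beta> R by (simp add: M_def)
  define P where "P = (1 + cosh (\<beta> * R)) ^ DIM('a)"
  have P: "P \<ge> 0" unfolding P_def by (intro zero_le_power add_nonneg_nonneg) auto
  define C where "C = P * (16 * R\<^sup>2 * 2 ^ DIM('a) * exp (R\<^sup>2))"
  have C: "C \<ge> 0" using P by (simp add: C_def)
  \<comment> \<open>The reciprocal of the factor of l^2 \<open>hyp_D\<close> in the final estimate:
    1 from the divergence identity, (M + 1) C from the inner ball.\<close>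
  define K where "K = 1 / (1 + (M + 1) * C)"
  have den: "1 + (M + 1) * C \<ge> 1" using M C by simp
  then have K: "K > 0" "K \<le> 1" "K * (1 + (M + 1) * C) = 1" by (simp_all add: K_def)
  show ?thesis
  proof (rule exI[of _ K], intro conjI K(1) allI impI, elim conjE)
    fix u :: "'a \<Rightarrow> real" and h l and \<delta> :: real
    assume adm: "hyp_admissible u h" and l: "0 < l" "l \<le> \<beta>" and \<delta>: "\<delta> > 0"
    have l2: "l\<^sup>2 > 0" using l by simp
    \<comment> \<open>The Poincare error is later multiplied by P and by M + 1; the added 1 keeps
      the denominator positive.\<close>
    define \<delta>' where "\<delta>' = \<delta> / ((M + 1) * P + 1)"
    have d': "\<delta>' > 0" "(M + 1) * (P * \<delta>') \<le> \<delta>"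
    proof -
      have pos: "(M + 1) * P + 1 > 0" using M P by (simp add: add_nonneg_pos)
      then show "\<delta>' > 0" using \<delta> by (simp add: \<delta>'_def)
      have "(M + 1) * (P * \<delta>') = \<delta> * ((M + 1) * P / ((M + 1) * P + 1))" by (simp add: \<delta>'_def)
      also have "\<dots> \<le> \<delta> * 1" using pos \<delta> by (intro mult_left_mono) (auto simp: pos_divide_le_eq)
      finally show "(M + 1) * (P * \<delta>') \<le> \<delta>" by simp
    qed
    have R0: "R > 0" using R by simp
    obtain c where c: "(LINT x|lborel_ball 1. conf x ^ DIM('a) * (if hyp_dist0 x < l * R then (u x - c * hyp_gaussian l x)\<^sup>2 else 0))
        \<le> C * (l\<^sup>2 * hyp_D l u h) + P * \<delta>'"
      using hyp_local_Poincare[OF adm N l R0 d'(1)] unfolding C_def P_def by blast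
    define v where "v x = u x - c * hyp_gaussian l x" for x
    define h' where "h' x = h x + (c * hyp_gaussian l x * hyp_dist0 x * conf x / (l\<^sup>2 * norm x)) *\<^sub>R x" for x
    have admv: "hyp_admissible v h'" and Dv: "hyp_D l v h' = hyp_D l u h"
      using hyp_admissible_diff_gaussian[OF adm N l(1), of c] by (simp_all add: v_def[abs_def] h'_def[abs_def])
    have vm[measurable]: "v \<in> borel_measurable borel"
      and i1: "integrable (lborel_ball 1) (\<lambda>x. conf x ^ DIM('a) * (v x)\<^sup>2)"
      and i2: "integrable (lborel_ball 1) (\<lambda>x. conf x ^ DIM('a) * ((hyp_dist0 x)\<^sup>2 * (v x)\<^sup>2))"
      using admv unfolding hyp_admissible_def by auto
    have i3: "integrable (lborel_ball 1) (\<lambda>x. conf x ^ DIM('a) * (hyp_weight x * (v x)\<^sup>2))"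
      by (rule hyp_admissible_integrable(3)[OF admv N])
    let ?T = "\<lambda>x. conf x ^ DIM('a) * (if hyp_dist0 x < l * R then (v x)\<^sup>2 else 0)"
    have iT: "integrable (lborel_ball 1) ?T"
    proof (rule integrable_lborel_ball_bound[OF i1])
      fix x :: 'a assume "norm x < 1"
      from conf_ge_1[OF this] show "\<bar>?T x\<bar> \<le> conf x ^ DIM('a) * (v x)\<^sup>2" by simp
    qed measurable
    have A0: "0 \<le> (LINT x|lborel_ball 1. conf x ^ (DIM('a) - 2) * (norm (h' x))\<^sup>2)"
    proof (rule integral_nonneg_AE, rule AE_I2)
      fix x :: 'a assume "x \<in> space (lborel_ball 1)"
      then have "conf x \<ge> 1" by (intro conf_ge_1) (simp add: space_restrict_space)
      then show "0 \<le> conf x ^ (DIM('a) - 2) * (norm (h' x))\<^sup>2" by simp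
    qed
    \<comment> \<open>Outside the inner ball the quadratic term wins; inside it, M + 1 makes up for
      the weight.\<close>
    have key: "1 \<le> (hyp_dist0 x)\<^sup>2 / l\<^sup>2 - hyp_weight x + (M + 1) * (if hyp_dist0 x < l * R then 1 else 0)"
      if x: "norm x < 1" for x :: 'a
    proof -
      have w: "hyp_weight x \<le> real DIM('a) + m * hyp_dist0 x"
        using hyp_weight_bounds[OF x] by (simp add: m_def)
      have r0: "hyp_dist0 x \<ge> 0" by (rule hyp_dist0_nonneg[OF x])
      show ?thesis
      proof (cases "hyp_dist0 x < l * R")
        case True
        have "hyp_dist0 x \<le> \<beta> * R"
          using True mult_right_mono[OF l(2), of R] R0 by linarith
        then have "m * hyp_dist0 x \<le> m * (\<beta> * R)" using m by (intro mult_left_mono) auto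
        then have "hyp_weight x \<le> M" using w by (simp add: M_def)
        moreover have "0 \<le> (hyp_dist0 x)\<^sup>2 / l\<^sup>2" by simp
        ultimately show ?thesis using True by simp
      next
        case False
        define y where "y = hyp_dist0 x / l"
        have y: "y \<ge> R" using False l(1) by (simp add: y_def pos_le_divide_eq mult.commute)
        have \<rho>: "hyp_dist0 x = l * y" using l by (simp add: y_def)
        have "l * y \<le> \<beta> * y" using l(2) y R by (intro mult_right_mono) auto
        then have "m * hyp_dist0 x \<le> m * (\<beta> * y)" unfolding \<rho> using m by (intro mult_left_mono) auto
        then have 1: "hyp_weight x \<le> real DIM('a) + m * \<beta> * y" using w by (simp add: mult.assoc)
        have "R * y \<le> y * y" using y R by (intro mult_right_mono) auto
        moreover have "m * \<beta> * y + (real DIM('a) + 1) * 1 \<le> m * \<beta> * y + (real DIM('a) + 1) * y"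
          using y R by (intro add_left_mono mult_left_mono) auto
        moreover have "m * \<beta> * y + (real DIM('a) + 1) * y = R * y" by (simp add: R_def algebra_simps)
        ultimately have "m * \<beta> * y + (real DIM('a) + 1) \<le> y\<^sup>2"
          unfolding power2_eq_square by (metis mult.right_neutral order_trans)
        moreover have "(hyp_dist0 x)\<^sup>2 / l\<^sup>2 = y\<^sup>2" by (simp add: y_def power_divide)
        ultimately show ?thesis using 1 False by simp
      qed
    qed
    let ?V = "LINT x|lborel_ball 1. conf x ^ DIM('a) * (v x)\<^sup>2"
    let ?B = "LINT x|lborel_ball 1. conf x ^ DIM('a) * ((hyp_dist0 x)\<^sup>2 * (v x)\<^sup>2)"
    let ?W = "LINT x|lborel_ball 1. conf x ^ DIM('a) * (hyp_weight x * (v x)\<^sup>2)"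
    have ir: "integrable (lborel_ball 1) (\<lambda>x. conf x ^ DIM('a) * ((hyp_dist0 x)\<^sup>2 * (v x)\<^sup>2) / l\<^sup>2
        - conf x ^ DIM('a) * (hyp_weight x * (v x)\<^sup>2) + (M + 1) * ?T x)"
      by (intro Bochner_Integration.integrable_add Bochner_Integration.integrable_diff
          integrable_divide_zero integrable_mult_right i2 i3 iT)
    have "?V \<le> (LINT x|lborel_ball 1. conf x ^ DIM('a) * ((hyp_dist0 x)\<^sup>2 * (v x)\<^sup>2) / l\<^sup>2
        - conf x ^ DIM('a) * (hyp_weight x * (v x)\<^sup>2) + (M + 1) * ?T x)"
    proof (rule integral_mono[OF i1 ir])
      fix x :: 'a assume "x \<in> space (lborel_ball 1)"
      then have x: "norm x < 1" by (simp add: space_restrict_space)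
      have "0 \<le> conf x ^ DIM('a) * (v x)\<^sup>2" using conf_ge_1[OF x] by simp
      from mult_left_mono[OF key[OF x] this]
      have "conf x ^ DIM('a) * (v x)\<^sup>2 \<le> conf x ^ DIM('a) * (v x)\<^sup>2 *
        ((hyp_dist0 x)\<^sup>2 / l\<^sup>2 - hyp_weight x + (M + 1) * (if hyp_dist0 x < l * R then 1 else 0))" by simp
      also have "\<dots> = conf x ^ DIM('a) * ((hyp_dist0 x)\<^sup>2 * (v x)\<^sup>2) / l\<^sup>2
        - conf x ^ DIM('a) * (hyp_weight x * (v x)\<^sup>2) + (M + 1) * ?T x"
        by (cases "hyp_dist0 x < l * R") (simp_all add: algebra_simps)
      finally show "conf x ^ DIM('a) * (v x)\<^sup>2 \<le> \<dots>" .
    qed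
    also have "\<dots> = ?B / l\<^sup>2 - ?W + (M + 1) * integral\<^sup>L (lborel_ball 1) ?T"
    proof -
      have "integral\<^sup>L (lborel_ball 1) (\<lambda>x. f x / L - g x + q * t x)
        = integral\<^sup>L (lborel_ball 1) f / L - integral\<^sup>L (lborel_ball 1) g + q * integral\<^sup>L (lborel_ball 1) t"
        if "integrable (lborel_ball 1) f" "integrable (lborel_ball 1) g" "integrable (lborel_ball 1) t"
        for f g t :: "'a \<Rightarrow> real" and L q :: real
        using that by simp
      from this[OF i2 i3 iT] show ?thesis .
    qed
    also have "\<dots> \<le> l\<^sup>2 * hyp_D l u h + (M + 1) * (C * (l\<^sup>2 * hyp_D l u h) + P * \<delta>')"
    proof (rule add_mono)
      \<comment> \<open>The energy of \<open>v\<close> is discarded from the expansion of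
        \<open>hyp_D\<close>.\<close>
      have "0 \<le> l\<^sup>2 * (LINT x|lborel_ball 1. conf x ^ (DIM('a) - 2) * (norm (h' x))\<^sup>2)"
        using A0 by simp
      then show "?B / l\<^sup>2 - ?W \<le> l\<^sup>2 * hyp_D l u h"
        using hyp_D_expand(1)[OF admv N l(1)] unfolding Dv by linarith
      show "(M + 1) * integral\<^sup>L (lborel_ball 1) ?T \<le> (M + 1) * (C * (l\<^sup>2 * hyp_D l u h) + P * \<delta>')"
        using c M unfolding v_def by (intro mult_left_mono) auto
    qed
    also have "\<dots> = (1 + (M + 1) * C) * (l\<^sup>2 * hyp_D l u h) + (M + 1) * (P * \<delta>')"
      by (simp add: algebra_simps)
    also have "\<dots> \<le> (1 + (M + 1) * C) * (l\<^sup>2 * hyp_D l u h) + \<delta>"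
      using d'(2) by simp
    finally have "K * ?V \<le> K * ((1 + (M + 1) * C) * (l\<^sup>2 * hyp_D l u h) + \<delta>)"
      using K by (intro mult_left_mono) auto
    also have "\<dots> = (K * (1 + (M + 1) * C)) * (l\<^sup>2 * hyp_D l u h) + K * \<delta>"
      by (simp add: algebra_simps)
    also have "\<dots> \<le> l\<^sup>2 * hyp_D l u h + \<delta>"
      unfolding K(3) using K \<delta> by (simp add: mult_left_le_one_le)
    finally show "\<exists>c. K * (LINT x|lborel_ball 1. conf x ^ DIM('a) * (u x - c * hyp_gaussian l x)\<^sup>2)
       \<le> l\<^sup>2 * hyp_D l u h + \<delta>"
      unfolding v_def by blast
  qed
qed

section \<open>Functions modulo null sets\<close>

text \<open>\<open>hyp_volume\<close> is built on the completed Lebesgue measure, while the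
  arguments by translation and exchange of integrals above are carried out for Borel functions.
  Integrals are therefore moved to a Borel representative \<open>F\<close>; agreement is asked on
  the ball only, where the values of \<open>f\<close> matter.\<close>

lemma hyp_volume_transfer:
  fixes f F :: "'a::euclidean_space \<Rightarrow> real"
  assumes F[measurable]: "F \<in> borel_measurable borel" and ae: "AE x in lborel. x \<in> ball 0 1 \<longrightarrow> f x = F x"
  shows "integrable hyp_volume f \<longleftrightarrow> integrable (lborel_ball 1) (\<lambda>x. conf x ^ DIM('a) * F x)" (is ?I)
    and "(LINT x|hyp_volume. f x) = (LINT x|lborel_ball 1. conf x ^ DIM('a) * F x)" (is ?J)
proof -
  let ?i = "indicat_real (ball (0::'a) 1)"
  have iF: "(\<lambda>x. ?i x *\<^sub>R F x) \<in> borel_measurable lborel"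
    using F by (intro borel_measurable_scaleR borel_measurable_indicator) simp_all
  have B: "ball (0::'a) 1 \<inter> space lebesgue \<in> sets lebesgue" by simp
  have ae': "AE x in lebesgue. ?i x *\<^sub>R F x = ?i x *\<^sub>R f x"
    by (rule AE_completion) (use ae in \<open>eventually_elim, auto simp: indicator_def\<close>)
  have fm: "(\<lambda>x. ?i x *\<^sub>R f x) \<in> borel_measurable lebesgue"
    by (rule borel_measurable_AE[OF _ ae']) (rule measurable_completion[OF iF])
  have fr: "f \<in> borel_measurable (lebesgue_on (ball 0 1))"
    using fm by (subst borel_measurable_restrict_space_iff[OF B])
  have cm: "(\<lambda>x. (2 / (1 - (norm x)\<^sup>2)) ^ DIM('a)) \<in> borel_measurable (lebesgue_on (ball (0::'a) 1))"
    by (rule measurable_restrict_space1, rule measurable_completion) measurable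
  have c0: "AE x in lebesgue_on (ball (0::'a) 1). 0 \<le> (2 / (1 - (norm x)\<^sup>2)) ^ DIM('a)"
  proof (rule AE_I2)
    fix x :: 'a assume "x \<in> space (lebesgue_on (ball 0 1))"
    then have "norm x < 1" by (simp add: space_restrict_space)
    then have "0 \<le> conf x" using conf_ge_1[of x] by linarith
    then show "0 \<le> (2 / (1 - (norm x)\<^sup>2)) ^ DIM('a)" unfolding conf_def by (rule zero_le_power)
  qed
  have gm: "(\<lambda>x. ?i x *\<^sub>R (conf x ^ DIM('a) *\<^sub>R f x)) \<in> borel_measurable lebesgue"
  proof -
    have "(\<lambda>x. conf x ^ DIM('a) * (?i x *\<^sub>R f x)) \<in> borel_measurable lebesgue"
      by (intro borel_measurable_times fm measurable_completion) measurable
    then show ?thesis by (simp add: mult_ac)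
  qed
  have Gm: "(\<lambda>x. ?i x *\<^sub>R (conf x ^ DIM('a) * F x)) \<in> borel_measurable lborel"
    using F by (intro borel_measurable_scaleR borel_measurable_times borel_measurable_power borel_measurable_indicator) simp_all
  have gae: "AE x in lebesgue. ?i x *\<^sub>R (conf x ^ DIM('a) *\<^sub>R f x) = ?i x *\<^sub>R (conf x ^ DIM('a) * F x)"
    using ae' by eventually_elim (auto simp: indicator_def split: if_splits)
  have "integrable hyp_volume f \<longleftrightarrow> integrable (lebesgue_on (ball 0 1)) (\<lambda>x. conf x ^ DIM('a) *\<^sub>R f x)"
    unfolding hyp_volume_def conf_def using fr cm c0 by (rule integrable_density)
  also have "\<dots> \<longleftrightarrow> integrable lebesgue (\<lambda>x. ?i x *\<^sub>R (conf x ^ DIM('a) *\<^sub>R f x))"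
    by (rule integrable_restrict_space[OF B])
  also have "\<dots> \<longleftrightarrow> integrable lebesgue (\<lambda>x. ?i x *\<^sub>R (conf x ^ DIM('a) * F x))"
    by (rule integrable_cong_AE[OF gm measurable_completion[OF Gm] gae])
  also have "\<dots> \<longleftrightarrow> integrable lborel (\<lambda>x. ?i x *\<^sub>R (conf x ^ DIM('a) * F x))"
    by (rule integrable_completion[OF Gm])
  also have "\<dots> \<longleftrightarrow> integrable (lborel_ball 1) (\<lambda>x. conf x ^ DIM('a) * F x)"
    by (rule integrable_restrict_space[symmetric]) simp
  finally show ?I .
  have "(LINT x|hyp_volume. f x) = (LINT x|lebesgue_on (ball 0 1). conf x ^ DIM('a) *\<^sub>R f x)"
    unfolding hyp_volume_def conf_def using fr cm c0 by (rule integral_density)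
  also have "\<dots> = (LINT x|lebesgue. ?i x *\<^sub>R (conf x ^ DIM('a) *\<^sub>R f x))"
    by (rule integral_restrict_space[OF B])
  also have "\<dots> = (LINT x|lebesgue. ?i x *\<^sub>R (conf x ^ DIM('a) * F x))"
    by (rule integral_cong_AE[OF gm measurable_completion[OF Gm] gae])
  also have "\<dots> = (LINT x|lborel. ?i x *\<^sub>R (conf x ^ DIM('a) * F x))"
    by (rule integral_completion[OF Gm])
  also have "\<dots> = (LINT x|lborel_ball 1. conf x ^ DIM('a) * F x)"
    by (rule integral_restrict_space[symmetric]) simp
  finally show ?J .
qed

text \<open>The analogue for pairings with test functions; that \<open>F\<close> vanishes off the
  ball replaces the restriction of the integral.\<close>

lemma set_integral_transfer:
  fixes f F \<psi> :: "'a::euclidean_space \<Rightarrow> real"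
  assumes F: "F \<in> borel_measurable borel" and ae: "AE x in lborel. x \<in> ball 0 1 \<longrightarrow> f x = F x"
    and out: "\<And>x. x \<notin> ball 0 1 \<Longrightarrow> F x = 0" and \<psi>: "\<psi> \<in> borel_measurable borel"
  shows "(LINT x:ball 0 1|lebesgue. f x * \<psi> x) = (LINT x|lborel. F x * \<psi> x)"
proof -
  have Fm: "(\<lambda>x. F x * \<psi> x) \<in> borel_measurable lborel" using F \<psi> by simp
  have ae': "AE x in lebesgue. F x * \<psi> x = indicat_real (ball 0 1) x *\<^sub>R (f x * \<psi> x)"
    by (rule AE_completion) (use ae in \<open>eventually_elim, auto simp: indicator_def out\<close>)
  have "(LINT x:ball 0 1|lebesgue. f x * \<psi> x) = (LINT x|lebesgue. F x * \<psi> x)"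
    unfolding set_lebesgue_integral_def
    by (rule integral_cong_AE[symmetric, OF measurable_completion[OF Fm] borel_measurable_AE[OF measurable_completion[OF Fm] ae'] ae'])
  also have "\<dots> = (LINT x|lborel. F x * \<psi> x)" by (rule integral_completion[OF Fm])
  finally show ?thesis .
qed

lemma test_function_measurable:
  fixes \<phi> :: "'a::euclidean_space \<Rightarrow> real"
  assumes "test_function \<phi>" "i \<in> Basis"
  shows "\<phi> \<in> borel_measurable borel" "(\<lambda>x. frechet_derivative \<phi> (at x) i) \<in> borel_measurable borel"
proof -
  have "C_k 0 \<phi>" "C_k (Suc 0) \<phi>" using assms(1) unfolding test_function_def by blast+
  then show "\<phi> \<in> borel_measurable borel" "(\<lambda>x. frechet_derivative \<phi> (at x) i) \<in> borel_measurable borel"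
    using assms(2) by (auto intro!: borel_measurable_continuous_onI)
qed

text \<open>Local integrability speaks of compact subsets; closed balls of radius 1 - 1 / (n + 1)
  exhaust the open ball.\<close>

lemma locally_integrable_measurable:
  fixes g :: "'a::euclidean_space \<Rightarrow> 'b::euclidean_space"
  assumes "locally_integrable g"
  shows "(\<lambda>x. indicat_real (ball 0 1) x *\<^sub>R g x) \<in> borel_measurable lebesgue"
proof (rule borel_measurable_LIMSEQ_metric)
  fix n
  have "cball (0::'a) (1 - 1 / real (Suc n)) \<subseteq> ball 0 1"
    by (auto simp del: of_nat_Suc) (smt (verit) divide_pos_pos of_nat_0_less_iff zero_less_Suc)
  then have "g absolutely_integrable_on cball 0 (1 - 1 / real (Suc n))"
    using assms compact_cball unfolding locally_integrable_def by blast
  then show "(\<lambda>x. indicat_real (cball 0 (1 - 1 / real (Suc n))) x *\<^sub>R g x) \<in> borel_measurable lebesgue"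
    unfolding set_integrable_def by (rule borel_measurable_integrable)
next
  fix x :: 'a
  show "(\<lambda>n. indicat_real (cball 0 (1 - 1 / real (Suc n))) x *\<^sub>R g x) \<longlonglongrightarrow> indicat_real (ball 0 1) x *\<^sub>R g x"
  proof (cases "norm x < 1")
    case True
    have "(\<lambda>n. 1 - 1 / real (Suc n)) \<longlonglongrightarrow> 1 - 0"
      by (intro tendsto_diff tendsto_const LIMSEQ_Suc[OF lim_1_over_n])
    then have "\<forall>\<^sub>F n in sequentially. 1 - 1 / real (Suc n) > norm x"
      using True by (intro order_tendstoD(1)) auto
    then have "\<forall>\<^sub>F n in sequentially. indicat_real (cball 0 (1 - 1 / real (Suc n))) x *\<^sub>R g x = indicat_real (ball 0 1) x *\<^sub>R g x"
      by eventually_elim (use True in auto)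
    then show ?thesis by (rule tendsto_eventually)
  next
    case False
    have "indicat_real (cball 0 (1 - 1 / real (Suc n))) x = 0" for n
    proof -
      have "1 / real (Suc n) > 0" by simp
      then have "x \<notin> cball 0 (1 - 1 / real (Suc n))"
        using False unfolding mem_cball dist_0_norm by linarith
      then show ?thesis by simp
    qed
    then show ?thesis using False by simp
  qed
qed

lemma borel_version:
  fixes g :: "'a::euclidean_space \<Rightarrow> real"
  assumes "(\<lambda>x. indicat_real (ball 0 1) x *\<^sub>R g x) \<in> borel_measurable lebesgue"
  shows "\<exists>G\<in>borel_measurable borel. (AE x in lborel. x \<in> ball 0 1 \<longrightarrow> g x = G x) \<and> (\<forall>x. x \<notin> ball 0 1 \<longrightarrow> G x = 0)"
proof -
  obtain G0 where G0: "G0 \<in> borel_measurable lborel" "AE x in lborel. indicat_real (ball 0 1) x *\<^sub>R g x = G0 x"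
    using completion_ex_borel_measurable_real[OF assms] by blast
  then have G0m: "G0 \<in> borel_measurable borel" by simp
  define G where "G x = indicat_real (ball 0 1) x * G0 x" for x
  have "G \<in> borel_measurable borel"
    unfolding G_def[abs_def] using G0m by (intro borel_measurable_times borel_measurable_indicator) simp_all
  moreover have "AE x in lborel. x \<in> ball 0 1 \<longrightarrow> g x = G x"
    using G0(2) by eventually_elim (auto simp: G_def)
  moreover have "\<forall>x. x \<notin> ball 0 1 \<longrightarrow> G x = 0" by (simp add: G_def indicator_def)
  ultimately show ?thesis by blast
qed

lemma riem_norm_hyp_gradient:
  assumes "norm x < 1"
  shows "(riem_norm x (hyp_gradient u x))\<^sup>2 = (norm (weak_gradient u x))\<^sup>2 / (conf x)\<^sup>2"
proof -
  have p: "1 - (norm x)\<^sup>2 > 0" using one_minus_square_pos[of "norm x"] assms by simp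
  have "riem_norm x (hyp_gradient u x) = norm (weak_gradient u x) / conf x"
    using p by (simp add: riem_norm_def hyp_gradient_def conf_def power2_eq_square)
  then show ?thesis by (simp add: power_divide)
qed

lemma hyp_W12_admissible:
  fixes u :: "'a::euclidean_space \<Rightarrow> real"
  assumes u: "u \<in> hyp_W12" and mom: "integrable hyp_volume (\<lambda>x. (hyp_dist0 x)\<^sup>2 * \<bar>u x\<bar>\<^sup>2)"
    and N: "DIM('a) \<ge> 2"
  shows "\<exists>U H. hyp_admissible U H \<and> (AE x in lborel. x \<in> ball 0 1 \<longrightarrow> u x = U x) \<and>
    hyp_dirichlet u = (LINT x|lborel_ball 1. conf x ^ (DIM('a) - 2) * (norm (H x))\<^sup>2) \<and>
    hyp_moment u = (LINT x|lborel_ball 1. conf x ^ DIM('a) * ((hyp_dist0 x)\<^sup>2 * (U x)\<^sup>2))"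
proof -
  have L2: "u \<in> borel_measurable hyp_volume" "integrable hyp_volume (\<lambda>x. \<bar>u x\<bar>\<^sup>2)"
    and ex: "\<exists>g. has_weak_gradient u g"
    and Di: "integrable hyp_volume (\<lambda>x. (riem_norm x (hyp_gradient u x))\<^sup>2)"
    using u unfolding hyp_W12_def hyp_L2_def by auto
  define g where "g = weak_gradient u"
  \<comment> \<open>The element chosen by \<open>weak_gradient\<close> is a genuine weak gradient
    because \<open>hyp_W12\<close> guarantees that one exists.\<close>
  have g: "has_weak_gradient u g"
    unfolding g_def weak_gradient_def by (rule someI_ex[OF ex])
  have "locally_integrable u" and gl: "locally_integrable g"
    using g unfolding has_weak_gradient_def by auto
  from borel_version[OF locally_integrable_measurable[OF this(1)]]
  obtain U where U: "U \<in> borel_measurable borel" "AE x in lborel. x \<in> ball 0 1 \<longrightarrow> u x = U x"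
    "\<And>x. x \<notin> ball 0 1 \<Longrightarrow> U x = 0" by blast
  \<comment> \<open>Borel representatives are taken one component at a time, as
    \<open>borel_version\<close> concerns real functions, and reassembled over the basis.\<close>
  have "\<forall>i. \<exists>G. G \<in> borel_measurable borel \<and> (AE x in lborel. x \<in> ball 0 1 \<longrightarrow> g x \<bullet> i = G x) \<and> (\<forall>x. x \<notin> ball 0 1 \<longrightarrow> G x = 0)"
  proof (rule allI, rule borel_version[unfolded Bex_def])
    fix i
    have "(\<lambda>x. (indicat_real (ball 0 1) x *\<^sub>R g x) \<bullet> i) \<in> borel_measurable lebesgue"
      using locally_integrable_measurable[OF gl] by (intro borel_measurable_inner) simp_all
    then show "(\<lambda>x. indicat_real (ball 0 1) x *\<^sub>R (g x \<bullet> i)) \<in> borel_measurable lebesgue" by simp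
  qed
  from choice[OF this] obtain H0 where
    "\<forall>i. H0 i \<in> borel_measurable borel \<and> (AE x in lborel. x \<in> ball 0 1 \<longrightarrow> g x \<bullet> i = H0 i x) \<and> (\<forall>x. x \<notin> ball 0 1 \<longrightarrow> H0 i x = 0)"
    by (rule exE)
  then have H0: "\<And>i. H0 i \<in> borel_measurable borel"
    "\<And>i. AE x in lborel. x \<in> ball 0 1 \<longrightarrow> g x \<bullet> i = H0 i x" "\<And>i x. x \<notin> ball 0 1 \<Longrightarrow> H0 i x = 0"
    by blast+
  define H where "H x = (\<Sum>i\<in>Basis. H0 i x *\<^sub>R i)" for x
  have Hm: "H \<in> borel_measurable borel"
    unfolding H_def[abs_def] using H0(1) by (intro borel_measurable_sum borel_measurable_scaleR) simp_all
  have Hi: "H x \<bullet> i = H0 i x" if "i \<in> Basis" for x i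
    using that by (simp add: H_def inner_sum_left inner_Basis if_distrib sum.delta cong: if_cong)
  have Hout: "H x = 0" if "x \<notin> ball 0 1" for x
    using H0(3)[OF that] by (simp add: H_def)
  have "AE x in lborel. \<forall>i\<in>Basis. x \<in> ball 0 1 \<longrightarrow> g x \<bullet> i = H0 i x"
    using H0(2) by (intro AE_finite_allI) auto
  then have Hae: "AE x in lborel. x \<in> ball 0 1 \<longrightarrow> g x = H x"
  proof eventually_elim
    case (elim x)
    show ?case
    proof (rule impI, rule euclidean_eqI)
      fix i :: 'a assume "x \<in> ball 0 1" "i \<in> Basis"
      with elim show "g x \<bullet> i = H x \<bullet> i" by (simp only: Hi)
    qed
  qed
  have U2m: "(\<lambda>x. (U x)\<^sup>2) \<in> borel_measurable borel"
    and rU2m: "(\<lambda>x. (hyp_dist0 x)\<^sup>2 * (U x)\<^sup>2) \<in> borel_measurable borel"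
    and H2m: "(\<lambda>x. (norm (H x))\<^sup>2 / (conf x)\<^sup>2) \<in> borel_measurable borel"
    using U(1) Hm by (auto intro!: borel_measurable_times borel_measurable_power borel_measurable_divide)
  have U2ae: "AE x in lborel. x \<in> ball 0 1 \<longrightarrow> \<bar>u x\<bar>\<^sup>2 = (U x)\<^sup>2"
    and rU2ae: "AE x in lborel. x \<in> ball 0 1 \<longrightarrow> (hyp_dist0 x)\<^sup>2 * \<bar>u x\<bar>\<^sup>2 = (hyp_dist0 x)\<^sup>2 * (U x)\<^sup>2"
    using U(2) by (eventually_elim, auto)+
  have H2ae: "AE x in lborel. x \<in> ball 0 1 \<longrightarrow> (riem_norm x (hyp_gradient u x))\<^sup>2 = (norm (H x))\<^sup>2 / (conf x)\<^sup>2"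
    using Hae by eventually_elim (auto simp: riem_norm_hyp_gradient g_def[symmetric])
  have i1: "integrable (lborel_ball 1) (\<lambda>x. conf x ^ DIM('a) * (U x)\<^sup>2)"
    using L2(2) hyp_volume_transfer(1)[OF U2m U2ae] by simp
  have i2: "integrable (lborel_ball 1) (\<lambda>x. conf x ^ DIM('a) * ((hyp_dist0 x)\<^sup>2 * (U x)\<^sup>2))"
    using mom hyp_volume_transfer(1)[OF rU2m rU2ae] by simp
  \<comment> \<open>Here N \<ge> 2 makes the exponent N - 2, a difference of natural numbers, the
    true one.\<close>
  have pw: "conf x ^ DIM('a) * ((norm (H x))\<^sup>2 / (conf x)\<^sup>2) = conf x ^ (DIM('a) - 2) * (norm (H x))\<^sup>2"
    if "x \<in> space (lborel_ball 1)" for x :: 'a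
  proof -
    have "conf x \<noteq> 0" using conf_ge_1[of x] that by (auto simp: space_restrict_space)
    moreover have "conf x ^ DIM('a) = conf x ^ (DIM('a) - 2) * (conf x)\<^sup>2"
      using N by (metis le_add_diff_inverse2 power_add)
    ultimately show ?thesis by simp
  qed
  have i3: "integrable (lborel_ball 1) (\<lambda>x. conf x ^ (DIM('a) - 2) * (norm (H x))\<^sup>2)"
  proof -
    have "integrable (lborel_ball 1) (\<lambda>x. conf x ^ DIM('a) * ((norm (H x))\<^sup>2 / (conf x)\<^sup>2)) \<longleftrightarrow>
        integrable (lborel_ball 1) (\<lambda>x. conf x ^ (DIM('a) - 2) * (norm (H x))\<^sup>2)"
      by (rule Bochner_Integration.integrable_cong[OF refl]) (rule pw)
    then show ?thesis
      using Di unfolding hyp_volume_transfer(1)[OF H2m H2ae] by (rule iffD1)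
  qed
  have dir: "hyp_dirichlet u = (LINT x|lborel_ball 1. conf x ^ (DIM('a) - 2) * (norm (H x))\<^sup>2)"
    unfolding hyp_dirichlet_def hyp_volume_transfer(2)[OF H2m H2ae]
    by (rule Bochner_Integration.integral_cong[OF refl]) (rule pw)
  have momeq: "hyp_moment u = (LINT x|lborel_ball 1. conf x ^ DIM('a) * ((hyp_dist0 x)\<^sup>2 * (U x)\<^sup>2))"
    unfolding hyp_moment_def by (rule hyp_volume_transfer(2)[OF rU2m rU2ae])
  have ext: "integrable lborel f"
    if "integrable (lborel_ball 1) (\<lambda>x. conf x ^ k * f x)" "f \<in> borel_measurable borel" "\<And>x. x \<notin> ball 0 1 \<Longrightarrow> f x = 0"
    for f :: "'a \<Rightarrow> real" and k
  proof (rule Bochner_Integration.integrable_bound)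
    show "integrable lborel (\<lambda>x. indicat_real (ball 0 1) x *\<^sub>R (conf x ^ k * f x))"
      using that(1) by (subst (asm) integrable_restrict_space) simp_all
    show "f \<in> borel_measurable lborel" using that(2) by simp
    show "AE x in lborel. norm (f x) \<le> norm (indicat_real (ball 0 1) x *\<^sub>R (conf x ^ k * f x))"
    proof (rule AE_I2)
      fix x :: 'a
      show "norm (f x) \<le> norm (indicat_real (ball 0 1) x *\<^sub>R (conf x ^ k * f x))"
      proof (cases "x \<in> ball 0 1")
        case True
        then have c: "1 \<le> conf x" by (intro conf_ge_1) simp
        then have "1 * \<bar>f x\<bar> \<le> conf x ^ k * \<bar>f x\<bar>" by (intro mult_right_mono one_le_power) auto
        then show ?thesis using True c by (simp add: abs_mult)
      next
        case False
        then show ?thesis using that(3)[OF False] by simp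
      qed
    qed
  qed
  have wp: "weak_pair U H"
    unfolding weak_pair_def
  proof (intro conjI allI impI ballI)
    show "integrable lborel (\<lambda>x. (U x)\<^sup>2)"
      by (rule ext[OF i1 U2m]) (simp add: U(3))
    show "integrable lborel (\<lambda>x. (norm (H x))\<^sup>2)"
      by (rule ext[OF i3]) (use Hm Hout in \<open>auto intro!: borel_measurable_power\<close>)
    fix \<phi> :: "'a \<Rightarrow> real" and i :: 'a assume \<phi>: "test_function \<phi>" and i: "i \<in> Basis"
    have "(LINT x|lborel. U x * frechet_derivative \<phi> (at x) i) = (LINT x:hyp_ball|lebesgue. u x * frechet_derivative \<phi> (at x) i)"
      by (rule set_integral_transfer[symmetric, OF U(1,2,3) test_function_measurable(2)[OF \<phi> i]])
    also have "\<dots> = - (LINT x:hyp_ball|lebesgue. (g x \<bullet> i) * \<phi> x)"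
      using g \<phi> i unfolding has_weak_gradient_def by blast
    also have "(LINT x:hyp_ball|lebesgue. (g x \<bullet> i) * \<phi> x) = (LINT x|lborel. H0 i x * \<phi> x)"
      by (rule set_integral_transfer[OF H0 test_function_measurable(1)[OF \<phi> i]])
    finally show "(LINT x|lborel. U x * frechet_derivative \<phi> (at x) i) = - (LINT x|lborel. (H x \<bullet> i) * \<phi> x)"
      by (simp add: Hi i)
  qed (use U Hm Hout in auto)
  have "hyp_admissible U H"
    unfolding hyp_admissible_def using U(1) Hm i1 i2 i3 weak_pair_grad_approx[OF wp] by blast
  with U(2) dir momeq show ?thesis by blast
qed

section \<open>From stability to the deficits\<close>

lemma INF_square_le:
  fixes f :: "'b \<Rightarrow> real"
  assumes "S \<noteq> {}" "\<And>x. x \<in> S \<Longrightarrow> 0 \<le> f x"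
  shows "(INF x\<in>S. (f x)\<^sup>2) \<le> (INF x\<in>S. f x)\<^sup>2"
proof (rule ccontr)
  assume n: "\<not> ?thesis"
  have I0: "0 \<le> (INF x\<in>S. f x)" using assms by (intro cINF_greatest)
  \<comment> \<open>Some value of \<open>f\<close> lies below this root, and its square would lie
    below the infimum of the squares.\<close>
  have "(INF x\<in>S. f x) < sqrt (INF x\<in>S. (f x)\<^sup>2)"
    using n I0 by (intro real_less_rsqrt) simp
  moreover have "bdd_below (f ` S)" using assms(2) by (rule bdd_belowI2)
  ultimately obtain x where x: "x \<in> S" "f x < sqrt (INF x\<in>S. (f x)\<^sup>2)"
    using cINF_less_iff[OF assms(1), of f] by blast
  have "(f x)\<^sup>2 < (sqrt (INF x\<in>S. (f x)\<^sup>2))\<^sup>2"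
    using x assms(2) by (intro power_strict_mono) auto
  also have "\<dots> = (INF x\<in>S. (f x)\<^sup>2)"
    using assms(1) by (intro real_sqrt_pow2 cINF_greatest) auto
  also have "\<dots> \<le> (f x)\<^sup>2"
    using x(1) by (intro cINF_lower bdd_belowI2[of _ 0]) auto
  finally show False by simp
qed

lemma class_A_deficit:
  assumes N: "DIM('a::euclidean_space) \<ge> 2" and \<beta>: "\<beta> > 0"
  shows "\<exists>K>0. \<forall>u \<in> (class_A \<beta> :: ('a \<Rightarrow> real) set).
     0 \<le> (LINT x|hyp_volume. hyp_weight x * \<bar>u x\<bar>\<^sup>2) \<and>
     deficit2 u = deficit1 u * (deficit1 u + (LINT x|hyp_volume. hyp_weight x * \<bar>u x\<bar>\<^sup>2)) \<and>
     K * (INF (l, c) \<in> {0<..\<beta>} \<times> UNIV. LINT x|hyp_volume. \<bar>u x - c * hyp_gaussian l x\<bar>\<^sup>2) \<le> deficit1 u"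
proof -
  obtain K where K: "K > 0" and stab: "\<And>(u :: 'a \<Rightarrow> real) h l \<delta>. hyp_admissible u h \<Longrightarrow> 0 < l \<Longrightarrow> l \<le> \<beta> \<Longrightarrow> \<delta> > 0 \<Longrightarrow>
    \<exists>c. K * (LINT x|lborel_ball 1. conf x ^ DIM('a) * (u x - c * hyp_gaussian l x)\<^sup>2) \<le> l\<^sup>2 * hyp_D l u h + \<delta>"
    using hyp_stability[OF N \<beta>] by blast
  show ?thesis
  \<comment> \<open>Half the stability constant, because D is twice the first deficit.\<close>
  proof (rule exI[of _ "K / 2"], intro conjI ballI)
    show "K / 2 > 0" using K by simp
    fix u :: "'a \<Rightarrow> real" assume "u \<in> class_A \<beta>"
    then have u: "u \<in> hyp_W12" and nz: "\<not> (AE x in hyp_volume. u x = 0)"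
      and mom: "integrable hyp_volume (\<lambda>x. (hyp_dist0 x)\<^sup>2 * \<bar>u x\<bar>\<^sup>2)"
      and q: "hyp_moment u / hyp_dirichlet u \<le> \<beta> ^ 4"
      unfolding class_A_def by auto
    obtain U H where adm: "hyp_admissible U H" and ae: "AE x in lborel. x \<in> ball 0 1 \<longrightarrow> u x = U x"
      and Aeq: "hyp_dirichlet u = (LINT x|lborel_ball 1. conf x ^ (DIM('a) - 2) * (norm (H x))\<^sup>2)"
      and Beq: "hyp_moment u = (LINT x|lborel_ball 1. conf x ^ DIM('a) * ((hyp_dist0 x)\<^sup>2 * (U x)\<^sup>2))"
      using hyp_W12_admissible[OF u mom N] by blast
    have Um: "U \<in> borel_measurable borel" using adm unfolding hyp_admissible_def by simp
    define A where "A = hyp_dirichlet u"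
    define B where "B = hyp_moment u"
    define W where "W = (LINT x|hyp_volume. hyp_weight x * \<bar>u x\<bar>\<^sup>2)"
    have A0: "A \<ge> 0" by (simp add: A_def hyp_dirichlet_def)
    have B0: "B \<ge> 0" by (simp add: B_def hyp_moment_def)
    have Weq: "W = (LINT x|lborel_ball 1. conf x ^ DIM('a) * (hyp_weight x * (U x)\<^sup>2))"
      unfolding W_def
    proof (rule hyp_volume_transfer(2))
      show "(\<lambda>x. hyp_weight x * (U x)\<^sup>2) \<in> borel_measurable borel"
        using Um by (intro borel_measurable_times borel_measurable_power) simp_all
      show "AE x in lborel. x \<in> ball 0 1 \<longrightarrow> hyp_weight x * \<bar>u x\<bar>\<^sup>2 = hyp_weight x * (U x)\<^sup>2"
        using ae by eventually_elim auto
    qed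
    have wnn: "0 \<le> conf x ^ DIM('a) * (hyp_weight x * (U x)\<^sup>2)" if "x \<in> space (lborel_ball 1)" for x
    proof -
      have "norm x < 1" using that by (simp add: space_restrict_space)
      from conf_ge_1[OF this] hyp_weight_bounds(1)[OF this]
      have "0 \<le> conf x" "0 \<le> hyp_weight x" by linarith+
      then show ?thesis by simp
    qed
    \<comment> \<open>The condition u \<noteq> 0 enters here, as the weight is at least 1. Strict
      positivity then excludes the degenerate values A = 0 and B = 0.\<close>
    have W0: "W > 0"
    proof (rule ccontr)
      assume "\<not> W > 0"
      moreover have "W \<ge> 0" unfolding Weq using wnn by (intro integral_nonneg_AE AE_I2)
      ultimately have "W = 0" by simp
      then have "AE x in lborel_ball 1. conf x ^ DIM('a) * (hyp_weight x * (U x)\<^sup>2) = 0"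
        unfolding Weq
        by (subst (asm) integral_nonneg_eq_0_iff_AE[OF hyp_admissible_integrable(3)[OF adm N] AE_I2[OF wnn]])
      then have "AE x in lborel. x \<in> ball 0 1 \<longrightarrow> conf x ^ DIM('a) * (hyp_weight x * (U x)\<^sup>2) = 0"
        by (subst (asm) AE_restrict_space_iff) auto
      then have "AE x in lborel. x \<in> ball 0 1 \<longrightarrow> u x = 0"
        using ae
      proof eventually_elim
        case (elim x)
        show ?case
        proof
          assume x: "x \<in> ball 0 1"
          then have "norm x < 1" by simp
          from conf_ge_1[OF this] hyp_weight_bounds(1)[OF this] elim x show "u x = 0" by auto
        qed
      qed
      then have "AE x in lebesgue. x \<in> ball 0 1 \<longrightarrow> u x = 0"
        by (rule AE_completion)
      then have "AE x in lebesgue_on (ball 0 1). u x = 0"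
        by (subst AE_restrict_space_iff) auto
      then have "AE x in hyp_volume. u x = 0"
        unfolding hyp_volume_def
      proof (subst AE_density)
        show "(\<lambda>x. ennreal ((2 / (1 - (norm x)\<^sup>2)) ^ DIM('a))) \<in> borel_measurable (lebesgue_on (ball (0::'a) 1))"
          by (rule measurable_restrict_space1, rule measurable_completion) measurable
      qed (auto elim: eventually_mono)
      then show False using nz by contradiction
    qed
    have id: "l\<^sup>2 * hyp_D l U H = l\<^sup>2 * A + B / l\<^sup>2 - W" if "l > 0" for l
      using hyp_D_expand(1)[OF adm N that] by (simp add: A_def B_def Aeq Beq Weq)
    have D0: "0 \<le> l\<^sup>2 * hyp_D l U H" for l
    proof (intro mult_nonneg_nonneg)
      show "0 \<le> hyp_D l U H" unfolding hyp_D_def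
      proof (intro integral_nonneg_AE AE_I2)
        fix x :: 'a assume "x \<in> space (lborel_ball 1)"
        then have "conf x \<ge> 1" by (intro conf_ge_1) (simp add: space_restrict_space)
        then show "0 \<le> conf x ^ (DIM('a) - 2) * (norm (H x + (hyp_dist0 x * conf x * U x / (l\<^sup>2 * norm x)) *\<^sub>R x))\<^sup>2"
          by simp
      qed
    qed simp
    \<comment> \<open>The expansion at l^2 = t together with D \<ge> 0; since t is free, it detects
      a vanishing \<open>A\<close> or \<open>B\<close>.\<close>
    have Wt: "W \<le> t * A + B / t" if "t > 0" for t
      using id[of "sqrt t"] D0[of "sqrt t"] that by simp
    \<comment> \<open>The quotient in \<^const>\<open>class_A\<close> is \<open>0\<close> for \<open>A = 0\<close>, so this case has to be excluded.\<close>
    have "A \<noteq> 0"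
    proof
      assume "A = 0"
      \<comment> \<open>With A = 0 the bound reads W \<le> B / t; this t makes the right-hand side
        smaller than W, and B + 1 keeps it positive even for B = 0.\<close>
      then have "W \<le> B / (2 * (B + 1) / W)" using Wt[of "2 * (B + 1) / W"] W0 B0 by simp
      also have "\<dots> = W * (B / (2 * (B + 1)))" by simp
      also have "\<dots> < W * 1" using W0 B0 by (intro mult_strict_left_mono) (auto simp: divide_less_eq)
      finally show False by simp
    qed
    then have Ap: "A > 0" using A0 by simp
    have "B \<noteq> 0"
    proof
      assume "B = 0"
      \<comment> \<open>With B = 0 the bound reads W \<le> t A, contradicted by t = W / (2
        A).\<close>
      then have "W \<le> W / 2" using Wt[of "W / (2 * A)"] W0 Ap by simp
      then show False using W0 by simp
    qed
    then have Bp: "B > 0" using B0 by simp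
    \<comment> \<open>The balanced choice: both terms of l^2 A + B / l^2 equal sqrt A sqrt B, and
      their sum is minimal.\<close>
    define l where "l = sqrt (sqrt (B / A))"
    have l0: "l > 0" using Ap Bp by (simp add: l_def)
    have l2: "l\<^sup>2 = sqrt (B / A)" using Ap Bp by (simp add: l_def)
    have "l ^ 4 = (l\<^sup>2)\<^sup>2" by simp
    also have "\<dots> = B / A" unfolding l2 using Ap Bp by simp
    also have "\<dots> \<le> \<beta> ^ 4" using q by (simp add: A_def B_def)
    finally have l\<beta>: "l \<le> \<beta>" using \<beta> by (simp add: power_mono_iff[of l \<beta> 4] l0 less_imp_le)
    have "l\<^sup>2 * A = sqrt A * sqrt B"
    proof -
      have "sqrt (B / A) * A = sqrt B / sqrt A * (sqrt A * sqrt A)" using Ap by (simp add: real_sqrt_divide)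
      also have "\<dots> = sqrt A * sqrt B"
      proof -
        have "b / a * (a * a) = a * b" if "a > 0" for a b :: real using that by simp
        then show ?thesis using Ap by (simp only: real_sqrt_gt_0_iff)
      qed
      finally show ?thesis by (simp add: l2)
    qed
    moreover have "B / l\<^sup>2 = sqrt A * sqrt B"
    proof -
      have "B / sqrt (B / A) = (sqrt B * sqrt B) / (sqrt B / sqrt A)" using Bp by (simp add: real_sqrt_divide)
      also have "\<dots> = sqrt A * sqrt B"
      proof -
        have "b * b / (b / a) = a * b" if "b > 0" for a b :: real using that by simp
        then show ?thesis using Bp by (simp only: real_sqrt_gt_0_iff)
      qed
      finally show ?thesis by (simp add: l2)
    qed
    moreover have e1: "deficit1 u = sqrt A * sqrt B - 1 / 2 * W"
      by (simp only: deficit1_def A_def B_def W_def)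
    ultimately have d1: "2 * deficit1 u = l\<^sup>2 * hyp_D l U H"
      using id[OF l0] by simp
    show "0 \<le> (LINT x|hyp_volume. hyp_weight x * \<bar>u x\<bar>\<^sup>2)"
      unfolding W_def[symmetric] using W0 by simp
    have "(sqrt A * sqrt B) * (sqrt A * sqrt B) = A * B"
      using Ap Bp by (simp add: algebra_simps)
    moreover have "deficit2 u = A * B - 1 / 4 * W\<^sup>2"
      by (simp only: deficit2_def A_def B_def W_def)
    ultimately show "deficit2 u = deficit1 u * (deficit1 u + (LINT x|hyp_volume. hyp_weight x * \<bar>u x\<bar>\<^sup>2))"
      unfolding e1 W_def[symmetric] by (simp add: power2_eq_square algebra_simps)
    let ?f = "\<lambda>(l, c). LINT x|hyp_volume. \<bar>u x - c * hyp_gaussian l x\<bar>\<^sup>2"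
    have val: "?f (l, c) = (LINT x|lborel_ball 1. conf x ^ DIM('a) * (U x - c * hyp_gaussian l x)\<^sup>2)" for l c
      unfolding prod.case
    proof (rule hyp_volume_transfer(2))
      show "(\<lambda>x. (U x - c * hyp_gaussian l x)\<^sup>2) \<in> borel_measurable borel"
        using Um by (intro borel_measurable_power borel_measurable_diff borel_measurable_times) simp_all
      show "AE x in lborel. x \<in> ball 0 1 \<longrightarrow> \<bar>u x - c * hyp_gaussian l x\<bar>\<^sup>2 = (U x - c * hyp_gaussian l x)\<^sup>2"
        using ae by eventually_elim auto
    qed
    have "K * (INF p \<in> {0<..\<beta>} \<times> UNIV. ?f p) \<le> 2 * deficit1 u"
    \<comment> \<open>The witness \<open>c\<close> depends on the error, the infimum does not; so
      the error may tend to 0.\<close>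
    proof (rule field_le_epsilon)
      fix \<delta> :: real assume "\<delta> > 0"
      from stab[OF adm l0 l\<beta> this] obtain c where
        c: "K * (LINT x|lborel_ball 1. conf x ^ DIM('a) * (U x - c * hyp_gaussian l x)\<^sup>2) \<le> l\<^sup>2 * hyp_D l U H + \<delta>"
        by blast
      have "(INF p \<in> {0<..\<beta>} \<times> UNIV. ?f p) \<le> ?f (l, c)"
        using l0 l\<beta> by (intro cINF_lower bdd_belowI2[of _ 0]) auto
      then have "K * (INF p \<in> {0<..\<beta>} \<times> UNIV. ?f p) \<le> K * ?f (l, c)"
        using K by (intro mult_left_mono) auto
      also have "\<dots> \<le> 2 * deficit1 u + \<delta>" using c unfolding val d1 .
      finally show "K * (INF p \<in> {0<..\<beta>} \<times> UNIV. ?f p) \<le> 2 * deficit1 u + \<delta>" .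
    qed
    then show "K / 2 * (INF (l, c) \<in> {0<..\<beta>} \<times> UNIV. LINT x|hyp_volume. \<bar>u x - c * hyp_gaussian l x\<bar>\<^sup>2) \<le> deficit1 u"
      by simp
  qed
qed

theorem theorem1p8:
  fixes \<beta> :: real
  assumes "DIM('a::euclidean_space) \<ge> 2" and "\<beta> > 0"
  shows "\<exists>K>0. \<forall>u \<in> (class_A \<beta> :: ('a \<Rightarrow> real) set).
     deficit1 u \<ge>
       K * (INF (l, c) \<in> {0<..\<beta>} \<times> UNIV.
              LINT x|hyp_volume. \<bar>u x - c * hyp_gaussian l x\<bar>\<^sup>2) \<and>
     K * (INF (l, c) \<in> {0<..\<beta>} \<times> UNIV.
              LINT x|hyp_volume. \<bar>u x - c * hyp_gaussian l x\<bar>\<^sup>2) \<ge>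
       K * (INF (l, c) \<in> {0<..\<beta>} \<times> UNIV.
              (hyp_L2_norm (\<lambda>x. u x - c * hyp_gaussian l x))\<^sup>2) \<and>
     deficit2 u \<ge>
       K * (LINT x|hyp_volume. hyp_weight x * \<bar>u x\<bar>\<^sup>2) *
           (INF (l, c) \<in> {0<..\<beta>} \<times> UNIV.
              (hyp_L2_norm (\<lambda>x. u x - c * hyp_gaussian l x))\<^sup>2)
       + K\<^sup>2 * (INF (l, c) \<in> {0<..\<beta>} \<times> UNIV.
              (hyp_L2_norm (\<lambda>x. u x - c * hyp_gaussian l x)) ^ 4)"
proof -
  obtain K where K: "K > 0" and d: "\<And>u :: 'a \<Rightarrow> real. u \<in> class_A \<beta> \<Longrightarrow>
     0 \<le> (LINT x|hyp_volume. hyp_weight x * \<bar>u x\<bar>\<^sup>2) \<and>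
     deficit2 u = deficit1 u * (deficit1 u + (LINT x|hyp_volume. hyp_weight x * \<bar>u x\<bar>\<^sup>2)) \<and>
     K * (INF (l, c) \<in> {0<..\<beta>} \<times> UNIV. LINT x|hyp_volume. \<bar>u x - c * hyp_gaussian l x\<bar>\<^sup>2) \<le> deficit1 u"
    using class_A_deficit[OF assms] by blast
  show ?thesis
  proof (rule exI[of _ K], intro conjI[OF K] ballI)
    fix u :: "'a \<Rightarrow> real" assume u: "u \<in> class_A \<beta>"
    define S where "S = {0<..\<beta>} \<times> (UNIV :: real set)"
    have S: "S \<noteq> {}" using assms(2) by (auto simp: S_def intro!: exI[of _ \<beta>])
    define f where "f = (\<lambda>(l, c). LINT x|hyp_volume. \<bar>u x - c * hyp_gaussian l x\<bar>\<^sup>2)"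
    have f0: "0 \<le> f p" for p by (auto simp: f_def split: prod.split)
    define W where "W = (LINT x|hyp_volume. hyp_weight x * \<bar>u x\<bar>\<^sup>2)"
    define I where "I = (INF p\<in>S. f p)"
    have I0: "0 \<le> I" unfolding I_def using S f0 by (intro cINF_greatest) auto
    \<comment> \<open>The squared norm is the integral itself, so the second inequality of the chain
      holds with equality.\<close>
    have e2: "(\<lambda>(l, c). (hyp_L2_norm (\<lambda>x. u x - c * hyp_gaussian l x))\<^sup>2) = f"
      by (auto simp: f_def hyp_L2_norm_def)
    have e4: "(\<lambda>(l, c). (hyp_L2_norm (\<lambda>x. u x - c * hyp_gaussian l x)) ^ 4) = (\<lambda>p. (f p)\<^sup>2)"
    proof -
      have "t ^ 4 = (t\<^sup>2)\<^sup>2" for t :: real by simp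
      then show ?thesis by (auto simp: e2[symmetric])
    qed
    have "(INF p\<in>S. (f p)\<^sup>2) \<le> I\<^sup>2"
      unfolding I_def by (rule INF_square_le[OF S f0])
    moreover have d': "0 \<le> W" "deficit2 u = deficit1 u * (deficit1 u + W)" "K * I \<le> deficit1 u"
      using d[OF u] by (auto simp: W_def I_def S_def f_def)
    \<comment> \<open>For nonnegative arguments d (d + W) increases with d, so the lower bound K I
      of the first deficit may be inserted in both factors.\<close>
    moreover have "(K * I) * (K * I + W) \<le> deficit1 u * (deficit1 u + W)"
    proof (rule mult_mono)
      have "0 \<le> K * I" using K I0 by simp
      then show "0 \<le> deficit1 u" "0 \<le> K * I + W" using d' by linarith+
    qed (use d' in auto)
    ultimately have "K * W * I + K\<^sup>2 * (INF p\<in>S. (f p)\<^sup>2) \<le> deficit2 u"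
      using mult_left_mono[of "INF p\<in>S. (f p)\<^sup>2" "I\<^sup>2" "K\<^sup>2"] by (simp add: power2_eq_square algebra_simps)
    with d'(3) show "K * (INF (l, c) \<in> {0<..\<beta>} \<times> UNIV.
              LINT x|hyp_volume. \<bar>u x - c * hyp_gaussian l x\<bar>\<^sup>2) \<le> deficit1 u \<and>
       K * (INF (l, c) \<in> {0<..\<beta>} \<times> UNIV.
              (hyp_L2_norm (\<lambda>x. u x - c * hyp_gaussian l x))\<^sup>2)
         \<le> K * (INF (l, c) \<in> {0<..\<beta>} \<times> UNIV.
              LINT x|hyp_volume. \<bar>u x - c * hyp_gaussian l x\<bar>\<^sup>2) \<and>
       K * (LINT x|hyp_volume. hyp_weight x * \<bar>u x\<bar>\<^sup>2) *
           (INF (l, c) \<in> {0<..\<beta>} \<times> UNIV.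
              (hyp_L2_norm (\<lambda>x. u x - c * hyp_gaussian l x))\<^sup>2)
       + K\<^sup>2 * (INF (l, c) \<in> {0<..\<beta>} \<times> UNIV.
              (hyp_L2_norm (\<lambda>x. u x - c * hyp_gaussian l x)) ^ 4) \<le> deficit2 u"
      unfolding e2 e4 S_def[symmetric] W_def[symmetric] f_def[symmetric] I_def[symmetric] by simp
  qed
qed

end
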